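(* Let $X$ be an infinite-dimensional linear topological space whose underlying topological space belongs to the class $\mathcal{C}^\infty_{fd}$ (i.e. is a direct limit of an increasing sequence of finite-dimensional metrizable compacta). Then: (i) $X$ is homeomorphic to $\mathbb{R}^\infty$; (ii) if, in addition, $X$ is locally convex, then $X$ is linearly homeomorphic to $\mathbb{R}^\infty$, i.e. there is a linear bijection $X\to\mathbb{R}^\infty$ that is a homeomorphism.
   Context: Linear topological spaces are topological vector spaces over $\mathbb{R}$; "infinite-dimensional" for a linear space refers to linear (algebraic) dimension. Direct limit: given an increasing sequence of topological spaces $X_1\subset X_2\subset\cdots$ (each $X_n$ a topological subspace of $X_{n+1}$), the direct limit $\varinjlim X_n$ is the union $\bigcup_{n\in\mathbb{N}}X_n$ with the topology in which a set $U$ is open if and only if $U\cap X_n$ is open in $X_n$ for every $n\in\mathbb{N}$. $\mathbb{R}^\infty$ is the direct limit of $\mathbb{R}^1\subset\mathbb{R}^2\subset\mathbb{R}^3\subset\cdots$, where $\mathbb{R}^n\subset\mathbb{R}^{n+1}$ via $(x_1,\dots,x_n)\mapsto(x_1,\dots,x_n,0)$; with the natural coordinatewise linear operations it is a locally convex linear topological space. $\mathcal{C}^\infty_{fd}$ is the class of topological spaces that are (homeomorphic to) direct limits of increasing sequences $X_1\subset X_2\subset\cdots$ of finite-dimensional metrizable compact spaces, where finite-dimensional means of finite covering dimension. *)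

theory Defs
  imports "HOL-Analysis.Analysis"
begin

section \<open>Real topological vector spaces\<close>

text \<open>No separation axiom is required. Continuity of negation, part of
  \<^class>\<open>topological_ab_group_add\<close>, follows from that of scalar multiplication.\<close>

class linear_topological_space = real_vector + topological_ab_group_add +
  assumes tendsto_scaleR_Pair:
    "LIM x (nhds a \<times>\<^sub>F nhds b). fst x *\<^sub>R snd x :> nhds (a *\<^sub>R b)"

instance real_normed_vector \<subseteq> linear_topological_space
proof
  fix a :: real and b :: 'a
  have "((\<lambda>x. x) \<longlongrightarrow> (a, b)) (nhds (a, b))" by (rule filterlim_ident)
  from tendsto_scaleR[OF tendsto_fst[OF this] tendsto_snd[OF this]]
  show "LIM x (nhds a \<times>\<^sub>F nhds b). fst x *\<^sub>R snd x :> nhds (a *\<^sub>R b)"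
    by (simp add: nhds_prod)
qed

definition infinite_dimensional :: "'a::real_vector itself \<Rightarrow> bool" where
  "infinite_dimensional _ \<longleftrightarrow> \<not> (\<exists>B::'a set. finite B \<and> span B = UNIV)"

definition locally_convex :: "'a::linear_topological_space itself \<Rightarrow> bool" where
  "locally_convex _ \<longleftrightarrow>
    (\<forall>U::'a set. open U \<and> 0 \<in> U \<longrightarrow> (\<exists>V. open V \<and> convex V \<and> 0 \<in> V \<and> V \<subseteq> U))"

section \<open>Direct limits of increasing sequences of spaces\<close>

definition increasing_spaces :: "(nat \<Rightarrow> 'a topology) \<Rightarrow> bool" where
  "increasing_spaces X \<longleftrightarrow>
    (\<forall>n. topspace (X n) \<subseteq> topspace (X (Suc n)) \<and>
         subtopology (X (Suc n)) (topspace (X n)) = X n)"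

definition direct_limit :: "(nat \<Rightarrow> 'a topology) \<Rightarrow> 'a topology" where
  "direct_limit X =
    topology (\<lambda>U. U \<subseteq> (\<Union>n. topspace (X n)) \<and> (\<forall>n. openin (X n) (U \<inter> topspace (X n))))"

lemma openin_direct_limit:
  "openin (direct_limit X) U \<longleftrightarrow>
    U \<subseteq> (\<Union>n. topspace (X n)) \<and> (\<forall>n. openin (X n) (U \<inter> topspace (X n)))"
proof -
  have "istopology (\<lambda>U. U \<subseteq> (\<Union>n. topspace (X n)) \<and> (\<forall>n. openin (X n) (U \<inter> topspace (X n))))"
    unfolding istopology_def
  proof (intro conjI allI impI)
    fix S T n
    assume *: "S \<subseteq> (\<Union>n. topspace (X n)) \<and> (\<forall>n. openin (X n) (S \<inter> topspace (X n)))"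
      "T \<subseteq> (\<Union>n. topspace (X n)) \<and> (\<forall>n. openin (X n) (T \<inter> topspace (X n)))"
    have "S \<inter> T \<inter> topspace (X n) = (S \<inter> topspace (X n)) \<inter> (T \<inter> topspace (X n))" by auto
    with * show "openin (X n) (S \<inter> T \<inter> topspace (X n))" by (simp add: openin_Int)
  next
    fix \<K> n
    assume "\<forall>K\<in>\<K>. K \<subseteq> (\<Union>n. topspace (X n)) \<and> (\<forall>n. openin (X n) (K \<inter> topspace (X n)))"
    then have "openin (X n) (\<Union>K\<in>\<K>. K \<inter> topspace (X n))" by blast
    then show "openin (X n) (\<Union>\<K> \<inter> topspace (X n))" by (simp only: Int_Union2)
  qed auto
  then show ?thesis by (simp add: direct_limit_def)
qed

lemma topspace_direct_limit [simp]: "topspace (direct_limit X) = (\<Union>n. topspace (X n))"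
proof
  show "topspace (direct_limit X) \<subseteq> (\<Union>n. topspace (X n))"
    using openin_topspace[of "direct_limit X"] unfolding openin_direct_limit by (rule conjunct1)
  have "(\<Union>n. topspace (X n)) \<inter> topspace (X m) = topspace (X m)" for m by auto
  then have "openin (direct_limit X) (\<Union>n. topspace (X n))"
    by (simp add: openin_direct_limit)
  then show "(\<Union>n. topspace (X n)) \<subseteq> topspace (direct_limit X)" by (rule openin_subset)
qed

section \<open>The space \<open>\<real>\<^sup>\<infinity>\<close>\<close>

text \<open>Its points are the finitely supported real sequences; \<^term>\<open>Euclidean_space n\<close> is
  \<open>\<real>\<^sup>n\<close>, realised as the sequences vanishing from index \<open>n\<close> on.\<close>

definition R_infinity :: "(nat \<Rightarrow> real) topology" where
  "R_infinity = direct_limit (\<lambda>n. Euclidean_space (Suc n))"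

lemma increasing_spaces_Euclidean_space: "increasing_spaces (\<lambda>n. Euclidean_space (Suc n))"
  unfolding increasing_spaces_def Euclidean_space_def
  by (auto simp: subtopology_subtopology intro!: arg_cong2[where f=subtopology])

lemma topspace_R_infinity: "topspace R_infinity = {x. finite {i. x i \<noteq> 0}}"
proof -
  have "(\<exists>n. \<forall>i\<ge>Suc n. x i = 0) \<longleftrightarrow> finite {i. x i \<noteq> 0}" for x :: "nat \<Rightarrow> real"
  proof
    assume "\<exists>n. \<forall>i\<ge>Suc n. x i = 0"
    then obtain n where "\<forall>i\<ge>Suc n. x i = 0" by blast
    then have "{i. x i \<noteq> 0} \<subseteq> {..<Suc n}" using not_less by blast
    then show "finite {i. x i \<noteq> 0}" using finite_subset by blast
  next
    assume "finite {i. x i \<noteq> 0}"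
    then obtain n where "\<forall>i\<in>{i. x i \<noteq> 0}. i \<le> n" using finite_nat_set_iff_bounded_le by blast
    then show "\<exists>n. \<forall>i\<ge>Suc n. x i = 0" by (metis mem_Collect_eq not_less_eq_eq)
  qed
  then show ?thesis by (auto simp: R_infinity_def topspace_Euclidean_space)
qed

definition linear_homeomorphism_R_infinity ::
    "('a::linear_topological_space \<Rightarrow> nat \<Rightarrow> real) \<Rightarrow> bool" where
  "linear_homeomorphism_R_infinity f \<longleftrightarrow>
    (\<forall>x y. f (x + y) = (\<lambda>i. f x i + f y i)) \<and>
    (\<forall>c x. f (c *\<^sub>R x) = (\<lambda>i. c * f x i)) \<and>
    homeomorphic_map euclidean R_infinity f"

section \<open>Covering dimension and the class of direct limits of finite-dimensional compacta\<close>

definition covering_dim_le :: "'a topology \<Rightarrow> nat \<Rightarrow> bool" where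
  "covering_dim_le X n \<longleftrightarrow>
    (\<forall>\<U>. finite \<U> \<and> (\<forall>U\<in>\<U>. openin X U) \<and> \<Union>\<U> = topspace X \<longrightarrow>
      (\<exists>\<V>. finite \<V> \<and> (\<forall>V\<in>\<V>. openin X V) \<and> \<Union>\<V> = topspace X \<and>
           (\<forall>V\<in>\<V>. \<exists>U\<in>\<U>. V \<subseteq> U) \<and>
           (\<forall>x\<in>topspace X. card {V \<in> \<V>. x \<in> V} \<le> Suc n)))"

definition finite_covering_dim :: "'a topology \<Rightarrow> bool" where
  "finite_covering_dim X \<longleftrightarrow> (\<exists>n. covering_dim_le X n)"

definition fd_compacta_sequence :: "(nat \<Rightarrow> 'a topology) \<Rightarrow> bool" where
  "fd_compacta_sequence K \<longleftrightarrow>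
    increasing_spaces K \<and>
    (\<forall>n. compact_space (K n) \<and> metrizable_space (K n) \<and> finite_covering_dim (K n))"

text \<open>The sequence is taken on the point type of the space itself; this is no restriction, as
  lemma \<open>C_fd_infinityI\<close> below shows.\<close>

definition C_fd_infinity :: "'a topology \<Rightarrow> bool" where
  "C_fd_infinity X \<longleftrightarrow>
    (\<exists>K::nat \<Rightarrow> 'a topology. fd_compacta_sequence K \<and> X homeomorphic_space direct_limit K)"

lemma covering_dim_le_homeomorphic:
  assumes "X homeomorphic_space Y" "covering_dim_le X n"
  shows "covering_dim_le Y n"
  unfolding covering_dim_le_def
proof (intro allI impI)
  obtain f g where fg: "homeomorphic_maps X Y f g"
    using assms(1) by (auto simp: homeomorphic_space_def)
  then have f: "homeomorphic_map X Y f" and g: "homeomorphic_map Y X g"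
    using homeomorphic_maps_map by blast+
  have gf: "\<And>x. x \<in> topspace X \<Longrightarrow> g (f x) = x" and fg': "\<And>y. y \<in> topspace Y \<Longrightarrow> f (g y) = y"
    using fg by (auto simp: homeomorphic_maps_def)
  have fX: "f ` topspace X = topspace Y" and gY: "g ` topspace Y = topspace X"
    using f g homeomorphic_imp_surjective_map by blast+
  have fo: "openin Y (f ` U)" if "openin X U" for U
    using f that homeomorphic_map_openness openin_subset by blast
  have go: "openin X (g ` U)" if "openin Y U" for U
    using g that homeomorphic_map_openness openin_subset by blast
  fix \<U> assume \<U>: "finite \<U> \<and> (\<forall>U\<in>\<U>. openin Y U) \<and> \<Union>\<U> = topspace Y"
  have "finite ((`) g ` \<U>) \<and> (\<forall>U\<in>(`) g ` \<U>. openin X U) \<and> \<Union>((`) g ` \<U>) = topspace X"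
    using \<U> go gY by (metis (no_types, lifting) finite_imageI image_Union imageE)
  then obtain \<V> where \<V>: "finite \<V>" "\<forall>V\<in>\<V>. openin X V" "\<Union>\<V> = topspace X"
    "\<forall>V\<in>\<V>. \<exists>U\<in>(`) g ` \<U>. V \<subseteq> U" "\<forall>x\<in>topspace X. card {V \<in> \<V>. x \<in> V} \<le> Suc n"
    using assms(2)[unfolded covering_dim_le_def, rule_format, of "(`) g ` \<U>"] by auto
  have mem: "y \<in> f ` V \<longleftrightarrow> g y \<in> V" if "V \<in> \<V>" "y \<in> topspace Y" for V y
  proof -
    have "V \<subseteq> topspace X" using \<V>(3) that(1) by blast
    then show ?thesis using gf fg' that(2) by (metis image_iff subsetD)
  qed
  show "\<exists>\<V>. finite \<V> \<and> (\<forall>V\<in>\<V>. openin Y V) \<and> \<Union>\<V> = topspace Y \<and>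
      (\<forall>V\<in>\<V>. \<exists>U\<in>\<U>. V \<subseteq> U) \<and> (\<forall>x\<in>topspace Y. card {V \<in> \<V>. x \<in> V} \<le> Suc n)"
  proof (intro exI[of _ "(`) f ` \<V>"] conjI ballI)
    show "finite ((`) f ` \<V>)" using \<V>(1) by simp
    show "openin Y V" if "V \<in> (`) f ` \<V>" for V using that \<V>(2) fo by auto
    show "\<Union>((`) f ` \<V>) = topspace Y" using \<V>(3) fX by (metis image_Union)
    show "\<exists>U\<in>\<U>. W \<subseteq> U" if W: "W \<in> (`) f ` \<V>" for W
    proof -
      obtain V where V: "V \<in> \<V>" "W = f ` V" using W by auto
      then obtain U' where "U' \<in> (`) g ` \<U>" "V \<subseteq> U'" using \<V>(4) by metis
      then obtain U where "U \<in> \<U>" "V \<subseteq> g ` U" by (metis imageE)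
      moreover have "f ` g ` U = U"
      proof -
        have "U \<subseteq> topspace Y" using \<U> \<open>U \<in> \<U>\<close> by blast
        then have "\<forall>u\<in>U. f (g u) = u" using fg' by blast
        then show ?thesis by (auto simp: image_image)
      qed
      ultimately show ?thesis using V(2) by (metis image_mono)
    qed
    fix y assume y: "y \<in> topspace Y"
    then have "g y \<in> topspace X" using gY by blast
    have "{W \<in> (`) f ` \<V>. y \<in> W} \<subseteq> (`) f ` {V \<in> \<V>. g y \<in> V}"
    proof
      fix W assume "W \<in> {W \<in> (`) f ` \<V>. y \<in> W}"
      then obtain V where "V \<in> \<V>" "W = f ` V" "y \<in> f ` V" by auto
      then show "W \<in> (`) f ` {V \<in> \<V>. g y \<in> V}" using mem[of V y] y by simp
    qed
    then have "card {W \<in> (`) f ` \<V>. y \<in> W} \<le> card ((`) f ` {V \<in> \<V>. g y \<in> V})"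
      using \<V>(1) by (intro card_mono) simp_all
    also have "\<dots> \<le> card {V \<in> \<V>. g y \<in> V}"
      using \<V>(1) by (intro card_image_le) simp
    also have "\<dots> \<le> Suc n" using \<V>(5) \<open>g y \<in> topspace X\<close> by (rule bspec)
    finally show "card {W \<in> (`) f ` \<V>. y \<in> W} \<le> Suc n" .
  qed
qed

lemma C_fd_infinityI:
  fixes K :: "nat \<Rightarrow> 'b topology" and X :: "'a topology"
  assumes K: "fd_compacta_sequence K" and "X homeomorphic_space direct_limit K"
  shows "C_fd_infinity X"
proof -
  obtain g f where gf: "homeomorphic_maps X (direct_limit K) g f"
    using assms(2) by (auto simp: homeomorphic_space_def)
  define D where "D = (\<Union>n. topspace (K n))"
  have sub: "topspace (K n) \<subseteq> D" for n by (auto simp: D_def)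
  have fX: "f y \<in> topspace X" and gfy: "g (f y) = y" if "y \<in> D" for y
    using gf that by (auto simp: homeomorphic_maps_def D_def continuous_map_def)
  have gD: "g x \<in> D" and fgx: "f (g x) = x" if "x \<in> topspace X" for x
    using gf that by (auto simp: homeomorphic_maps_def D_def continuous_map_def)
  define L where "L n = pullback_topology (topspace X) g (K n)" for n
  have pre: "g -` U \<inter> topspace X = f ` U" if "U \<subseteq> D" for U
  proof (intro equalityI subsetI)
    fix x assume "x \<in> g -` U \<inter> topspace X"
    then show "x \<in> f ` U" using fgx by (metis IntD1 IntD2 imageI vimageD)
  next
    fix x assume "x \<in> f ` U"
    then obtain u where "u \<in> U" "x = f u" by blast
    moreover from this that have "u \<in> D" by blast
    ultimately show "x \<in> g -` U \<inter> topspace X" using fX gfy by simp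
  qed
  have KD: "U \<subseteq> D" if "openin (K n) U" for n U
    using that openin_subset sub by blast
  have L: "openin (L n) S \<longleftrightarrow> (\<exists>U. openin (K n) U \<and> S = f ` U)" for n S
    unfolding L_def openin_pullback_topology using pre[OF KD] by metis
  have tL: "topspace (L n) = f ` topspace (K n)" for n
    using pre[OF sub] by (simp add: L_def topspace_pullback_topology)
  have inj: "inj_on f D" using gfy by (metis inj_on_inverseI)
  have hom: "K n homeomorphic_space L n" for n
  proof -
    have "homeomorphic_map (K n) (L n) f"
    proof (rule bijective_open_imp_homeomorphic_map)
      show "continuous_map (K n) (L n) f"
        unfolding continuous_map_def
      proof (intro conjI allI impI)
        show "f \<in> topspace (K n) \<rightarrow> topspace (L n)" by (auto simp: tL)
        fix S assume "openin (L n) S"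
        then obtain U where U: "openin (K n) U" "S = f ` U" using L by blast
        have "x \<in> U" if "x \<in> topspace (K n)" "f x \<in> f ` U" for x
          using inj_on_image_mem_iff[OF inj _ KD[OF U(1)]] that sub by blast
        then have "{x \<in> topspace (K n). f x \<in> S} = U"
          using U(2) openin_subset[OF U(1)] by blast
        then show "openin (K n) {x \<in> topspace (K n). f x \<in> S}" using U by simp
      qed
      show "open_map (K n) (L n) f" by (auto simp: open_map_def L)
      show "f ` topspace (K n) = topspace (L n)" by (simp add: tL)
      show "inj_on f (topspace (K n))" using inj sub inj_on_subset by blast
    qed
    then show ?thesis by (rule homeomorphic_map_imp_homeomorphic_space)
  qed
  have incK: "topspace (K n) \<subseteq> topspace (K (Suc n))"
    "subtopology (K (Suc n)) (topspace (K n)) = K n" for n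
    using K by (auto simp: fd_compacta_sequence_def increasing_spaces_def)
  have "subtopology (L (Suc n)) (topspace (L n)) = L n" for n
  proof -
    have "openin (subtopology (L (Suc n)) (topspace (L n))) S \<longleftrightarrow> openin (L n) S" for S
    proof -
      have *: "f ` U \<inter> f ` topspace (K n) = f ` (U \<inter> topspace (K n))"
        if "openin (K (Suc n)) U" for U
      proof -
        have "U \<subseteq> D" using that openin_subset sub by blast
        then show ?thesis using inj_on_image_Int[OF inj _ sub] by blast
      qed
      have "openin (subtopology (L (Suc n)) (topspace (L n))) S \<longleftrightarrow>
          (\<exists>U. openin (K (Suc n)) U \<and> S = f ` U \<inter> f ` topspace (K n))"
        by (auto simp: openin_subtopology L tL)
      also have "\<dots> \<longleftrightarrow> (\<exists>U. openin (K (Suc n)) U \<and> S = f ` (U \<inter> topspace (K n)))"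
        using * by metis
      also have "\<dots> \<longleftrightarrow> (\<exists>V. openin (subtopology (K (Suc n)) (topspace (K n))) V \<and> S = f ` V)"
        by (auto simp: openin_subtopology)
      also have "\<dots> \<longleftrightarrow> openin (L n) S" by (simp add: incK L)
      finally show ?thesis .
    qed
    then show ?thesis by (simp add: topology_eq)
  qed
  moreover have "topspace (L n) \<subseteq> topspace (L (Suc n))" for n
    using incK by (simp add: tL image_mono)
  moreover have "compact_space (L n) \<and> metrizable_space (L n) \<and> finite_covering_dim (L n)" for n
    using K hom[of n] covering_dim_le_homeomorphic
    unfolding fd_compacta_sequence_def finite_covering_dim_def
    by (metis homeomorphic_compact_space homeomorphic_metrizable_space)
  ultimately have "fd_compacta_sequence L"
    by (simp add: fd_compacta_sequence_def increasing_spaces_def)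
  moreover have "X = direct_limit L"
    unfolding topology_eq
  proof
    fix S
    have X: "topspace X = (\<Union>n. topspace (L n))"
    proof -
      have "topspace X = f ` D" using pre[of D] gD by blast
      then show ?thesis by (auto simp: tL D_def)
    qed
    show "openin X S \<longleftrightarrow> openin (direct_limit L) S"
    proof (cases "S \<subseteq> topspace X")
      case True
      have "homeomorphic_map X (direct_limit K) g" using gf homeomorphic_maps_map by blast
      then have "openin X S \<longleftrightarrow> openin (direct_limit K) (g ` S)"
        using True homeomorphic_map_openness by blast
      also have "\<dots> \<longleftrightarrow> (\<forall>n. openin (K n) (g ` S \<inter> topspace (K n)))"
        using True gD by (auto simp: openin_direct_limit D_def)
      also have "\<dots> \<longleftrightarrow> (\<forall>n. openin (L n) (S \<inter> topspace (L n)))"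
      proof -
        have eq: "f ` (g ` S \<inter> topspace (K n)) = S \<inter> topspace (L n)" for n
        proof -
          have "g ` S \<subseteq> D" using True gD by blast
          moreover have "f ` g ` S = S" using True fgx by (auto simp: image_image subset_iff)
          ultimately show ?thesis using inj_on_image_Int[OF inj _ sub] tL by metis
        qed
        have "openin (K n) (g ` S \<inter> topspace (K n)) \<longleftrightarrow> openin (L n) (S \<inter> topspace (L n))" for n
        proof
          assume "openin (L n) (S \<inter> topspace (L n))"
          then obtain U where U: "openin (K n) U" "f ` U = f ` (g ` S \<inter> topspace (K n))"
            using L eq by metis
          have "U \<subseteq> D" using U(1) openin_subset sub by blast
          then have "U = g ` S \<inter> topspace (K n)"
            using U(2) inj_on_image_eq_iff[OF inj] sub by (meson Int_lower2 order_trans)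
          then show "openin (K n) (g ` S \<inter> topspace (K n))" using U(1) by simp
        qed (use L eq in metis)
        then show ?thesis by simp
      qed
      finally show ?thesis using True X by (simp add: openin_direct_limit)
    next
      case False
      then show ?thesis using X openin_subset[of X S] by (auto simp: openin_direct_limit)
    qed
  qed
  ultimately show ?thesis
    unfolding C_fd_infinity_def using homeomorphic_space_refl by blast
qed

end

theory Submission
  imports Defs "HOL-Homology.Invariance_of_Domain"
begin

text \<open>A compact subset of the space \<open>X\<close> lies in one of the given compacta, so it embeds into some
  \<open>\<real>\<^sup>k\<close> and, by invariance of domain, contains no cube of dimension above \<open>k\<close>. Applied to the
  compactum \<open>[-1,1] (K - K)\<close>, together with Baire's theorem in a cube of large dimension, this
  yields for every compact \<open>K\<close> a direction \<open>y\<close> such that the translates of \<open>K\<close> by distinct multiples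
  of \<open>y\<close> are disjoint. An embedding into \<open>X\<close> of a closed subset of a cube extends over the cube: first
  to a map, by Dugundji's formula with a cover of bounded order (which makes local convexity
  unnecessary), then to an embedding by adding suitable multiples of finitely many such directions.
  The same extension property of \<open>\<real>\<^sup>\<infinity>\<close> follows from Tietze's theorem, and a back-and-forth
  argument gives the homeomorphism.

  If \<open>X\<close> is locally convex, every compactum \<open>K\<close> spans a finite-dimensional space, for otherwise a
  null sequence of independent multiples of points of \<open>K\<close> has its convex hull inside a
  compactum, which then contains cubes of all dimensions. So \<open>X\<close> has a countable basis, and the
  coordinate map is the linear homeomorphism.\<close>

section \<open>General position\<close>

text \<open>Without local convexity a convex combination of small vectors need not be small, unless
  the number of its terms is bounded. Hence the order of the cover used for averaging is fixed in
  advance. The covering dimension of the compacta is converted once, by the Menger-Noebeling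
  argument of successive perturbations into general position, into embeddings into Euclidean spaces;
  afterwards only these embeddings are used. Baire's theorem is applied in a finite-dimensional cube
  mapped into \<open>X\<close>, since an infinite-dimensional \<open>X\<close> that is a countable
  union of compacta is not itself a Baire space. A direction \<open>y\<close> with disjoint
  translates serves as an extra coordinate: the map g + u y determines both g and the real function
  u. In this way enough functions to separate the points of a cube can be added to a map into
  \<open>X\<close>, and if they vanish on a closed set the map is unchanged there.\<close>

lemma homogeneous_system_nontrivial_solution:
  fixes a :: "'i \<Rightarrow> 'l \<Rightarrow> real"
  assumes "finite J" "finite L" "card J < card L"
  shows "\<exists>w. (\<exists>l\<in>L. w l \<noteq> 0) \<and> (\<forall>i\<in>J. (\<Sum>l\<in>L. w l * a i l) = 0)"
  using assms
proof (induction J arbitrary: L a rule: finite_induct)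
  case empty
  then obtain l where "l \<in> L" by fastforce
  then show ?case by (intro exI[of _ "\<lambda>_. 1"]) auto
next
  case (insert i J)
  show ?case
  proof (cases "\<forall>l\<in>L. a i l = 0")
    case True
    have "card J < card L" using insert by simp
    from insert.IH[OF insert.prems(1) this, of a] True show ?thesis by auto
  next
    case False
    then obtain p where p: "p \<in> L" "a i p \<noteq> 0" by blast
    \<comment> \<open>Gaussian elimination: \<open>a'\<close> is the system after equation
      \<open>i\<close> has been used to remove the unknown \<open>p\<close>. Its solution is
      completed at \<open>p\<close> in \<open>v\<close>.\<close>
    define a' where "a' j l = a j l - a j p / a i p * a i l" for j l
    have "card J < card (L - {p})" using insert p by simp
    from insert.IH[OF _ this, of a'] insert.prems(1) obtain w where
      w: "\<exists>l\<in>L - {p}. w l \<noteq> 0" "\<forall>j\<in>J. (\<Sum>l\<in>L - {p}. w l * a' j l) = 0" by auto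
    define v where "v = w(p := - (\<Sum>l\<in>L - {p}. w l * a i l) / a i p)"
    have split: "(\<Sum>l\<in>L. v l * a j l) =
        - (\<Sum>l\<in>L - {p}. w l * a i l) / a i p * a j p + (\<Sum>l\<in>L - {p}. w l * a j l)" for j
      using insert.prems(1) p(1) by (simp add: sum.remove[of L p] v_def)
    have "(\<Sum>l\<in>L. v l * a j l) = 0" if "j \<in> J" for j
    proof -
      have "(\<Sum>l\<in>L - {p}. w l * a' j l) =
          (\<Sum>l\<in>L - {p}. w l * a j l) - a j p / a i p * (\<Sum>l\<in>L - {p}. w l * a i l)"
        by (simp add: a'_def sum_subtractf[symmetric] sum_distrib_left algebra_simps)
      then show ?thesis using w(2) that split[of j] by (simp add: field_simps)
    qed
    moreover have "(\<Sum>l\<in>L. v l * a i l) = 0" using split[of i] p(2) by simp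
    moreover have "\<exists>l\<in>L. v l \<noteq> 0" using w(1) by (auto simp: v_def)
    ultimately show ?thesis by blast
  qed
qed

text \<open>The points are chosen one at a time. A new point has to avoid the span of every set of
  fewer than \<open>k\<close> earlier ones; it is enough that, for each such set, one nonzero
  functional vanishing on the set does not vanish at the new point.\<close>

lemma perturb_to_general_position:
  fixes q :: "'i \<Rightarrow> nat \<Rightarrow> real"
  assumes "finite I" "e > 0"
  shows "\<exists>p. (\<forall>i\<in>I. \<forall>l<k. \<bar>p i l - q i l\<bar> < e) \<and>
    (\<forall>J c. J \<subseteq> I \<longrightarrow> card J \<le> k \<longrightarrow> (\<forall>l<k. (\<Sum>i\<in>J. c i * p i l) = 0) \<longrightarrow> (\<forall>i\<in>J. c i = 0))"
  using assms(1)
proof (induction I rule: finite_induct)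
  case empty
  then show ?case by auto
next
  case (insert i I)
  then obtain p where p1: "\<forall>i\<in>I. \<forall>l<k. \<bar>p i l - q i l\<bar> < e"
    and p2: "\<And>J c. J \<subseteq> I \<Longrightarrow> card J \<le> k \<Longrightarrow> (\<forall>l<k. (\<Sum>i\<in>J. c i * p i l) = 0) \<Longrightarrow> (\<forall>i\<in>J. c i = 0)"
    by blast
  define \<J> where "\<J> = {J. J \<subseteq> I \<and> card J < k}"
  have finJ: "finite \<J>" using insert(1) by (simp add: \<J>_def)
  have "\<forall>J\<in>\<J>. \<exists>w. (\<exists>l<k. w l \<noteq> 0) \<and> (\<forall>i\<in>J. (\<Sum>l<k. w l * p i l) = 0)"
  proof
    fix J assume "J \<in> \<J>"
    then have "finite J" "card J < card {..<k}"
      using insert(1) finite_subset by (auto simp: \<J>_def)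
    from homogeneous_system_nontrivial_solution[OF this(1) _ this(2), of p]
    show "\<exists>w. (\<exists>l<k. w l \<noteq> 0) \<and> (\<forall>i\<in>J. (\<Sum>l<k. w l * p i l) = 0)" by auto
  qed
  then obtain w where w: "\<And>J. J \<in> \<J> \<Longrightarrow> \<exists>l<k. w J l \<noteq> 0"
    "\<And>J i. J \<in> \<J> \<Longrightarrow> i \<in> J \<Longrightarrow> (\<Sum>l<k. w J l * p i l) = 0" by metis
  \<comment> \<open>\<open>poly (P J) t\<close> is the value of the functional \<open>w J\<close> at
    the point (1, t, t^2, ...) of the moment curve. As a nonzero polynomial it has finitely many
    roots, so one \<open>t\<close> serves for all \<open>J\<close>.\<close>
  define P where "P J = (\<Sum>l<k. Polynomial.monom (w J l) l)" for J
  have P: "poly (P J) t = (\<Sum>l<k. w J l * t ^ l)" for J t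
    by (simp add: P_def poly_sum Polynomial.poly_monom)
  have "Polynomial.coeff (P J) l = w J l" if "l < k" for J l
    using that by (simp add: P_def Polynomial.coeff_sum Polynomial.coeff_monom)
  then have "P J \<noteq> 0" if "J \<in> \<J>" for J using w(1)[OF that] by (metis Polynomial.coeff_0)
  then have "finite (\<Union>J\<in>\<J>. {t. poly (P J) t = 0})"
    using finJ poly_roots_finite by blast
  from ex_new_if_finite[OF infinite_UNIV_char_0 this] obtain t where
    t: "\<And>J. J \<in> \<J> \<Longrightarrow> poly (P J) t \<noteq> 0" by blast
  define M where "M = 1 + (\<Sum>l<k. \<bar>t ^ l\<bar>)"
  have M: "M > 0" unfolding M_def by (simp add: add_pos_nonneg sum_nonneg)
  \<comment> \<open>The finitely many step lengths in the direction (1, t, t^2, ...) that would put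
    the new point into the kernel of some \<open>w J\<close>. Steps below \<open>e / M\<close> stay
    within \<open>e\<close> of \<open>q i\<close>.\<close>
  let ?bad = "(\<lambda>J. - (\<Sum>l<k. w J l * q i l) / poly (P J) t) ` \<J>"
  have "infinite ({0<..<e / M} - ?bad)"
    using finJ M assms(2) by (intro Diff_infinite_finite) (auto simp: infinite_Ioo)
  then obtain s where "s \<in> {0<..<e / M} - ?bad" using infinite_imp_nonempty[of "{0<..<e / M} - ?bad"] by blast
  then have s: "0 < s" "s < e / M"
    "\<And>J. J \<in> \<J> \<Longrightarrow> s \<noteq> - (\<Sum>l<k. w J l * q i l) / poly (P J) t" by auto
  define p' where "p' = p(i := \<lambda>l. q i l + s * t ^ l)"
  have pi: "(\<Sum>l<k. w J l * p' i l) \<noteq> 0" if "J \<in> \<J>" for J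
  proof -
    have "(\<Sum>l<k. w J l * p' i l) = (\<Sum>l<k. w J l * q i l) + s * poly (P J) t"
      by (simp add: p'_def P sum.distrib sum_distrib_left algebra_simps)
    then show ?thesis using s(3)[OF that] t[OF that] by (auto simp: field_simps)
  qed
  have p'I: "p' j = p j" if "j \<in> I" for j using that insert(2) by (auto simp: p'_def)
  show ?case
  proof (intro exI[of _ p'] conjI ballI allI impI)
    fix j l assume "j \<in> insert i I" "l < k"
    moreover have "\<bar>s * t ^ l\<bar> < e" if "l < k"
    proof -
      have "\<bar>t ^ l\<bar> \<le> (\<Sum>l<k. \<bar>t ^ l\<bar>)" using that by (intro member_le_sum) auto
      then have "\<bar>t ^ l\<bar> \<le> M" by (simp add: M_def)
      then have "s * \<bar>t ^ l\<bar> \<le> s * M" using s(1) by (intro mult_left_mono) auto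
      also have "\<dots> < e" using s(2) M by (simp add: field_simps)
      finally show ?thesis using s(1) by (simp add: abs_mult)
    qed
    ultimately show "\<bar>p' j l - q j l\<bar> < e" using p1 by (auto simp: p'_def)
  next
    fix J c j assume J: "J \<subseteq> insert i I" "card J \<le> k" "\<forall>l<k. (\<Sum>i\<in>J. c i * p' i l) = 0" "j \<in> J"
    have finJ': "finite J" using J(1) insert(1) finite_subset by blast
    define J' where "J' = J - {i}"
    have J'I: "J' \<subseteq> I" using J(1) by (auto simp: J'_def)
    have sub: "\<forall>j\<in>J'. c j = 0" if "\<forall>l<k. (\<Sum>i\<in>J'. c i * p' i l) = 0"
    proof (rule p2[OF J'I])
      show "card J' \<le> k" using J(2) card_mono[of J J'] finJ' by (simp add: J'_def)
      have "(\<Sum>i\<in>J'. c i * p i l) = (\<Sum>i\<in>J'. c i * p' i l)" for l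
        using J'I p'I by (intro sum.cong) auto
      then show "\<forall>l<k. (\<Sum>i\<in>J'. c i * p i l) = 0" using that by simp
    qed
    show "c j = 0"
    proof (cases "i \<in> J")
      case False
      then have "J' = J" by (simp add: J'_def)
      then show ?thesis using sub J by auto
    next
      case True
      then have "card J' < k" using J(2) card_Diff1_less[OF finJ' True] by (simp add: J'_def)
      then have J': "J' \<in> \<J>" using J'I by (simp add: \<J>_def)
      have "(\<Sum>i\<in>J. c i * p' i l) = c i * p' i l + (\<Sum>i\<in>J'. c i * p' i l)" for l
        using finJ' True by (simp add: J'_def sum.remove)
      then have eq: "c i * p' i l + (\<Sum>i\<in>J'. c i * p' i l) = 0" if "l < k" for l
        using J(3) that by simp
      \<comment> \<open>Applying the functional \<open>w J'\<close> to the linear relation kills the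
        terms of \<open>J'\<close> and isolates \<open>c i\<close>.\<close>
      have "(\<Sum>l<k. w J' l * (\<Sum>i\<in>J'. c i * p' i l)) = (\<Sum>i\<in>J'. c i * (\<Sum>l<k. w J' l * p' i l))"
        by (simp add: sum_distrib_left sum.swap[of _ J'] algebra_simps)
      also have "\<dots> = 0"
        using w(2)[OF J'] J'I p'I by (intro sum.neutral) (metis mult_zero_right subsetD)
      finally have "(\<Sum>l<k. w J' l * (c i * p' i l)) + 0 =
          (\<Sum>l<k. w J' l * (c i * p' i l + (\<Sum>i\<in>J'. c i * p' i l)))"
        by (simp add: distrib_left sum.distrib)
      also have "\<dots> = 0" using eq by simp
      finally have "c i * (\<Sum>l<k. w J' l * p' i l) = 0"
        by (simp add: sum_distrib_left algebra_simps)
      then have ci: "c i = 0" using pi[OF J'] by simp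
      then show ?thesis using sub eq J(4) by (auto simp: J'_def)
    qed
  qed
qed

section \<open>Fine covers of bounded order and embeddings into Euclidean spaces\<close>

text \<open>A metric form of having dimension at most N - 1, for compact \<open>K\<close>: the bound
  \<open>N\<close> on the order is the same for every mesh \<open>e\<close>. The members are open in
  the whole space, but mesh and order are measured on \<open>K\<close> alone.\<close>

definition fine_covers :: "'b::metric_space set \<Rightarrow> nat \<Rightarrow> bool" where
  "fine_covers K N \<longleftrightarrow> (\<forall>e>0. \<exists>\<C>. finite \<C> \<and>
     (\<forall>U\<in>\<C>. open U \<and> (\<forall>x\<in>U \<inter> K. \<forall>y\<in>U \<inter> K. dist x y < e)) \<and> K \<subseteq> \<Union>\<C> \<and>
     (\<forall>x\<in>K. card {U\<in>\<C>. x \<in> U} \<le> N))"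

lemma fine_covers_partition_of_unity:
  fixes K :: "'b::metric_space set"
  assumes "fine_covers K N" "e > 0"
  obtains \<C> :: "'b set set" and \<phi> where "finite \<C>" "\<And>U. U \<in> \<C> \<Longrightarrow> continuous_on K (\<phi> U)"
    "\<And>U x. U \<in> \<C> \<Longrightarrow> x \<in> K \<Longrightarrow> (0::real) \<le> \<phi> U x" "\<And>x. x \<in> K \<Longrightarrow> (\<Sum>U\<in>\<C>. \<phi> U x) = 1"
    "\<And>x. x \<in> K \<Longrightarrow> card {U\<in>\<C>. \<phi> U x \<noteq> 0} \<le> N"
    "\<And>U x y. U \<in> \<C> \<Longrightarrow> x \<in> K \<Longrightarrow> y \<in> K \<Longrightarrow> \<phi> U x \<noteq> 0 \<Longrightarrow> \<phi> U y \<noteq> 0 \<Longrightarrow> dist x y < e"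
proof -
  obtain \<C> where "finite \<C> \<and>
     (\<forall>U\<in>\<C>. open U \<and> (\<forall>x\<in>U \<inter> K. \<forall>y\<in>U \<inter> K. dist x y < e)) \<and> K \<subseteq> \<Union>\<C> \<and>
     (\<forall>x\<in>K. card {U\<in>\<C>. x \<in> U} \<le> N)"
    using assms(1)[unfolded fine_covers_def, THEN spec, THEN mp, OF assms(2)] by (rule exE)
  then have C: "finite \<C>" "\<And>U. U \<in> \<C> \<Longrightarrow> open U"
    "\<And>U x y. U \<in> \<C> \<Longrightarrow> x\<in>U \<inter> K \<Longrightarrow> y\<in>U \<inter> K \<Longrightarrow> dist x y < e" "K \<subseteq> \<Union>\<C>"
    "\<And>x. x\<in>K \<Longrightarrow> card {U\<in>\<C>. x \<in> U} \<le> N"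
    by simp_all
  obtain F :: "'b set \<Rightarrow> 'b \<Rightarrow> real" where F: "\<And>U. U \<in> \<C> \<Longrightarrow> continuous_on K (F U) \<and> (\<forall>x \<in> K. 0 \<le> F U x)"
      "\<And>x U. \<lbrakk>U \<in> \<C>; x \<in> K; x \<notin> U\<rbrakk> \<Longrightarrow> F U x = (0::real)"
      "\<And>x. x \<in> K \<Longrightarrow> supp_sum (\<lambda>W. F W x) \<C> = 1"
  proof (rule subordinate_partition_of_unity[OF C(4) C(2)])
    fix x assume "x \<in> K"
    then show "\<exists>V. open V \<and> x \<in> V \<and> finite {U \<in> \<C>. U \<inter> V \<noteq> {}}"
      using C(1) by (intro exI[of _ UNIV]) auto
  qed (assumption, rule that)
  show thesis
  proof (rule that[of \<C> F])
    fix x assume x: "x \<in> K"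
    have "supp_sum (\<lambda>W. F W x) \<C> = (\<Sum>U\<in>\<C>. F U x)"
      unfolding supp_sum_def support_on_def using C(1) by (intro sum.mono_neutral_left) auto
    then show "(\<Sum>U\<in>\<C>. F U x) = 1" using F(3)[OF x] by simp
    have "card {U\<in>\<C>. F U x \<noteq> 0} \<le> card {U\<in>\<C>. x \<in> U}"
      using C(1) F(2) x by (intro card_mono) auto
    then show "card {U\<in>\<C>. F U x \<noteq> 0} \<le> N" using C(5)[OF x] by simp
  next
    fix U x y assume "U \<in> \<C>" "x \<in> K" "y \<in> K" "F U x \<noteq> 0" "F U y \<noteq> 0"
    then show "dist x y < e" using C(3)[of U x y] F(2) by blast
  qed (use C F in auto)
qed

text \<open>The Menger-Noebeling perturbation: \<open>G\<close> is replaced by a map into the nerve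
  of a fine cover whose vertices are in general position. Two points involve at most
  \<open>2*N\<close> vertices together, and these are linearly independent, so equal values force
  equal barycentric coordinates and hence a common support. Linear instead of affine independence
  costs one dimension compared with the classical 2n+1, where N = n+1.\<close>

lemma perturb_to_separate:
  fixes K :: "'b::metric_space set" and G :: "nat \<Rightarrow> 'b \<Rightarrow> real"
  assumes K: "compact K" "fine_covers K N" and G: "\<And>l. l < 2*N \<Longrightarrow> continuous_on K (G l)"
    and e: "e > 0" and r: "r > 0"
  obtains H :: "nat \<Rightarrow> 'b \<Rightarrow> real" where "\<And>l. l < 2*N \<Longrightarrow> continuous_on K (H l)"
    "\<And>l x. l < 2*N \<Longrightarrow> x \<in> K \<Longrightarrow> \<bar>H l x - G l x\<bar> \<le> e"
    "\<And>x y. x \<in> K \<Longrightarrow> y \<in> K \<Longrightarrow> dist x y \<ge> r \<Longrightarrow> \<exists>l<2*N. H l x \<noteq> H l y"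
proof -
  have "\<exists>d>0. \<forall>l<n. \<forall>x\<in>K. \<forall>y\<in>K. dist x y < d \<longrightarrow> \<bar>G l x - G l y\<bar> \<le> e/2" if "n \<le> 2*N" for n
    using that
  proof (induction n)
    case 0
    then show ?case by (intro exI[of _ 1]) auto
  next
    case (Suc n)
    then obtain d where d: "d > 0" "\<forall>l<n. \<forall>x\<in>K. \<forall>y\<in>K. dist x y < d \<longrightarrow> \<bar>G l x - G l y\<bar> \<le> e/2" by auto
    have "uniformly_continuous_on K (G n)" using Suc.prems K(1) G by (intro compact_uniformly_continuous) simp_all
    then obtain d' where d': "d' > 0" "\<forall>x\<in>K. \<forall>y\<in>K. dist x y < d' \<longrightarrow> \<bar>G n x - G n y\<bar> < e/2"
      unfolding uniformly_continuous_on_def dist_real_def using e half_gt_zero by (metis dist_commute)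
    show ?case using d d' by (intro exI[of _ "min d d'"]) (auto simp: less_Suc_eq, force)
  qed
  from this[OF order_refl] obtain d where d0: "d > 0"
    "\<forall>l<2*N. \<forall>x\<in>K. \<forall>y\<in>K. dist x y < d \<longrightarrow> \<bar>G l x - G l y\<bar> \<le> e/2" by (elim exE conjE)
  then have d: "d > 0"
    "\<And>l x y. l<2*N \<Longrightarrow> x\<in>K \<Longrightarrow> y\<in>K \<Longrightarrow> dist x y < d \<Longrightarrow> \<bar>G l x - G l y\<bar> \<le> e/2" by simp_all
  obtain \<C> :: "'b set set" and \<phi> where C: "finite \<C>" "\<And>U. U \<in> \<C> \<Longrightarrow> continuous_on K (\<phi> U)"
    "\<And>U x. U \<in> \<C> \<Longrightarrow> x \<in> K \<Longrightarrow> (0::real) \<le> \<phi> U x" "\<And>x. x \<in> K \<Longrightarrow> (\<Sum>U\<in>\<C>. \<phi> U x) = 1"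
    "\<And>x. x \<in> K \<Longrightarrow> card {U\<in>\<C>. \<phi> U x \<noteq> 0} \<le> N"
    "\<And>U x y. U \<in> \<C> \<Longrightarrow> x \<in> K \<Longrightarrow> y \<in> K \<Longrightarrow> \<phi> U x \<noteq> 0 \<Longrightarrow> \<phi> U y \<noteq> 0 \<Longrightarrow> dist x y < min d r"
    using fine_covers_partition_of_unity[OF K(2), of "min d r"] d(1) r by auto
  \<comment> \<open>A sample point of the support of \<open>\<phi> U\<close>. If
    \<open>\<phi> U\<close> vanishes on all of \<open>K\<close> the point is arbitrary, and the term
    of \<open>U\<close> is zero.\<close>
  define c where "c U = (SOME x. x \<in> K \<and> \<phi> U x \<noteq> 0)" for U
  have c: "c U \<in> K" "\<phi> U (c U) \<noteq> 0" if "x \<in> K" "\<phi> U x \<noteq> 0" for U x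
    using that someI[of "\<lambda>x. x \<in> K \<and> \<phi> U x \<noteq> 0" x] by (auto simp: c_def)
  \<comment> \<open>One half of \<open>e\<close> pays for moving the vertices, the other half for
    the oscillation of \<open>G\<close> on a support.\<close>
  obtain p where p0: "(\<forall>U\<in>\<C>. \<forall>l<2*N. \<bar>p U l - G l (c U)\<bar> < e/2) \<and>
    (\<forall>J a. J \<subseteq> \<C> \<longrightarrow> card J \<le> 2*N \<longrightarrow> (\<forall>l<2*N. (\<Sum>i\<in>J. a i * p i l) = 0) \<longrightarrow> (\<forall>i\<in>J. a i = 0))"
    using perturb_to_general_position[OF C(1) half_gt_zero[OF e], of "2*N" "\<lambda>U l. G l (c U)"] by (rule exE)
  have p: "\<And>U l. U \<in> \<C> \<Longrightarrow> l < 2*N \<Longrightarrow> \<bar>p U l - G l (c U)\<bar> < e/2"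
    "\<And>J a. J \<subseteq> \<C> \<Longrightarrow> card J \<le> 2*N \<Longrightarrow> (\<forall>l<2*N. (\<Sum>i\<in>J. a i * p i l) = 0) \<Longrightarrow> (\<forall>i\<in>J. a i = 0)"
    using p0 by blast+
  define H where "H l x = (\<Sum>U\<in>\<C>. \<phi> U x * p U l)" for l x
  show thesis
  proof (rule that[of H])
    show "continuous_on K (H l)" for l
      unfolding H_def by (intro continuous_intros C(2))
  next
    fix l x assume l: "l < 2*N" and x: "x \<in> K"
    have "H l x - G l x = (\<Sum>U\<in>\<C>. \<phi> U x * p U l) - (\<Sum>U\<in>\<C>. \<phi> U x) * G l x"
      using C(4)[OF x] by (simp add: H_def)
    also have "\<dots> = (\<Sum>U\<in>\<C>. \<phi> U x * (p U l - G l x))"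
      by (simp add: sum_distrib_right sum_subtractf right_diff_distrib)
    finally have "\<bar>H l x - G l x\<bar> \<le> (\<Sum>U\<in>\<C>. \<bar>\<phi> U x * (p U l - G l x)\<bar>)" by (simp add: sum_abs)
    also have "\<dots> \<le> (\<Sum>U\<in>\<C>. \<phi> U x * e)"
    proof (rule sum_mono)
      fix U assume U: "U \<in> \<C>"
      show "\<bar>\<phi> U x * (p U l - G l x)\<bar> \<le> \<phi> U x * e"
      proof (cases "\<phi> U x = 0")
        case False
        have "\<bar>G l (c U) - G l x\<bar> \<le> e/2"
          using d(2)[OF l c(1)[OF x False] x] C(6)[OF U c(1)[OF x False] x c(2)[OF x False] False] by simp
        then have "\<bar>p U l - G l x\<bar> \<le> e" using p(1)[OF U l] by linarith
        then show ?thesis using C(3)[OF U x] by (simp add: abs_mult mult_left_mono)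
      qed simp
    qed
    also have "\<dots> = e" using C(4)[OF x] by (simp add: sum_distrib_right[symmetric])
    finally show "\<bar>H l x - G l x\<bar> \<le> e" .
  next
    fix x y assume x: "x \<in> K" and y: "y \<in> K" and xy: "dist x y \<ge> r"
    show "\<exists>l<2*N. H l x \<noteq> H l y"
    proof (rule ccontr)
      assume *: "\<not> ?thesis"
      define J where "J = {U\<in>\<C>. \<phi> U x \<noteq> 0} \<union> {U\<in>\<C>. \<phi> U y \<noteq> 0}"
      have J: "J \<subseteq> \<C>" by (auto simp: J_def)
      have "card J \<le> card {U\<in>\<C>. \<phi> U x \<noteq> 0} + card {U\<in>\<C>. \<phi> U y \<noteq> 0}"
        unfolding J_def by (rule card_Un_le)
      then have "card J \<le> 2*N" using C(5)[OF x] C(5)[OF y] by simp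
      moreover have "(\<Sum>U\<in>J. (\<phi> U x - \<phi> U y) * p U l) = 0" if "l < 2*N" for l
      proof -
        have "(\<Sum>U\<in>J. (\<phi> U x - \<phi> U y) * p U l) = (\<Sum>U\<in>\<C>. (\<phi> U x - \<phi> U y) * p U l)"
          using C(1) by (intro sum.mono_neutral_left) (auto simp: J_def)
        also have "\<dots> = H l x - H l y" by (simp add: H_def sum_subtractf algebra_simps)
        finally show ?thesis using * that by simp
      qed
      ultimately have eq: "\<forall>U\<in>J. \<phi> U x - \<phi> U y = 0" using p(2)[OF J, of "\<lambda>U. \<phi> U x - \<phi> U y"] by blast
      obtain U where U: "U \<in> \<C>" "\<phi> U x \<noteq> 0" using C(4)[OF x] by (metis sum.neutral zero_neq_one)
      then have "U \<in> J" by (simp add: J_def)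
      then have "\<phi> U y \<noteq> 0" using eq U(2) by auto
      then show False using C(6)[OF U(1) x y U(2)] xy by simp
    qed
  qed
qed

text \<open>The pairs at distance at least \<open>r\<close> form a compact set, which turns
  pointwise separation into a gap. The minimum of the summed differences is divided by
  \<open>k + 1\<close>, so that \<open>k\<close> terms below the quotient cannot add up to
  it.\<close>

lemma uniform_separation_gap:
  fixes K :: "'b::metric_space set" and H :: "nat \<Rightarrow> 'b \<Rightarrow> real"
  assumes K: "compact K" and H: "\<And>l. l < k \<Longrightarrow> continuous_on K (H l)"
    and sep: "\<And>x y. x \<in> K \<Longrightarrow> y \<in> K \<Longrightarrow> dist x y \<ge> r \<Longrightarrow> \<exists>l<k. H l x \<noteq> H l y"
  obtains \<eta> where "\<eta> > 0"
    "\<And>x y. x \<in> K \<Longrightarrow> y \<in> K \<Longrightarrow> dist x y \<ge> r \<Longrightarrow> \<exists>l<k. \<bar>H l x - H l y\<bar> \<ge> \<eta>"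
proof -
  define D where "D = {p. dist (fst p) (snd p) \<ge> r} \<inter> (K \<times> K)"
  have "compact D"
    unfolding D_def by (intro closed_Int_compact compact_Times K closed_Collect_le continuous_intros)
  define g where "g p = (\<Sum>l<k. \<bar>H l (fst p) - H l (snd p)\<bar>)" for p
  show thesis
  proof (cases "D = {}")
    case True
    show ?thesis
    proof (rule that[of 1])
      fix x y assume "x \<in> K" "y \<in> K" "dist x y \<ge> r"
      then have "(x, y) \<in> D" by (simp add: D_def)
      then show "\<exists>l<k. \<bar>H l x - H l y\<bar> \<ge> 1" using True by simp
    qed simp
  next
    case False
    have "continuous_on D (\<lambda>p. H l (fst p))" "continuous_on D (\<lambda>p. H l (snd p))" if "l < k" for l
      by (rule continuous_on_compose2[OF H[OF that]]; auto simp: D_def intro!: continuous_intros)+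
    then have "continuous_on D g" unfolding g_def by (intro continuous_intros) auto
    then obtain p0 where p0: "p0 \<in> D" "\<And>p. p \<in> D \<Longrightarrow> g p0 \<le> g p"
      using continuous_attains_inf[OF \<open>compact D\<close> False] by metis
    obtain l0 where l0: "l0 < k" "H l0 (fst p0) \<noteq> H l0 (snd p0)"
      using sep[of "fst p0" "snd p0"] p0(1) by (auto simp: D_def)
    have "\<bar>H l0 (fst p0) - H l0 (snd p0)\<bar> \<le> g p0"
      unfolding g_def by (rule member_le_sum) (use l0 in auto)
    then have pos: "g p0 > 0" using l0(2) by linarith
    show ?thesis
    proof (rule that[of "g p0 / (real k + 1)"])
      show "g p0 / (real k + 1) > 0" using pos by simp
      fix x y assume xy: "x \<in> K" "y \<in> K" "dist x y \<ge> r"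
      show "\<exists>l<k. \<bar>H l x - H l y\<bar> \<ge> g p0 / (real k + 1)"
      proof (rule ccontr)
        assume "\<not> ?thesis"
        then have "\<bar>H l x - H l y\<bar> \<le> g p0 / (real k + 1)" if "l < k" for l
          using that by (meson linear)
        then have "g (x, y) \<le> (\<Sum>l<k. g p0 / (real k + 1))"
          unfolding g_def by (intro sum_mono) auto
        also have "\<dots> = real k * (g p0 / (real k + 1))" by simp
        also have "\<dots> < g p0" using pos by (simp add: field_simps)
        finally show False using p0(2)[of "(x, y)"] xy by (auto simp: D_def)
      qed
    qed
  qed
qed

abbreviation Rn :: "nat \<Rightarrow> (nat \<Rightarrow> real) set" where
  "Rn k \<equiv> {x. \<forall>i\<ge>k. x i = 0}"

text \<open>The embedding is a limit of perturbations. The map of stage \<open>n\<close> separates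
  points at distance at least 1/(n+1) by a gap, and all later changes are so small against this gap
  that the limit still separates them.\<close>

theorem fine_covers_imp_embedding:
  fixes K :: "'b::metric_space set"
  assumes K: "compact K" "fine_covers K N"
  obtains e :: "'b \<Rightarrow> nat \<Rightarrow> real" where "continuous_on K e" "inj_on e K" "e ` K \<subseteq> Rn (2*N)"
proof -
  \<comment> \<open>A state consists of a map \<open>fst s\<close> and its separation gap
    \<open>snd s\<close>.\<close>
  define P where "P n s \<longleftrightarrow> (\<forall>l<2*N. continuous_on K (fst s l)) \<and> 0 < snd s \<and> snd s \<le> (1/2)^n \<and>
      (\<forall>x\<in>K. \<forall>y\<in>K. dist x y \<ge> 1 / real (Suc n) \<longrightarrow> (\<exists>l<2*N. \<bar>fst s l x - fst s l y\<bar> \<ge> snd s))"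
    for n and s :: "(nat \<Rightarrow> 'b \<Rightarrow> real) \<times> real"
  \<comment> \<open>With changes of at most an eighth of the gap, and gaps that are at least halved,
    all later changes together amount to at most a quarter of the gap (\<open>close\<close>). Two
    points thus lose at most half of it in the limit.\<close>
  define Q where "Q n s s' \<longleftrightarrow> (\<forall>l<2*N. \<forall>x\<in>K. \<bar>fst s' l x - fst s l x\<bar> \<le> snd s / 8) \<and> snd s' \<le> snd s / 2"
    for n :: nat and s s' :: "(nat \<Rightarrow> 'b \<Rightarrow> real) \<times> real"
  have step: "\<exists>s'. P n s' \<and> (\<forall>l<2*N. \<forall>x\<in>K. \<bar>fst s' l x - G l x\<bar> \<le> e) \<and> snd s' \<le> b"
    if G: "\<And>l. l < 2*N \<Longrightarrow> continuous_on K (G l)" and "e > 0" "b > 0" for n G e b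
  proof -
    obtain H where H: "\<And>l. l < 2*N \<Longrightarrow> continuous_on K (H l)"
      "\<And>l x. l < 2*N \<Longrightarrow> x \<in> K \<Longrightarrow> \<bar>H l x - G l x\<bar> \<le> e"
      "\<And>x y. x \<in> K \<Longrightarrow> y \<in> K \<Longrightarrow> dist x y \<ge> 1 / real (Suc n) \<Longrightarrow> \<exists>l<2*N. H l x \<noteq> H l y"
      by (rule perturb_to_separate[OF K G \<open>e > 0\<close>, where r = "1 / real (Suc n)"]) auto
    obtain \<eta> where \<eta>: "\<eta> > 0"
      "\<And>x y. x \<in> K \<Longrightarrow> y \<in> K \<Longrightarrow> dist x y \<ge> 1 / real (Suc n) \<Longrightarrow> \<exists>l<2*N. \<bar>H l x - H l y\<bar> \<ge> \<eta>"
    proof (rule uniform_separation_gap[OF K(1), of "2*N" H "1 / real (Suc n)"], goal_cases)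
      case (1 l)
      then show ?case by (intro H(1))
    next
      case (2 x y)
      then show ?case by (intro H(3))
    next
      case 3
      show ?case by (rule 3(1)[OF 3(2,3)])
    qed
    define m where "m = min \<eta> (min b ((1/2)^n))"
    have "\<exists>l<2*N. \<bar>H l x - H l y\<bar> \<ge> m" if "x \<in> K" "y \<in> K" "dist x y \<ge> 1 / real (Suc n)" for x y
    proof -
      have "m \<le> \<eta>" by (simp add: m_def)
      with \<eta>(2)[OF that] show ?thesis by (meson order_trans)
    qed
    moreover have "0 < m" "m \<le> b" "m \<le> (1/2)^n" using \<eta>(1) \<open>b > 0\<close> by (auto simp: m_def)
    ultimately show ?thesis using H(1,2) by (intro exI[of _ "(H, m)"]) (simp add: P_def)
  qed
  have "\<exists>f. \<forall>n. P n (f n) \<and> Q n (f n) (f (Suc n))"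
  proof (rule dependent_nat_choice)
    show "\<exists>s. P 0 s" using step[of "\<lambda>_ _. 0" 1 1 0] by auto
  next
    fix s n assume s: "P n s"
    then have "\<And>l. l < 2*N \<Longrightarrow> continuous_on K (fst s l)" "snd s / 8 > 0" "snd s / 2 > 0" by (auto simp: P_def)
    from step[OF this, where n = "Suc n"] show "\<exists>s'. P (Suc n) s' \<and> Q n s s'" by (auto simp: Q_def)
  qed
  then obtain f where f: "\<And>n. P n (f n)" "\<And>n. Q n (f n) (f (Suc n))" by blast
  define G where "G n = fst (f n)" for n
  define \<eta> where "\<eta> n = snd (f n)" for n
  have G: "continuous_on K (G n l)" if "l < 2*N" for n l using f(1)[of n] that by (simp add: P_def G_def)
  have \<eta>: "0 < \<eta> n" "\<eta> n \<le> (1/2)^n" "\<eta> (Suc n) \<le> \<eta> n / 2" for n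
    using f(1)[of n] f(2)[of n] by (auto simp: P_def Q_def \<eta>_def)
  have sep: "\<exists>l<2*N. \<bar>G n l x - G n l y\<bar> \<ge> \<eta> n" if "x \<in> K" "y \<in> K" "dist x y \<ge> 1 / real (Suc n)" for n x y
    using f(1)[of n] that by (simp add: P_def G_def \<eta>_def)
  have GS: "\<bar>G (Suc n) l x - G n l x\<bar> \<le> \<eta> n / 8" if "l < 2*N" "x \<in> K" for n l x
    using f(2)[of n] that by (simp add: Q_def G_def \<eta>_def)
  have tele: "\<bar>G (n + m) l x - G n l x\<bar> \<le> \<eta> n / 4 - \<eta> (n + m) / 4" if "l < 2*N" "x \<in> K" for n m l x
  proof (induction m)
    case (Suc m)
    then show ?case using GS[OF that, of "n + m"] \<eta>(3)[of "n + m"] unfolding add_Suc_right by linarith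
  qed simp
  have close: "\<bar>G m l x - G n l x\<bar> \<le> \<eta> n / 4" if "l < 2*N" "x \<in> K" "m \<ge> n" for n m l x
    using tele[OF that(1,2), of n "m - n"] \<eta>(1)[of m] that(3) by simp
  have \<eta>0: "\<eta> \<longlonglongrightarrow> 0"
  proof (rule tendsto_sandwich[of "\<lambda>_. 0" _ _ "\<lambda>n. (1/2)^n"])
    show "(\<lambda>n. (1/2::real)^n) \<longlonglongrightarrow> 0" by (simp add: LIMSEQ_realpow_zero)
    show "\<forall>\<^sub>F n in sequentially. 0 \<le> \<eta> n" using \<eta>(1) by (simp add: less_imp_le)
    show "\<forall>\<^sub>F n in sequentially. \<eta> n \<le> (1/2)^n" by (intro always_eventually allI \<eta>(2))
  qed simp
  have conv: "convergent (\<lambda>n. G n l x)" if "l < 2*N" "x \<in> K" for l x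
    unfolding Cauchy_convergent_iff[symmetric] metric_Cauchy_iff2
  proof
    fix j
    have "\<forall>\<^sub>F n in sequentially. \<eta> n < inverse (Suc j)"
      using order_tendstoD(2)[OF \<eta>0] by simp
    then obtain n where n: "\<eta> n < inverse (Suc j)" by (auto simp: eventually_sequentially)
    have "dist (G m l x) (G m' l x) < inverse (Suc j)" if "m \<ge> n" "m' \<ge> n" for m m'
      using close[OF \<open>l < 2*N\<close> \<open>x \<in> K\<close> that(1)] close[OF \<open>l < 2*N\<close> \<open>x \<in> K\<close> that(2)] n \<eta>(1)[of n]
      unfolding dist_real_def by linarith
    then show "\<exists>M. \<forall>m\<ge>M. \<forall>n\<ge>M. dist (G m l x) (G n l x) < inverse (real (Suc j))" by blast
  qed
  define F where "F l x = lim (\<lambda>n. G n l x)" for l x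
  have lim: "(\<lambda>n. G n l x) \<longlonglongrightarrow> F l x" if "l < 2*N" "x \<in> K" for l x
    using conv[OF that] by (simp add: F_def convergent_LIMSEQ_iff)
  have FG: "\<bar>F l x - G n l x\<bar> \<le> \<eta> n / 4" if "l < 2*N" "x \<in> K" for l x n
  proof (rule LIMSEQ_le_const2)
    show "(\<lambda>m. \<bar>G m l x - G n l x\<bar>) \<longlonglongrightarrow> \<bar>F l x - G n l x\<bar>"
      by (intro tendsto_intros lim that)
  qed (use close[OF that] in blast)
  have F: "continuous_on K (F l)" if l: "l < 2*N" for l
  proof (rule uniform_limit_theorem[where F = sequentially])
    show "uniform_limit K (\<lambda>n. G n l) (F l) sequentially"
    proof (rule uniform_limitI)
      fix e :: real assume "e > 0"
      then have "\<forall>\<^sub>F n in sequentially. \<eta> n < e" using order_tendstoD(2)[OF \<eta>0] by simp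
      then show "\<forall>\<^sub>F n in sequentially. \<forall>x\<in>K. dist (G n l x) (F l x) < e"
      proof (rule eventually_mono)
        fix n assume n: "\<eta> n < e"
        show "\<forall>x\<in>K. dist (G n l x) (F l x) < e"
        proof
          fix x assume "x \<in> K"
          from FG[OF l this, of n] n \<eta>(1)[of n] show "dist (G n l x) (F l x) < e"
            unfolding dist_real_def by linarith
        qed
      qed
    qed
  qed (use G[OF l] in auto)
  define E where "E x l = (if l < 2*N then F l x else 0)" for x l
  show thesis
  proof (rule that[of E])
    show "continuous_on K E"
    proof (rule continuous_on_coordinatewise_then_product)
      fix l show "continuous_on K (\<lambda>x. E x l)"
        using F[of l] by (cases "l < 2*N") (simp_all add: E_def)
    qed
    show "E ` K \<subseteq> Rn (2*N)" by (auto simp: E_def)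
    show "inj_on E K"
    proof (rule inj_onI, rule ccontr)
      fix x y assume x: "x \<in> K" and y: "y \<in> K" and eq: "E x = E y" and "x \<noteq> y"
      then have "dist x y > 0" by simp
      then obtain n where "inverse (real (Suc n)) < dist x y" using reals_Archimedean by blast
      then obtain l where l: "l < 2*N" "\<bar>G n l x - G n l y\<bar> \<ge> \<eta> n"
        using sep[OF x y, of n] by (auto simp: inverse_eq_divide)
      have "F l x = F l y" using fun_cong[OF eq, of l] l(1) by (simp add: E_def)
      then show False using FG[OF l(1) x, of n] FG[OF l(1) y, of n] l(2) \<eta>(1)[of n] by linarith
    qed
  qed
qed

section \<open>Cubes\<close>

text \<open>The side grows together with the dimension, so that a single increasing sequence of
  compacta exhausts all the spaces \<open>Rn k\<close>.\<close>

definition cube :: "nat \<Rightarrow> (nat \<Rightarrow> real) set" where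
  "cube m = {x. (\<forall>i<m. \<bar>x i\<bar> \<le> real m) \<and> (\<forall>i\<ge>m. x i = 0)}"

lemma compact_box:
  fixes a b :: "'i \<Rightarrow> real"
  shows "compact {x. \<forall>i. a i \<le> x i \<and> x i \<le> b i}"
proof -
  have "compactin (product_topology (\<lambda>i. euclidean) UNIV) (PiE UNIV (\<lambda>i. {a i..b i}))"
    by (simp add: compactin_PiE)
  moreover have "PiE UNIV (\<lambda>i. {a i..b i}) = {x. \<forall>i. a i \<le> x i \<and> x i \<le> b i}" by (auto simp: PiE_def)
  ultimately show ?thesis by (simp add: euclidean_product_topology)
qed

lemma compact_cube: "compact (cube m)"
proof -
  have "cube m = {x. \<forall>i. (if i < m then - real m else 0) \<le> x i \<and> x i \<le> (if i < m then real m else 0)}"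
    unfolding cube_def by (auto simp: abs_le_iff not_less)
  then show ?thesis by (simp only: compact_box)
qed

lemma cube_mono: "m \<le> n \<Longrightarrow> cube m \<subseteq> cube n"
proof
  fix x assume mn: "m \<le> n" and x: "x \<in> cube m"
  have "\<bar>x i\<bar> \<le> real n" for i
  proof (cases "i < m")
    case True
    then have "\<bar>x i\<bar> \<le> real m" using x by (simp add: cube_def)
    then show ?thesis using mn by linarith
  qed (use x in \<open>simp add: cube_def\<close>)
  then show "x \<in> cube n" using x mn by (simp add: cube_def)
qed

lemma Rn_subset_cubes:
  assumes "x \<in> Rn k"
  shows "\<exists>m. x \<in> cube m"
proof -
  define m where "m = k + nat \<lceil>\<Sum>i<k. \<bar>x i\<bar>\<rceil>"
  have "\<bar>x i\<bar> \<le> real m" for i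
  proof (cases "i < k")
    case True
    then have "\<bar>x i\<bar> \<le> (\<Sum>i<k. \<bar>x i\<bar>)" by (intro member_le_sum) auto
    then show ?thesis unfolding m_def by linarith
  qed (use assms in simp)
  then show ?thesis using assms by (intro exI[of _ m]) (auto simp: cube_def m_def)
qed

text \<open>The metric on sequences is at most twice the largest difference among finitely many
  coordinates plus a tail (1/2)^N; here this is at most e/4 plus less than e/2.\<close>

lemma dist_fun_less:
  fixes x y :: "nat \<Rightarrow> real"
  assumes "e > 0" and "\<And>i. \<bar>x i - y i\<bar> \<le> e / 8"
  shows "dist x y < e"
proof -
  obtain N where N: "(1/2::real)^N < e/2" using real_arch_pow_inv[of "e/2" "1/2"] assms(1) by auto
  have "Max {dist (x (from_nat n)) (y (from_nat n))|n. n \<le> N} \<le> e/8"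
    using assms(2) by (subst Max_le_iff) (auto simp: dist_real_def)
  then show ?thesis using dist_fun_le_dist_first_terms[of x y N] N assms(1) by linarith
qed

text \<open>A real number is at distance less than \<open>d\<close> from at most two points of the
  lattice of step \<open>d\<close>, so a point lies in at most \<open>2^m\<close> of the boxes
  \<open>V z\<close>. The boxes restrict only the first \<open>m\<close> coordinates, as the others
  vanish on the cube.\<close>

lemma fine_covers_cube: "fine_covers (cube m) (2^m)"
  unfolding fine_covers_def
proof (intro allI impI)
  fix e :: real assume e: "e > 0"
  \<comment> \<open>The boxes have width \<open>2 * d\<close>, which is the bound
    \<open>e / 8\<close> of \<open>dist_fun_less\<close>.\<close>
  define d where "d = e/16"
  have d: "d > 0" using e by (simp add: d_def)
  define V where "V z = {x::nat \<Rightarrow> real. \<forall>i\<in>{..<m}. \<bar>x i - d * of_int (z i)\<bar> < d}" for z :: "nat \<Rightarrow> int"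
  define R :: int where "R = \<lceil>real m / d\<rceil> + 1"
  define Z where "Z = PiE {..<m} (\<lambda>_. {-R..R})"
  define n where "n x = restrict (\<lambda>i. \<lfloor>x i / d\<rfloor>) {..<m}" for x :: "nat \<Rightarrow> real"
  have near: "\<bar>t - d * of_int \<lfloor>t / d\<rfloor>\<bar> < d" for t :: real
  proof -
    have "of_int \<lfloor>t / d\<rfloor> * d \<le> t" using d by (simp add: pos_le_divide_eq[symmetric])
    moreover have "t < (of_int \<lfloor>t / d\<rfloor> + 1) * d" using d by (simp add: pos_divide_less_eq[symmetric])
    ultimately show ?thesis using d by (simp add: algebra_simps)
  qed
  show "\<exists>\<C>. finite \<C> \<and>
     (\<forall>U\<in>\<C>. open U \<and> (\<forall>x\<in>U \<inter> cube m. \<forall>y\<in>U \<inter> cube m. dist x y < e)) \<and> cube m \<subseteq> \<Union>\<C> \<and>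
     (\<forall>x\<in>cube m. card {U\<in>\<C>. x \<in> U} \<le> 2^m)"
  proof (intro exI[of _ "V ` Z"] conjI ballI subsetI)
    show "finite (V ` Z)" by (simp add: Z_def finite_PiE)
    show "open U" if "U \<in> V ` Z" for U
    proof -
      have "open {x::nat \<Rightarrow> real. \<forall>i\<in>{..<m}. \<bar>x i - d * of_int (z i)\<bar> < d}" for z :: "nat \<Rightarrow> int"
        unfolding Collect_ball_eq
        by (intro open_INT ballI open_Collect_less continuous_on_const continuous_on_rabs
            continuous_on_diff continuous_on_product_coordinates finite_lessThan)
      then show ?thesis using that by (auto simp: V_def)
    qed
  next
    fix U x y assume "U \<in> V ` Z" and x: "x \<in> U \<inter> cube m" and y: "y \<in> U \<inter> cube m"
    then obtain z where z: "U = V z" by blast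
    show "dist x y < e"
    proof (rule dist_fun_less[OF e])
      fix i show "\<bar>x i - y i\<bar> \<le> e/8"
      proof (cases "i < m")
        case True
        then have "\<bar>x i - d * of_int (z i)\<bar> < d" "\<bar>y i - d * of_int (z i)\<bar> < d"
          using x y z by (auto simp: V_def)
        then have "\<bar>x i - y i\<bar> < 2 * d" by linarith
        then show ?thesis by (simp add: d_def)
      qed (use x y e in \<open>auto simp: cube_def\<close>)
    qed
  next
    fix x assume x: "x \<in> cube m"
    have "\<lfloor>x i / d\<rfloor> \<in> {-R..R}" if "i < m" for i
    proof -
      have "- (real m / d) \<le> x i / d" "x i / d \<le> real m / d"
        using x that d by (auto simp: cube_def field_simps abs_le_iff)
      then show ?thesis unfolding R_def by simp linarith
    qed
    then have "n x \<in> Z" by (auto simp: Z_def n_def)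
    moreover have "x \<in> V (n x)" using near by (auto simp: V_def n_def)
    ultimately show "x \<in> \<Union> (V ` Z)" by blast
  next
    fix x assume "x \<in> cube m"
    define T where "T = PiE {..<m} (\<lambda>i. {\<lfloor>x i / d\<rfloor>, \<lfloor>x i / d\<rfloor> + 1})"
    have "{U\<in>V ` Z. x \<in> U} \<subseteq> V ` T"
    proof
      fix U assume "U \<in> {U\<in>V ` Z. x \<in> U}"
      then obtain z where z: "z \<in> Z" "U = V z" "x \<in> V z" by blast
      have "z i \<in> {\<lfloor>x i / d\<rfloor>, \<lfloor>x i / d\<rfloor> + 1}" if "i < m" for i
      proof -
        have "\<bar>x i - d * of_int (z i)\<bar> < d" using z(3) that by (auto simp: V_def)
        then have "\<bar>x i / d - of_int (z i)\<bar> < 1"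
          using d by (simp add: abs_less_iff field_simps)
        then have "z i = \<lfloor>x i / d\<rfloor> \<or> z i = \<lfloor>x i / d\<rfloor> + 1" by linarith
        then show ?thesis by simp
      qed
      then have "z \<in> T" using z(1) by (auto simp: T_def Z_def PiE_iff)
      then show "U \<in> V ` T" using z(2) by blast
    qed
    moreover have T: "finite T" by (simp add: T_def finite_PiE)
    ultimately have "card {U\<in>V ` Z. x \<in> U} \<le> card T"
      by (meson card_image_le card_mono finite_imageI le_trans)
    also have "card T = 2^m" by (simp add: T_def card_PiE numeral_2_eq_2)
    finally show "card {U\<in>V ` Z. x \<in> U} \<le> 2^m" .
  qed
qed

text \<open>Regarded as a map into \<open>Rn M\<close>, \<open>f\<close> would take the open box to
  an open set. But coordinate \<open>k\<close> vanishes on the image, while changing that coordinate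
  alone stays inside \<open>Rn M\<close>.\<close>

lemma no_embedding_of_box_into_lower_dimension:
  fixes a b :: "nat \<Rightarrow> real"
  assumes ab: "\<And>i. i < M \<Longrightarrow> a i < b i" and "k < M"
    and f: "continuous_on {x \<in> Rn M. \<forall>i<M. a i \<le> x i \<and> x i \<le> b i} f"
      "inj_on f {x \<in> Rn M. \<forall>i<M. a i \<le> x i \<and> x i \<le> b i}"
      "f ` {x \<in> Rn M. \<forall>i<M. a i \<le> x i \<and> x i \<le> b i} \<subseteq> Rn k"
  shows False
proof -
  define T where "T = {x::nat \<Rightarrow> real. \<forall>i\<in>{..<M}. a i < x i \<and> x i < b i}"
  define U where "U = T \<inter> Rn M"
  have E: "Euclidean_space M = top_of_set (Rn M)"
    by (simp add: Euclidean_space_def euclidean_product_topology)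
  have T: "open T"
    unfolding T_def Collect_ball_eq Collect_conj_eq
    by (intro open_INT ballI open_Int open_Collect_less continuous_on_const
        continuous_on_product_coordinates finite_lessThan)
  have U: "openin (Euclidean_space M) U" unfolding E U_def 
    using openin_open_Int[OF T, of "Rn M"] by (simp only: Int_commute)
  have UB: "U \<subseteq> {x \<in> Rn M. \<forall>i<M. a i \<le> x i \<and> x i \<le> b i}" by (auto simp: U_def T_def less_imp_le)
  have "openin (Euclidean_space M) (f ` U)"
  proof (rule invariance_of_domain_Euclidean_space[OF U])
    have 1: "continuous_on U f" using f(1) UB by (rule continuous_on_subset)
    have "Rn k \<subseteq> Rn M" using \<open>k < M\<close> by auto
    then have 2: "f ` U \<subseteq> Rn M" using f(3) UB by (meson image_mono order_trans)
    have 3: "subtopology (Euclidean_space M) U = top_of_set U"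
      unfolding E subtopology_subtopology by (simp add: U_def Int_absorb1)
    show "continuous_map (subtopology (Euclidean_space M) U) (Euclidean_space M) f"
      unfolding 3 unfolding E using 1 2 by (auto simp: continuous_map_in_subtopology image_subset_iff)
    show "inj_on f U" using f(2) UB by (rule inj_on_subset)
  qed
  then obtain W where W: "open W" "f ` U = Rn M \<inter> W" unfolding E openin_open by blast
  have "(\<lambda>i. if i < M then (a i + b i)/2 else 0) \<in> U" using ab by (auto simp: U_def T_def field_simps)
  then obtain p where p: "p \<in> f ` U" by blast
  have fU: "x k = 0" if "x \<in> f ` U" for x using f(3) UB that by blast
  have pk: "p k = 0" and pW: "p \<in> W" "p \<in> Rn M" using fU[OF p] p W(2) by blast+
  define g where "g t = p(k := t)" for t :: real
  have "continuous_on UNIV (\<lambda>t. g t i)" for i by (cases "i = k") (auto simp: g_def)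
  then have "continuous_on UNIV g" by (intro continuous_on_coordinatewise_then_product)
  then have "open (g -` W)" using W(1) by (simp add: open_vimage)
  moreover have "0 \<in> g -` W" using pW pk by (auto simp: g_def fun_upd_idem)
  ultimately obtain e where e: "e > 0" "ball 0 e \<subseteq> g -` W" using open_contains_ball by blast
  have "e/2 \<in> ball 0 e" using e(1) by simp
  then have "g (e/2) \<in> W" using e(2) by blast
  moreover have "g (e/2) \<in> Rn M" using pW(2) \<open>k < M\<close> by (auto simp: g_def)
  ultimately have "g (e/2) \<in> f ` U" using W(2) by blast
  then have "g (e/2) k = 0" by (rule fU)
  then show False using e(1) by (simp add: g_def)
qed

section \<open>Linear topological spaces\<close>

lemma tendsto_scaleR_lts:
  fixes g :: "'b \<Rightarrow> 'a::linear_topological_space"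
  assumes "(f \<longlongrightarrow> a) F" "(g \<longlongrightarrow> b) F"
  shows "((\<lambda>x. f x *\<^sub>R g x) \<longlongrightarrow> a *\<^sub>R b) F"
  using filterlim_compose[OF tendsto_scaleR_Pair filterlim_Pair[OF assms]] by simp

lemma continuous_on_scaleR_lts:
  fixes g :: "'b::topological_space \<Rightarrow> 'a::linear_topological_space"
  assumes "continuous_on S f" "continuous_on S g"
  shows "continuous_on S (\<lambda>x. f x *\<^sub>R g x)"
  using assms unfolding continuous_on_def by (auto intro!: tendsto_scaleR_lts)

lemma zero_nbhd_scale:
  fixes W :: "'a::linear_topological_space set"
  assumes "open W" "0 \<in> W"
  obtains V where "open V" "0 \<in> V" "\<And>t x. \<bar>t\<bar> \<le> 1 \<Longrightarrow> x \<in> V \<Longrightarrow> t *\<^sub>R x \<in> W"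
proof -
  have "LIM x (nhds 0 \<times>\<^sub>F nhds (0::'a)). fst x *\<^sub>R snd x :> nhds 0"
    using tendsto_scaleR_Pair[of 0 "0::'a"] by simp
  then have "\<forall>\<^sub>F x in nhds (0::real) \<times>\<^sub>F nhds (0::'a). fst x *\<^sub>R snd x \<in> W"
    using assms topological_tendstoD by blast
  then obtain P Q where PQ: "eventually P (nhds (0::real))" "eventually Q (nhds (0::'a))"
    "\<And>t x. P t \<Longrightarrow> Q x \<Longrightarrow> t *\<^sub>R x \<in> W" unfolding eventually_prod_filter by auto
  obtain d where d: "d > 0" "\<And>t. \<bar>t\<bar> < d \<Longrightarrow> P t"
    using PQ(1) unfolding eventually_nhds_metric by (auto simp: dist_real_def)
  obtain V0 where V0: "open V0" "0 \<in> V0" "\<And>x. x \<in> V0 \<Longrightarrow> Q x"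
    using PQ(2) unfolding eventually_nhds by auto
  \<comment> \<open>\<open>V\<close> is \<open>V0\<close> shrunk by the factor d/2. Moving this
    factor over to \<open>t\<close> turns modulus at most 1 into modulus below
    \<open>d\<close>.\<close>
  define V where "V = (\<lambda>x. (2/d) *\<^sub>R x) -` V0"
  show thesis
  proof (rule that[of V])
    show "open V" unfolding V_def
      by (intro open_vimage V0 continuous_on_scaleR_lts continuous_on_const continuous_on_id)
    show "0 \<in> V" using V0 by (simp add: V_def)
    fix t :: real and x assume t: "\<bar>t\<bar> \<le> 1" and x: "x \<in> V"
    have "\<bar>t * (d/2)\<bar> < d" using mult_right_mono[OF t, of "d/2"] d(1) by (simp add: abs_mult)
    then have "(t * (d/2)) *\<^sub>R ((2/d) *\<^sub>R x) \<in> W"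
      by (intro PQ(3) d(2) V0(3)) (use x in \<open>simp_all add: V_def\<close>)
    then show "t *\<^sub>R x \<in> W" using d(1) by simp
  qed
qed

lemma zero_nbhd_add:
  fixes W :: "'a::topological_monoid_add set"
  assumes "open W" "0 \<in> W"
  obtains V where "open V" "0 \<in> V" "\<And>x y. x \<in> V \<Longrightarrow> y \<in> V \<Longrightarrow> x + y \<in> W"
proof -
  have "LIM x (nhds 0 \<times>\<^sub>F nhds (0::'a)). fst x + snd x :> nhds 0"
    using tendsto_add_Pair[of 0 "0::'a"] by simp
  then have "\<forall>\<^sub>F x in nhds (0::'a) \<times>\<^sub>F nhds (0::'a). fst x + snd x \<in> W"
    using assms topological_tendstoD by blast
  then obtain P Q where PQ: "eventually P (nhds (0::'a))" "eventually Q (nhds (0::'a))"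
    "\<And>t x. P t \<Longrightarrow> Q x \<Longrightarrow> t + x \<in> W" unfolding eventually_prod_filter by auto
  then have "eventually (\<lambda>x. P x \<and> Q x) (nhds 0)" by (simp add: eventually_conj)
  then obtain V where V: "open V" "0 \<in> V" "\<And>x. x \<in> V \<Longrightarrow> P x \<and> Q x"
    unfolding eventually_nhds by auto
  show thesis by (rule that[of V]) (use V PQ(3) in auto)
qed

lemma zero_nbhd_sum:
  fixes W :: "'a::linear_topological_space set"
  assumes "open W" "0 \<in> W"
  shows "\<exists>V. open V \<and> 0 \<in> V \<and> (\<forall>(A::'i set) f. finite A \<longrightarrow> card A \<le> N \<longrightarrow> (\<forall>a\<in>A. f a \<in> V) \<longrightarrow> sum f A \<in> W)"
  using assms
proof (induction N arbitrary: W)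
  case 0
  then show ?case by (intro exI[of _ W]) auto
next
  case (Suc N)
  obtain V1 where V1: "open V1" "0 \<in> V1" "\<And>x y. x \<in> V1 \<Longrightarrow> y \<in> V1 \<Longrightarrow> x + y \<in> W"
    using zero_nbhd_add[OF Suc.prems] by blast
  obtain V2 where V2: "open V2" "0 \<in> V2"
    "\<forall>(A::'i set) f. finite A \<longrightarrow> card A \<le> N \<longrightarrow> (\<forall>a\<in>A. f a \<in> V2) \<longrightarrow> sum f A \<in> V1"
    using Suc.IH[OF V1(1,2)] by blast
  show ?case
  proof (intro exI[of _ "V1 \<inter> V2"] conjI allI impI)
    fix A :: "'i set" and f assume A: "finite A" "card A \<le> Suc N" "\<forall>a\<in>A. f a \<in> V1 \<inter> V2"
    show "sum f A \<in> W"
    proof (cases "A = {}")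
      case False
      then obtain a where a: "a \<in> A" by blast
      have "sum f (A - {a}) \<in> V1" using V2(3) A a by auto
      moreover have "f a \<in> V1" using A(3) a by blast
      ultimately show ?thesis using V1(3) A(1) a by (simp add: sum.remove[of A a])
    qed (use Suc.prems in simp)
  qed (use V1 V2 in auto)
qed

text \<open>The substitute for local convexity: with at most \<open>N\<close> terms and coefficients
  bounded by 1, a combination of small vectors is small in every linear topological space.\<close>

lemma zero_nbhd_combination:
  fixes W :: "'a::linear_topological_space set"
  assumes "open W" "0 \<in> W"
  obtains V where "open V" "0 \<in> V" "\<And>(A::'i set) c x. finite A \<Longrightarrow> card A \<le> N \<Longrightarrow>
    (\<And>a. a \<in> A \<Longrightarrow> \<bar>c a\<bar> \<le> 1) \<Longrightarrow> (\<And>a. a \<in> A \<Longrightarrow> x a \<in> V) \<Longrightarrow> (\<Sum>a\<in>A. c a *\<^sub>R x a) \<in> W"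
proof -
  obtain V1 where V1: "open V1" "0 \<in> V1"
    "\<forall>(A::'i set) f. finite A \<longrightarrow> card A \<le> N \<longrightarrow> (\<forall>a\<in>A. f a \<in> V1) \<longrightarrow> sum f A \<in> W"
    using zero_nbhd_sum[OF assms] by blast
  obtain V where V: "open V" "0 \<in> V" "\<And>t x. \<bar>t\<bar> \<le> 1 \<Longrightarrow> x \<in> V \<Longrightarrow> t *\<^sub>R x \<in> V1"
    by (fact zero_nbhd_scale[OF V1(1,2)])
  show thesis
  proof (rule that[of V])
    fix A :: "'i set" and c :: "'i \<Rightarrow> real" and x
    assume A: "finite A" "card A \<le> N" "\<And>a. a \<in> A \<Longrightarrow> \<bar>c a\<bar> \<le> 1" "\<And>a. a \<in> A \<Longrightarrow> x a \<in> V"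
    have "\<forall>a\<in>A. c a *\<^sub>R x a \<in> V1" using V(3) A(3,4) by blast
    then show "(\<Sum>a\<in>A. c a *\<^sub>R x a) \<in> W"
      using V1(3)[rule_format, OF A(1,2), of "\<lambda>a. c a *\<^sub>R x a"] by blast
  qed (use V in auto)
qed

section \<open>Extension of maps into linear topological spaces\<close>

text \<open>The complement of \<open>B\<close> is divided into dyadic shells, and each shell is cut
  up by a cover whose mesh is comparable to the distance from \<open>B\<close>. A point lies in at
  most two neighbouring shells, so the order at most doubles. The points \<open>b W\<close> are the
  places where a map given on \<open>B\<close> will be sampled.\<close>

lemma finite_order_Whitney_cover:
  fixes K B :: "'b::metric_space set"
  assumes fc: "fine_covers K N" and B: "closed B" "B \<noteq> {}"
  obtains \<W> and b :: "'b set \<Rightarrow> 'b" where "\<And>W. W \<in> \<W> \<Longrightarrow> open W" "K - B \<subseteq> \<Union>\<W>"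
    "\<And>x. x \<notin> B \<Longrightarrow> finite {W \<in> \<W>. W \<inter> {y. infdist x B / 2 < infdist y B} \<noteq> {}}"
    "\<And>x. x \<in> K - B \<Longrightarrow> card {W \<in> \<W>. x \<in> W} \<le> 2 * N"
    "\<And>W x. W \<in> \<W> \<Longrightarrow> x \<in> W \<inter> K \<Longrightarrow> b W \<in> B \<and> dist x (b W) \<le> 8 * infdist x B"
proof -
  define d where "d x = infdist x B" for x
  have dpos: "d x > 0" if "x \<notin> B" for x
    using that B by (simp add: d_def infdist_pos_not_in_closed)
  have dcont: "continuous_on UNIV d" unfolding d_def by (intro continuous_intros)
  have "\<forall>j::nat. \<exists>\<C>. finite \<C> \<and>
     (\<forall>U\<in>\<C>. open U \<and> (\<forall>x\<in>U \<inter> K. \<forall>y\<in>U \<inter> K. dist x y < (1/2)^j)) \<and> K \<subseteq> \<Union>\<C> \<and>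
     (\<forall>x\<in>K. card {U\<in>\<C>. x \<in> U} \<le> N)"
    using fc[unfolded fine_covers_def] by simp
  from choice[OF this] obtain C where "\<forall>j::nat. finite (C j) \<and>
     (\<forall>U\<in>C j. open U \<and> (\<forall>x\<in>U \<inter> K. \<forall>y\<in>U \<inter> K. dist x y < (1/2)^j)) \<and> K \<subseteq> \<Union>(C j) \<and>
     (\<forall>x\<in>K. card {U\<in>C j. x \<in> U} \<le> N)" ..
  then have C: "\<And>j. finite (C j)" "\<And>j U. U \<in> C j \<Longrightarrow> open U"
    "\<And>j U x y. U \<in> C j \<Longrightarrow> x \<in> U \<inter> K \<Longrightarrow> y \<in> U \<inter> K \<Longrightarrow> dist x y < (1/2)^j"
    "\<And>j. K \<subseteq> \<Union>(C j)" "\<And>j x. x \<in> K \<Longrightarrow> card {U\<in>C j. x \<in> U} \<le> N" by simp_all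
  \<comment> \<open>Shell \<open>j\<close> is given by 2^-(j+1) < d x < 2^(1-j), so shells whose
    indices differ by two or more are disjoint. Shell 0 has no upper bound and takes in all distant
    points.\<close>
  define A where "A j = {x. 1 < d x * 2^(Suc j)} \<inter> (if j = 0 then UNIV else {x. d x * 2^j < 2})" for j
  have Aopen: "open (A j)" for j
    unfolding A_def
    by (auto intro!: open_Int open_Collect_less continuous_on_mult dcont continuous_on_const)
  define \<W> where "\<W> = (\<Union>j. (\<lambda>U. U \<inter> A j) ` C j)"
  define c where "c W = (SOME x. x \<in> W \<inter> K)" for W
  define b where "b W = (SOME y. y \<in> B \<and> dist (c W) y < 2 * d (c W))" for W
  have in_A: "\<exists>j. x \<in> A j \<and> (\<forall>i. x \<in> A i \<longrightarrow> i \<in> {j, Suc j})" if "x \<notin> B" for x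
  proof -
    have dx: "d x > 0" by (rule dpos[OF that])
    obtain n where "inverse (d x) < 2 ^ n" using real_arch_pow[of 2 "inverse (d x)"] by auto
    then have "1 < d x * 2 ^ n" using dx by (simp add: field_simps)
    moreover have "d x * 2 ^ n \<le> d x * 2 ^ Suc n" using dx by simp
    ultimately have "1 < d x * 2 ^ Suc n" by linarith
    then have ex: "\<exists>n. 1 < d x * 2 ^ Suc n" by blast
    define j where "j = (LEAST n. 1 < d x * 2 ^ Suc n)"
    have j: "1 < d x * 2 ^ Suc j" unfolding j_def by (rule LeastI_ex[OF ex])
    have least: "j \<le> n" if "1 < d x * 2 ^ Suc n" for n
      unfolding j_def using that by (rule Least_le)
    have "x \<in> A j"
    proof (cases j)
      case (Suc i)
      then have "\<not> 1 < d x * 2 ^ Suc i" using least[of i] by auto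
      then show ?thesis using j Suc by (simp add: A_def)
    qed (use j in \<open>simp add: A_def\<close>)
    moreover have "i \<in> {j, Suc j}" if i: "x \<in> A i" for i
    proof (rule ccontr)
      assume *: "i \<notin> {j, Suc j}"
      have "j \<le> i" using i least[of i] by (simp add: A_def)
      then have ij: "Suc (Suc j) \<le> i" using * by auto
      then have "d x * 2 ^ i < 2" using i by (simp add: A_def split: if_splits)
      moreover have "d x * 2 ^ Suc (Suc j) \<le> d x * 2 ^ i"
        using ij dx by (intro mult_left_mono power_increasing) auto
      ultimately show False using j by simp
    qed
    ultimately show ?thesis by blast
  qed
  show thesis
  proof (rule that[of \<W> b])
    fix W assume "W \<in> \<W>"
    then show "open W" using C(2) Aopen by (auto simp: \<W>_def)
  next
    show "K - B \<subseteq> \<Union>\<W>"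
    proof
      fix x assume x: "x \<in> K - B"
      then obtain j where "x \<in> A j" using in_A by blast
      moreover obtain U where "U \<in> C j" "x \<in> U" using C(4) x by blast
      ultimately show "x \<in> \<Union>\<W>" by (auto simp: \<W>_def)
    qed
  next
    fix x assume "x \<notin> B"
    then have dx: "d x > 0" by (rule dpos)
    obtain J where J: "4 / d x < 2 ^ J" using real_arch_pow[of 2 "4 / d x"] by auto
    have "{W \<in> \<W>. W \<inter> {y. d x / 2 < d y} \<noteq> {}} \<subseteq> (\<Union>j\<le>J. (\<lambda>U. U \<inter> A j) ` C j)"
    proof
      fix W assume "W \<in> {W \<in> \<W>. W \<inter> {y. d x / 2 < d y} \<noteq> {}}"
      then obtain j U y where W: "W = U \<inter> A j" "U \<in> C j" "y \<in> A j" "d x / 2 < d y" by (auto simp: \<W>_def)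
      have "j \<le> J"
      proof (rule ccontr)
        assume "\<not> j \<le> J"
        then have j: "j > J" by simp
        then have "d y * 2^j < 2" using W(3) by (simp add: A_def split: if_splits)
        moreover have "d x / 2 * 2^J \<le> d y * 2^j" using j W(4) dx by (intro mult_mono power_increasing) auto
        moreover have "4 < d x * 2 ^ J" using J dx by (simp add: field_simps)
        ultimately show False by simp
      qed
      then show "W \<in> (\<Union>j\<le>J. (\<lambda>U. U \<inter> A j) ` C j)" using W by blast
    qed
    moreover have "finite (\<Union>j\<le>J. (\<lambda>U. U \<inter> A j) ` C j)" using C(1) by simp
    ultimately show "finite {W \<in> \<W>. W \<inter> {y. infdist x B / 2 < infdist y B} \<noteq> {}}"
      unfolding d_def[symmetric] by (rule finite_subset)
  next
    fix x assume x: "x \<in> K - B"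
    then obtain j where j: "\<And>i. x \<in> A i \<Longrightarrow> i \<in> {j, Suc j}" using in_A[of x] by blast
    define T where "T i = (\<lambda>U. U \<inter> A i) ` {U \<in> C i. x \<in> U}" for i
    have fin: "finite (T i)" for i using C(1) by (simp add: T_def)
    have T: "card (T i) \<le> N" for i
    proof -
      have "card (T i) \<le> card {U \<in> C i. x \<in> U}" unfolding T_def using C(1) by (intro card_image_le) simp
      also have "\<dots> \<le> N" using C(5) x by blast
      finally show ?thesis .
    qed
    have "{W \<in> \<W>. x \<in> W} \<subseteq> T j \<union> T (Suc j)"
    proof
      fix W assume "W \<in> {W \<in> \<W>. x \<in> W}"
      then obtain i U where W: "W = U \<inter> A i" "U \<in> C i" "x \<in> A i" "x \<in> U" by (auto simp: \<W>_def)
      then have "W \<in> T i" by (auto simp: T_def)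
      then show "W \<in> T j \<union> T (Suc j)" using j[OF W(3)] by auto
    qed
    then have "card {W \<in> \<W>. x \<in> W} \<le> card (T j \<union> T (Suc j))" using fin by (intro card_mono) auto
    also have "\<dots> \<le> card (T j) + card (T (Suc j))" by (rule card_Un_le)
    also have "\<dots> \<le> 2 * N" using T[of j] T[of "Suc j"] by simp
    finally show "card {W \<in> \<W>. x \<in> W} \<le> 2 * N" .
  next
    fix W x assume W: "W \<in> \<W>" and x: "x \<in> W \<inter> K"
    obtain j U where U: "W = U \<inter> A j" "U \<in> C j" using W by (auto simp: \<W>_def)
    have c: "c W \<in> W \<inter> K" unfolding c_def by (rule someI[of _ x]) (rule x)
    have A0: "0 < d y" if "y \<in> A j" for y
    proof (rule ccontr)
      assume "\<not> 0 < d y"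
      then have "d y * 2 ^ Suc j \<le> 0" by (intro mult_nonpos_nonneg) auto
      then show False using that by (simp add: A_def)
    qed
    have "d (c W) > 0" using A0 c U(1) by blast
    then have "infdist (c W) B < 2 * d (c W)" by (simp add: d_def)
    then have "\<exists>y. y \<in> B \<and> dist (c W) y < 2 * d (c W)"
      unfolding infdist_notempty[OF B(2)] by (subst (asm) cINF_less_iff) (auto simp: B)
    then have b: "b W \<in> B" "dist (c W) (b W) < 2 * d (c W)"
      unfolding b_def by (metis (mono_tags, lifting) someI_ex)+
    \<comment> \<open>The constant 8 is 2 + 6: \<open>x\<close> is within 2 d x of
      \<open>c W\<close>, so d (c W) is below 3 d x, and \<open>b W\<close> is within twice that
      distance of \<open>c W\<close>.\<close>
    have "dist x (c W) < (1/2)^j" using C(3)[OF U(2)] x c U(1) by blast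
    moreover have "1 < d x * 2 ^ Suc j" using x U(1) by (auto simp: A_def)
    then have "(1/2)^j < 2 * d x" by (simp add: field_simps power_divide)
    ultimately have xc: "dist x (c W) < 2 * d x" by linarith
    have "d (c W) \<le> d x + dist (c W) x" unfolding d_def by (rule infdist_triangle)
    then have "dist (c W) (b W) < 6 * d x" using b(2) xc by (simp add: dist_commute)
    then show "b W \<in> B \<and> dist x (b W) \<le> 8 * infdist x B"
      using b(1) xc dist_triangle[of x "b W" "c W"] by (simp add: d_def)
  qed
qed

text \<open>Off \<open>B\<close> the value is a locally finite average of values of \<open>f\<close>
  at the points \<open>b W\<close>. Continuity at a point of \<open>B\<close> rests on the average
  having at most \<open>2 * N\<close> terms, all of them taken near that point.\<close>

theorem extend_into_linear_topological_space:
  fixes K :: "'b::metric_space set" and f :: "'b \<Rightarrow> 'a::linear_topological_space"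
  assumes fc: "fine_covers K N" and B: "closed B" and f: "continuous_on B f"
  obtains g where "continuous_on K g" "\<And>x. x \<in> B \<Longrightarrow> g x = f x"
proof (cases "B = {}")
  case True
  then show thesis using that[of "\<lambda>_. 0"] by simp
next
  case ne: False
  obtain \<W> and b :: "'b set \<Rightarrow> 'b" where
    W: "\<And>W. W \<in> \<W> \<Longrightarrow> open W" "K - B \<subseteq> \<Union>\<W>"
    "\<And>x. x \<notin> B \<Longrightarrow> finite {W \<in> \<W>. W \<inter> {y. infdist x B / 2 < infdist y B} \<noteq> {}}"
    "\<And>x. x \<in> K - B \<Longrightarrow> card {W \<in> \<W>. x \<in> W} \<le> 2 * N"
    "\<And>W x. W \<in> \<W> \<Longrightarrow> x \<in> W \<inter> K \<Longrightarrow> b W \<in> B \<and> dist x (b W) \<le> 8 * infdist x B"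
    by (fact finite_order_Whitney_cover[OF fc B ne])
  define V where "V x = {y. infdist x B / 2 < infdist y B}" for x
  have V: "open (V x)" for x
    unfolding V_def by (intro open_Collect_less continuous_intros)
  have xV: "x \<in> V x" if "x \<notin> B" for x
    using infdist_pos_not_in_closed[OF B ne that] by (simp add: V_def)
  have VB: "V x \<inter> B = {}" for x
    using infdist_nonneg[of x B] by (auto simp: V_def)
  obtain F :: "'b set \<Rightarrow> 'b \<Rightarrow> real" where
    F: "\<And>W. W \<in> \<W> \<Longrightarrow> continuous_on (K - B) (F W) \<and> (\<forall>x \<in> K - B. 0 \<le> F W x)"
      "\<And>x W. \<lbrakk>W \<in> \<W>; x \<in> K - B; x \<notin> W\<rbrakk> \<Longrightarrow> F W x = 0"
      "\<And>x. x \<in> K - B \<Longrightarrow> supp_sum (\<lambda>W. F W x) \<W> = 1"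
  proof (rule subordinate_partition_of_unity[OF W(2) W(1)])
    fix x assume "x \<in> K - B"
    then show "\<exists>U. open U \<and> x \<in> U \<and> finite {W \<in> \<W>. W \<inter> U \<noteq> {}}"
      using V xV W(3)[of x] by (intro exI[of _ "V x"]) (auto simp: V_def)
  qed (assumption, rule that)
  define T where "T x = {W \<in> \<W>. x \<in> W}" for x
  have finT: "finite (T x)" if "x \<in> K - B" for x
  proof (rule finite_subset)
    show "T x \<subseteq> {W \<in> \<W>. W \<inter> V x \<noteq> {}}" using xV that by (auto simp: T_def)
  qed (use W(3) that in \<open>auto simp: V_def\<close>)
  have F1: "(\<Sum>W\<in>T x. F W x) = 1" if x: "x \<in> K - B" for x
  proof -
    have "supp_sum (\<lambda>W. F W x) \<W> = (\<Sum>W\<in>T x. F W x)"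
      unfolding supp_sum_def support_on_def
      using finT[OF x] F(2)[OF _ x] by (intro sum.mono_neutral_left) (auto simp: T_def)
    then show ?thesis using F(3)[OF x] by simp
  qed
  define g where "g x = (if x \<in> B then f x else \<Sum>W\<in>T x. F W x *\<^sub>R f (b W))" for x
  have "continuous (at x within K) g" if x: "x \<in> K" for x
    unfolding continuous_within_topological
  proof (intro allI impI)
    fix O' assume O': "open O'" "g x \<in> O'"
    show "\<exists>A. open A \<and> x \<in> A \<and> (\<forall>y\<in>K. y \<in> A \<longrightarrow> g y \<in> O')"
    proof (cases "x \<in> B")
      case False
      define \<W>0 where "\<W>0 = {W \<in> \<W>. W \<inter> V x \<noteq> {}}"
      have fin0: "finite \<W>0" using W(3)[OF False] by (simp add: \<W>0_def V_def)
      have eq: "(\<Sum>W\<in>\<W>0. F W y *\<^sub>R f (b W)) = g y" if y: "y \<in> K \<inter> V x" for y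
      proof -
        have yB: "y \<in> K - B" using y VB by blast
        have "(\<Sum>W\<in>\<W>0. F W y *\<^sub>R f (b W)) = (\<Sum>W\<in>T y. F W y *\<^sub>R f (b W))"
        proof (rule sum.mono_neutral_right[OF fin0])
          show "T y \<subseteq> \<W>0" using y by (auto simp: T_def \<W>0_def)
          show "\<forall>W\<in>\<W>0 - T y. F W y *\<^sub>R f (b W) = 0" using F(2)[OF _ yB] by (auto simp: T_def \<W>0_def)
        qed
        then show ?thesis using yB by (simp add: g_def)
      qed
      have sub: "K \<inter> V x \<subseteq> K - B" using VB by blast
      have "continuous_on (K \<inter> V x) (\<lambda>y. \<Sum>W\<in>\<W>0. F W y *\<^sub>R f (b W))"
      proof (intro continuous_on_sum continuous_on_scaleR_lts continuous_on_const)
        fix W assume "W \<in> \<W>0"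
        then have "continuous_on (K - B) (F W)" using F(1)[of W] by (simp add: \<W>0_def)
        then show "continuous_on (K \<inter> V x) (F W)" using sub by (rule continuous_on_subset)
      qed
      then have "continuous_on (K \<inter> V x) g" by (rule continuous_on_eq) (rule eq)
      moreover have "x \<in> K \<inter> V x" using x xV[OF False] by simp
      ultimately obtain A where A: "open A" "x \<in> A" "\<forall>y\<in>K \<inter> V x. y \<in> A \<longrightarrow> g y \<in> O'"
        using O' unfolding continuous_on_topological by meson
      then show ?thesis using V xV[OF False] by (intro exI[of _ "A \<inter> V x"]) auto
    next
      case True
      then have gx: "g x = f x" by (simp add: g_def)
      define O0 where "O0 = (\<lambda>v. f x + v) -` O'"
      have O0: "open O0" "0 \<in> O0"
        using O' gx unfolding O0_def by (auto intro!: open_vimage continuous_intros)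
      obtain Q where Q: "open Q" "0 \<in> Q"
        "\<And>A c v. finite (A::'b set set) \<Longrightarrow> card A \<le> 2 * N \<Longrightarrow> (\<And>a. a \<in> A \<Longrightarrow> \<bar>c a\<bar> \<le> 1) \<Longrightarrow>
          (\<And>a. a \<in> A \<Longrightarrow> v a \<in> Q) \<Longrightarrow> (\<Sum>a\<in>A. c a *\<^sub>R v a) \<in> O0"
        by (fact zero_nbhd_combination[OF O0, of "2 * N"])
      have "open ((\<lambda>v. v - f x) -` (Q \<inter> O0))" "f x \<in> (\<lambda>v. v - f x) -` (Q \<inter> O0)"
        using Q(1,2) O0 by (auto intro!: open_vimage continuous_intros open_Int)
      then obtain A where A: "open A" "x \<in> A" "\<forall>y\<in>B. y \<in> A \<longrightarrow> f y \<in> (\<lambda>v. v - f x) -` (Q \<inter> O0)"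
        using f True unfolding continuous_on_topological by meson
      obtain r where r: "r > 0" "ball x r \<subseteq> A" using A open_contains_ball by blast
      have near: "f y - f x \<in> Q \<inter> O0" if "y \<in> B" "dist x y < r" for y
        using A(3) r(2) that by auto
      show ?thesis
      \<comment> \<open>For \<open>y\<close> within r/9 of \<open>x\<close>, also
        \<open>infdist y B\<close> is below r/9, so every \<open>b W\<close> used at
        \<open>y\<close> lies within r/9 + 8 r/9 = r of \<open>x\<close>.\<close>
      proof (intro exI[of _ "ball x (r/9)"] conjI ballI impI)
        fix y assume y: "y \<in> K" "y \<in> ball x (r/9)"
        then have xy: "dist x y < r/9" by simp
        show "g y \<in> O'"
        proof (cases "y \<in> B")
          case True
          then have "f y - f x \<in> O0" using near[of y] xy r(1) by simp
          then show ?thesis using True by (simp add: O0_def g_def)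
        next
          case False
          then have yB: "y \<in> K - B" using y by simp
          have "(\<Sum>W\<in>T y. F W y *\<^sub>R (f (b W) - f x)) \<in> O0"
          proof (rule Q(3)[OF finT[OF yB]])
            show "card (T y) \<le> 2 * N" using W(4)[OF yB] by (simp add: T_def)
            fix W assume WT: "W \<in> T y"
            have nn: "\<forall>W\<in>T y. 0 \<le> F W y" using F(1) yB by (auto simp: T_def)
            have "F W y \<le> (\<Sum>W\<in>T y. F W y)" using WT nn finT[OF yB] by (intro member_le_sum) auto
            then show "\<bar>F W y\<bar> \<le> 1" using F1[OF yB] nn WT by simp
            have b: "b W \<in> B" "dist y (b W) \<le> 8 * infdist y B"
              using W(5)[of W y] WT y(1) by (auto simp: T_def)
            have "infdist y B \<le> dist y x" using True by (rule infdist_le)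
            then have "dist x (b W) < r"
              using b(2) xy dist_triangle[of x "b W" y] by (simp add: dist_commute)
            then show "f (b W) - f x \<in> Q" using near b(1) by blast
          qed
          also have "(\<Sum>W\<in>T y. F W y *\<^sub>R (f (b W) - f x)) = g y - f x"
            using F1[OF yB] False
            by (simp add: g_def scaleR_diff_right sum_subtractf scaleR_left.sum[symmetric])
          finally show ?thesis by (simp add: O0_def)
        qed
      qed (use r in auto)
    qed
  qed
  then have "continuous_on K g" by (simp add: continuous_on_eq_continuous_within)
  then show thesis by (rule that) (simp add: g_def)
qed

section \<open>Linear topological spaces exhausted by finite-dimensional compacta\<close>

definition lincomb :: "(nat \<Rightarrow> 'a::real_vector) \<Rightarrow> nat \<Rightarrow> (nat \<Rightarrow> real) \<Rightarrow> 'a" where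
  "lincomb v m x = (\<Sum>i<m. x i *\<^sub>R v i)"

lemma continuous_on_lincomb:
  fixes v :: "nat \<Rightarrow> 'a::linear_topological_space"
  shows "continuous_on S (lincomb v m)"
  unfolding lincomb_def
  by (intro continuous_on_sum continuous_on_scaleR_lts continuous_on_const
      continuous_on_subset[OF continuous_on_product_coordinates subset_UNIV])

lemma lincomb_eq_0D:
  assumes "inj v" "independent (range v)" "lincomb v m c = 0" "i < m"
  shows "c i = 0"
proof -
  have "(\<Sum>w\<in>v ` {..<m}. c (inv_into UNIV v w) *\<^sub>R w) = lincomb v m c"
    using assms(1) by (subst sum.reindex) (auto simp: lincomb_def inj_on_def)
  then have "(\<Sum>w\<in>v ` {..<m}. c (inv_into UNIV v w) *\<^sub>R w) = 0" using assms(3) by simp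
  then have "c (inv_into UNIV v (v i)) = 0"
    using assms(2,4) by (intro independentD[of "range v" "v ` {..<m}" "\<lambda>w. c (inv_into UNIV v w)"]) auto
  then show ?thesis using assms(1) by simp
qed

lemma inj_on_lincomb:
  assumes "inj v" "independent (range v)"
  shows "inj_on (lincomb v m) (Rn m)"
proof (rule inj_onI, rule ext)
  fix x y i assume x: "x \<in> Rn m" and y: "y \<in> Rn m" and "lincomb v m x = lincomb v m y"
  then have "lincomb v m (\<lambda>i. x i - y i) = 0"
    by (simp add: lincomb_def scaleR_diff_left sum_subtractf)
  from lincomb_eq_0D[OF assms this] show "x i = y i" using x y by (cases "i < m") auto
qed

lemma infinite_dimensional_independent_sequence:
  assumes "infinite_dimensional TYPE('a::real_vector)"
  obtains v :: "nat \<Rightarrow> 'a::real_vector" where "inj v" "independent (range v)"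
proof -
  obtain B :: "'a set" where B: "independent B" "UNIV \<subseteq> span B"
    by (rule maximal_independent_subset[of "UNIV :: 'a set"])
  then have "infinite B" using assms by (auto simp: infinite_dimensional_def)
  then obtain v :: "nat \<Rightarrow> 'a" where "inj v" "range v \<subseteq> B"
    using infinite_countable_subset by blast
  then show thesis using that B(1) independent_mono by blast
qed

lemma continuous_on_inv_if_compact_closed:
  fixes f :: "'b::t2_space \<Rightarrow> 'c::topological_space"
  assumes cl: "\<And>T::'c set. compact T \<Longrightarrow> closed T"
    and K: "compact K" and f: "continuous_on K f" and g: "\<And>x. x \<in> K \<Longrightarrow> g (f x) = x"
  shows "continuous_on (f ` K) g"
  unfolding continuous_on_closed_invariant
proof (intro allI impI)
  fix B :: "'b set" assume "closed B"
  then have "compact (K \<inter> B)" using K by (simp add: compact_Int_closed)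
  then have "closed (f ` (K \<inter> B))"
    using f by (intro cl compact_continuous_image continuous_on_subset[OF f]) auto
  moreover have "f ` (K \<inter> B) \<inter> f ` K = g -` B \<inter> f ` K" using g by auto
  ultimately show "\<exists>A. closed A \<and> A \<inter> f ` K = g -` B \<inter> f ` K" by blast
qed

text \<open>The group argument from T1 to Hausdorff: x + V and y - V can meet only if y - x lies in
  V + V, and \<open>W\<close> omits exactly y - x.\<close>

lemma Hausdorff_if_closed_singletons:
  assumes closed_singleton: "\<And>x::'a::linear_topological_space. closed {x}"
  shows "Hausdorff_space (euclidean :: 'a topology)"
  unfolding Hausdorff_space_def
proof (intro allI impI, elim conjE)
  fix x y :: 'a assume "x \<noteq> y"
  define W where "W = (\<lambda>v. x - y + v) -` (- {0})"
  have "open W" "0 \<in> W"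
    using \<open>x \<noteq> y\<close> unfolding W_def by (auto intro!: open_vimage continuous_intros open_Compl closed_singleton)
  then obtain V where V: "open V" "0 \<in> V" "\<And>a b. a \<in> V \<Longrightarrow> b \<in> V \<Longrightarrow> a + b \<in> W"
    by (metis zero_nbhd_add)
  define P where "P = (\<lambda>u. u - x) -` V"
  define Q where "Q = (\<lambda>u. y - u) -` V"
  have "open P" "open Q" "x \<in> P" "y \<in> Q"
    using V unfolding P_def Q_def by (auto intro!: open_vimage continuous_intros)
  moreover have "disjnt P Q"
  proof -
    have False if "u \<in> P" "u \<in> Q" for u
    proof -
      have "(u - x) + (y - u) \<in> W" by (rule V(3)) (use that in \<open>simp_all add: P_def Q_def\<close>)
      then show False by (simp add: W_def)
    qed
    then show ?thesis by (auto simp: disjnt_def)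
  qed
  ultimately show "\<exists>P Q. openin euclidean P \<and> openin euclidean Q \<and> x \<in> P \<and> y \<in> Q \<and> disjnt P Q"
    by (intro exI[of _ P] exI[of _ Q]) simp
qed

lemma compact_imp_closed_if_closed_singletons:
  assumes "\<And>x::'a::linear_topological_space. closed {x}" and "compact (S :: 'a set)"
  shows "closed S"
  using compactin_imp_closedin[OF Hausdorff_if_closed_singletons[OF assms(1)], of S] assms(2) by simp

text \<open>The direct limit structure carried over to subsets of the linear space itself.
  \<open>closed_if\<close> is the limit topology in terms of closed sets, and
  \<open>C_embeds\<close> is the form in which finite covering dimension survives.\<close>

locale compacta_limit =
  fixes C :: "nat \<Rightarrow> 'a::linear_topological_space set"
  assumes compact_C: "compact (C n)"
    and C_Suc: "C n \<subseteq> C (Suc n)"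
    and C_cover: "(\<Union>n. C n) = UNIV"
    and closed_if: "(\<And>n. closed (F \<inter> C n)) \<Longrightarrow> closed F"
    and closed_singleton: "closed {x::'a}"
    and C_embeds: "\<exists>e k. continuous_on (C n) e \<and> inj_on e (C n) \<and> e ` C n \<subseteq> Rn k"
begin

section \<open>Closed and compact subsets of the limit\<close>

lemma C_mono: "m \<le> n \<Longrightarrow> C m \<subseteq> C n"
  using C_Suc by (rule lift_Suc_mono_le)

lemma closed_finite: "finite F \<Longrightarrow> closed (F :: 'a set)"
proof (induction F rule: finite_induct)
  case (insert x F)
  then show ?case using closed_Un[OF closed_singleton[of x]] by simp
qed simp

lemma compact_imp_closed_lts: "compact (S :: 'a set) \<Longrightarrow> closed S"
  using compact_imp_closed_if_closed_singletons[OF closed_singleton] by simp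

lemma closed_if_locally_finite:
  assumes "\<And>n. finite (F \<inter> C n)"
  shows "closed F"
  by (rule closed_if, rule closed_finite, rule assms)

text \<open>Only terms with index below \<open>k\<close> can lie in \<open>C k\<close>, so every set
  of terms meets each piece in a finite set.\<close>

lemma closed_if_eventually_outside:
  assumes "\<And>n. p n \<notin> C n"
  shows "closed (p ` J)"
proof (rule closed_if_locally_finite, rule finite_subset)
  fix k
  show "p ` J \<inter> C k \<subseteq> p ` {..<k}"
  proof
    fix x assume "x \<in> p ` J \<inter> C k"
    then obtain m where m: "x = p m" "p m \<in> C k" by blast
    then have "m < k" using assms[of m] C_mono[of k m] by (meson not_less subsetD)
    then show "x \<in> p ` {..<k}" using m(1) by blast
  qed
qed simp

text \<open>Otherwise choose points \<open>p n\<close> of \<open>S\<close> outside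
  \<open>C n\<close>. The complements of the tails of this sequence form an open cover of
  \<open>S\<close> without a finite subcover.\<close>

lemma compact_subset_C:
  assumes S: "compact S"
  obtains n where "S \<subseteq> C n"
proof (rule ccontr)
  assume "\<not> thesis"
  then have "\<forall>n. \<exists>x. x \<in> S \<and> x \<notin> C n" using that by blast
  then obtain p where p: "\<And>n. p n \<in> S" "\<And>n. p n \<notin> C n" by metis
  have "open (- p ` {n..})" for n
    by (intro open_Compl closed_if_eventually_outside p(2))
  moreover have "S \<subseteq> (\<Union>n. - p ` {n..})"
  proof
    fix x
    obtain k where "x \<in> C k" using C_cover by blast
    then have "x \<notin> p ` {k..}" using p(2) C_mono by blast
    then show "x \<in> (\<Union>n. - p ` {n..})" by blast
  qed
  ultimately obtain I where I: "finite I" "S \<subseteq> (\<Union>n\<in>I. - p ` {n..})"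
    using compactE_image[OF S, of UNIV "\<lambda>n. - p ` {n..}"] by metis
  have "p (Max I) \<in> (\<Union>n\<in>I. - p ` {n..})" using p(1) I(2) by blast
  then show False using I(1) Max_ge by auto
qed

lemma compact_embeds:
  assumes "compact (S :: 'a set)"
  obtains e k where "continuous_on S e" "inj_on e S" "e ` S \<subseteq> Rn k"
proof -
  obtain n where n: "S \<subseteq> C n" by (rule compact_subset_C[OF assms])
  obtain e k where "continuous_on (C n) e" "inj_on e (C n)" "e ` C n \<subseteq> Rn k" using C_embeds by blast
  then show thesis using n that[of e k] continuous_on_subset inj_on_subset by blast
qed

text \<open>\<open>k\<close> is the dimension of a Euclidean space into which \<open>S\<close>
  embeds. The factor \<open>s\<close> allows for the shrunken boxes that the Baire argument
  produces.\<close>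

lemma boxes_in_compact_bounded_dimension:
  assumes "compact S" and v: "inj (v :: nat \<Rightarrow> 'a)" "independent (range v)"
  obtains k where "\<And>M a b s. k < M \<Longrightarrow> (\<And>i. i < M \<Longrightarrow> a i < b i) \<Longrightarrow> s \<noteq> 0 \<Longrightarrow>
    \<not> (\<lambda>x. s *\<^sub>R lincomb v M x) ` {x \<in> Rn M. \<forall>i<M. a i \<le> x i \<and> x i \<le> b i} \<subseteq> S"
proof -
  obtain e k where e: "continuous_on S e" "inj_on e S" "e ` S \<subseteq> Rn k"
    by (rule compact_embeds[OF assms(1)])
  show thesis
  proof (rule that[of k], rule notI)
    fix M and a b :: "nat \<Rightarrow> real" and s :: real
    assume M: "k < M" and ab: "\<And>i. i < M \<Longrightarrow> a i < b i" and s: "s \<noteq> 0"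
    let ?Q = "{x \<in> Rn M. \<forall>i<M. a i \<le> x i \<and> x i \<le> b i}" and ?L = "\<lambda>x. s *\<^sub>R lincomb v M x"
    assume sub: "?L ` ?Q \<subseteq> S"
    have 1: "continuous_on ?Q (\<lambda>x. e (?L x))"
    proof (rule continuous_on_compose2[OF e(1) _ sub])
      show "continuous_on ?Q ?L"
        by (intro continuous_on_scaleR_lts continuous_on_const continuous_on_lincomb)
    qed
    have 2: "inj_on (\<lambda>x. e (?L x)) ?Q"
    proof (rule inj_onI)
      fix x y assume x: "x \<in> ?Q" and y: "y \<in> ?Q" and "e (?L x) = e (?L y)"
      moreover have "?L x \<in> S" "?L y \<in> S" using sub x y by blast+
      ultimately have "?L x = ?L y" using e(2) by (meson inj_onD)
      then have "lincomb v M x = lincomb v M y" using s by simp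
      then show "x = y" using inj_on_lincomb[OF v] x y by (auto dest: inj_onD)
    qed
    have 3: "(\<lambda>x. e (?L x)) ` ?Q \<subseteq> Rn k" using sub e(3) by blast
    show False by (rule no_embedding_of_box_into_lower_dimension[OF ab M 1 2 3])
  qed
qed

text \<open>The direction must have no nonzero multiple in K - K. If every vector had one, the cube
  \<open>?Q\<close> of dimension above \<open>k\<close> would be the union of the closed sets
  \<open>F n\<close>; by Baire one of them contains a box, and a shrunken copy of that box would lie
  in the compact set \<open>D\<close>.\<close>

lemma transversal_direction:
  assumes inf: "infinite_dimensional TYPE('a)" and K: "compact (K :: 'a set)"
  obtains y where "\<And>s a b. a \<in> K \<Longrightarrow> b \<in> K \<Longrightarrow> s *\<^sub>R y = a - b \<Longrightarrow> s = 0"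
proof (rule ccontr)
  assume *: "\<not> thesis"
  have all: "\<exists>s a b. a \<in> K \<and> b \<in> K \<and> s *\<^sub>R y = a - b \<and> s \<noteq> 0" for y
    using * that by blast
  obtain v :: "nat \<Rightarrow> 'a" where v: "inj v" "independent (range v)"
    by (fact infinite_dimensional_independent_sequence[OF inf])
  define D where "D = (\<lambda>p. fst p *\<^sub>R (fst (snd p) - snd (snd p))) ` ({-1..1::real} \<times> K \<times> K)"
  have D: "compact D"
    unfolding D_def
    by (intro compact_continuous_image compact_Times K compact_Icc continuous_on_scaleR_lts continuous_intros)
  obtain k where k: "\<And>M a b s. k < M \<Longrightarrow> (\<And>i. i < M \<Longrightarrow> a i < b i) \<Longrightarrow> s \<noteq> 0 \<Longrightarrow>
    \<not> (\<lambda>x. s *\<^sub>R lincomb v M x) ` {x \<in> Rn M. \<forall>i<M. a i \<le> x i \<and> x i \<le> b i} \<subseteq> D"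
    by (fact boxes_in_compact_bounded_dimension[OF D v])
  define M where "M = Suc k"
  let ?Q = "{x \<in> Rn M. \<forall>i<M. 0 \<le> x i \<and> x i \<le> (1::real)}"
  \<comment> \<open>The points of the cube whose image divided by \<open>n + 1\<close> lies in
    \<open>D\<close>. If s times the image lies in K - K, the quotient 1/(s (n+1)) is in [-1,1] for
    large \<open>n\<close>; this is the purpose of the interval in \<open>D\<close>.\<close>
  define F where "F n = ?Q \<inter> (\<lambda>x. (1 / real (Suc n)) *\<^sub>R lincomb v M x) -` D" for n
  have "?Q = {x. \<forall>i. 0 \<le> x i \<and> x i \<le> (if i < M then 1 else 0)}"
    by (auto simp: not_less order_antisym)
  then have Q: "compact ?Q" using compact_box[of "\<lambda>_. 0" "\<lambda>i. if i < M then 1 else 0"] by (simp only:)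
  have "continuous_on UNIV (\<lambda>x. (1 / real (Suc n)) *\<^sub>R lincomb v M x)" for n
    by (intro continuous_on_scaleR_lts continuous_on_const continuous_on_lincomb)
  then have "closed ((\<lambda>x. (1 / real (Suc n)) *\<^sub>R lincomb v M x) -` D)" for n
    using compact_imp_closed_lts[OF D] by (intro closed_vimage) auto
  then have F: "closedin (top_of_set ?Q) (F n)" for n
    unfolding F_def by (simp add: closedin_closed_Int)
  have cov: "?Q \<subseteq> (\<Union>n. F n)"
  proof
    fix x assume x: "x \<in> ?Q"
    obtain s a b where s: "a \<in> K" "b \<in> K" "s *\<^sub>R lincomb v M x = a - b" "s \<noteq> 0" using all by blast
    obtain n where n: "1 / \<bar>s\<bar> < real n" using reals_Archimedean2 by blast
    have "\<bar>1 / s / real (Suc n)\<bar> \<le> 1" using n s(4) by (simp add: abs_mult field_simps abs_if split: if_splits)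
    then have "1 / s / real (Suc n) \<in> {-1..1}" unfolding abs_le_iff atLeastAtMost_iff by linarith
    moreover have "(1 / real (Suc n)) *\<^sub>R lincomb v M x = (1 / s / real (Suc n)) *\<^sub>R (a - b)"
      using s(3)[symmetric] s(4) by simp
    ultimately have "(1 / real (Suc n)) *\<^sub>R lincomb v M x \<in> D"
      using s(1,2) unfolding D_def
      by (intro image_eqI[of _ _ "(1 / s / real (Suc n), a, b)"]) simp_all
    then show "x \<in> (\<Union>n. F n)" using x by (auto simp: F_def)
  qed
  have "\<exists>n. top_of_set ?Q interior_of F n \<noteq> {}"
  proof (rule ccontr)
    assume "\<nexists>n. top_of_set ?Q interior_of F n \<noteq> {}"
    then have "top_of_set ?Q interior_of \<Union>(range F) = {}"
    proof (intro Baire_category_alt disjI2 conjI)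
      show "locally_compact_space (top_of_set ?Q)"
        using Q by (intro compact_imp_locally_compact_space) (simp add: compact_space_subtopology)
      show "regular_space (top_of_set ?Q)"
        by (intro metrizable_imp_regular_space metrizable_space_subtopology metrizable_space_euclidean)
    qed (use F in auto)
    moreover have "top_of_set ?Q interior_of \<Union>(range F) = ?Q"
      using cov by (intro interior_of_unique) (auto simp: F_def)
    moreover have "(\<lambda>_. 0) \<in> ?Q" by simp
    ultimately show False by (metis empty_iff)
  qed
  then obtain n p where "p \<in> top_of_set ?Q interior_of F n" by blast
  then obtain U where U: "openin (top_of_set ?Q) U" "p \<in> U" "U \<subseteq> F n"
    unfolding interior_of_def by blast
  then obtain W where W: "open W" "U = ?Q \<inter> W" unfolding openin_open by blast
  obtain r where r: "r > 0" "ball p r \<subseteq> W" using W U(2) open_contains_ball by blast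
  have pQ: "p \<in> ?Q" using U(2) W(2) by blast
  \<comment> \<open>A box around \<open>p\<close> with the bound r/8 of
    \<open>dist_fun_less\<close>. Since \<open>p\<close> lies in the unit cube, cutting the box off
    at 0 and 1 leaves every side nondegenerate.\<close>
  define a where "a i = max 0 (p i - r/8)" for i
  define b where "b i = min 1 (p i + r/8)" for i
  have "a i < b i" if "i < M" for i using that pQ r(1) by (auto simp: a_def b_def)
  moreover have "(\<lambda>x. (1 / real (Suc n)) *\<^sub>R lincomb v M x) `
      {x \<in> Rn M. \<forall>i<M. a i \<le> x i \<and> x i \<le> b i} \<subseteq> D"
  proof
    fix z assume "z \<in> (\<lambda>x. (1 / real (Suc n)) *\<^sub>R lincomb v M x) ` {x \<in> Rn M. \<forall>i<M. a i \<le> x i \<and> x i \<le> b i}"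
    then obtain x where x: "z = (1 / real (Suc n)) *\<^sub>R lincomb v M x" "x \<in> Rn M" "\<forall>i<M. a i \<le> x i \<and> x i \<le> b i"
      by blast
    have xQ: "x \<in> ?Q" using x(2,3) by (auto simp: a_def b_def)
    have "dist p x < r"
    proof (rule dist_fun_less[OF r(1)])
      fix i show "\<bar>p i - x i\<bar> \<le> r / 8"
      proof (cases "i < M")
        case True
        then have "a i \<le> x i \<and> x i \<le> b i" using x(3) by blast
        then show ?thesis unfolding a_def b_def by linarith
      qed (use x(2) pQ r(1) in auto)
    qed
    then have "x \<in> U" using xQ r(2) W(2) by auto
    then have "x \<in> F n" using U(3) by blast
    then show "z \<in> D" using x(1) by (simp add: F_def)
  qed
  ultimately show False using k[of M a b "1 / real (Suc n)"] by (simp add: M_def)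
qed

text \<open>Adding \<open>u\<close> times a direction transversal to the image of \<open>g\<close>
  records the real function \<open>u\<close> without losing any information about
  \<open>g\<close>.\<close>

lemma add_transversal_direction:
  assumes inf: "infinite_dimensional TYPE('a)" and K: "compact K"
    and g: "continuous_on K (g :: 'b::topological_space \<Rightarrow> 'a)"
  obtains y where "\<And>x x'. x \<in> K \<Longrightarrow> x' \<in> K \<Longrightarrow> g x + u x *\<^sub>R y = g x' + u x' *\<^sub>R y \<Longrightarrow>
    u x = u x' \<and> g x = g x'"
proof -
  obtain y where y: "\<And>s a b. a \<in> g ` K \<Longrightarrow> b \<in> g ` K \<Longrightarrow> s *\<^sub>R y = a - b \<Longrightarrow> s = 0"
    by (fact transversal_direction[OF inf compact_continuous_image[OF g K]])
  show thesis
  proof (rule that[of y])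
    fix x x' assume x: "x \<in> K" "x' \<in> K" and eq: "g x + u x *\<^sub>R y = g x' + u x' *\<^sub>R y"
    then have "(u x' - u x) *\<^sub>R y = g x - g x'" by (simp add: algebra_simps)
    then have "u x' - u x = 0" using y x by blast
    then show "u x = u x' \<and> g x = g x'" using eq by simp
  qed
qed

lemma add_transversal_directions:
  fixes u :: "nat \<Rightarrow> 'b::topological_space \<Rightarrow> real"
  assumes inf: "infinite_dimensional TYPE('a)" and K: "compact K"
    and g: "continuous_on K (g :: 'b \<Rightarrow> 'a)" and u: "\<And>i. i < r \<Longrightarrow> continuous_on K (u i)"
  shows "\<exists>y. \<forall>x\<in>K. \<forall>x'\<in>K. g x + (\<Sum>i<r. u i x *\<^sub>R y i) = g x' + (\<Sum>i<r. u i x' *\<^sub>R y i) \<longrightarrow>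
    (\<forall>i<r. u i x = u i x') \<and> g x = g x'"
  using u
proof (induction r)
  case (Suc r)
  have "\<exists>y. \<forall>x\<in>K. \<forall>x'\<in>K. g x + (\<Sum>i<r. u i x *\<^sub>R y i) = g x' + (\<Sum>i<r. u i x' *\<^sub>R y i) \<longrightarrow>
    (\<forall>i<r. u i x = u i x') \<and> g x = g x'"
    by (rule Suc.IH) (rule Suc.prems, simp)
  then obtain y where "\<forall>x\<in>K. \<forall>x'\<in>K. g x + (\<Sum>i<r. u i x *\<^sub>R y i) = g x' + (\<Sum>i<r. u i x' *\<^sub>R y i) \<longrightarrow>
    (\<forall>i<r. u i x = u i x') \<and> g x = g x'" by (rule exE)
  then have y: "\<And>x x'. x\<in>K \<Longrightarrow> x'\<in>K \<Longrightarrow>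
      g x + (\<Sum>i<r. u i x *\<^sub>R y i) = g x' + (\<Sum>i<r. u i x' *\<^sub>R y i) \<Longrightarrow>
      (\<forall>i<r. u i x = u i x') \<and> g x = g x'" by blast
  define h where "h x = g x + (\<Sum>i<r. u i x *\<^sub>R y i)" for x
  have hc: "continuous_on K h"
    unfolding h_def
    by (intro continuous_on_add g continuous_on_sum continuous_on_scaleR_lts continuous_on_const Suc.prems) auto
  \<comment> \<open>The new direction is transversal to the image of the whole sum \<open>h\<close>
    built so far, not just to that of \<open>g\<close>.\<close>
  obtain z where z: "\<And>x x'. x \<in> K \<Longrightarrow> x' \<in> K \<Longrightarrow> h x + u r x *\<^sub>R z = h x' + u r x' *\<^sub>R z \<Longrightarrow> u r x = u r x' \<and> h x = h x'"
    by (fact add_transversal_direction[OF inf K hc, of "u r"])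
  define y' where "y' = y(r := z)"
  have eq: "g x + (\<Sum>i<Suc r. u i x *\<^sub>R y' i) = h x + u r x *\<^sub>R z" for x
    by (simp add: h_def y'_def)
  show ?case
  proof (intro exI[of _ y'] ballI impI)
    fix x x' assume x: "x \<in> K" "x' \<in> K"
      "g x + (\<Sum>i<Suc r. u i x *\<^sub>R y' i) = g x' + (\<Sum>i<Suc r. u i x' *\<^sub>R y' i)"
    have 1: "u r x = u r x' \<and> h x = h x'" using x(3) unfolding eq by (rule z[OF x(1,2)])
    then have "g x + (\<Sum>i<r. u i x *\<^sub>R y i) = g x' + (\<Sum>i<r. u i x' *\<^sub>R y i)" by (simp add: h_def)
    then have "(\<forall>i<r. u i x = u i x') \<and> g x = g x'" by (rule y[OF x(1,2)])
    then show "(\<forall>i<Suc r. u i x = u i x') \<and> g x = g x'" using 1 by (auto simp: less_Suc_eq)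
  qed
qed simp

lemma extend_embedding_to_cube:
  assumes inf: "infinite_dimensional TYPE('a)"
    and B: "closed B" "B \<subseteq> cube m" and f: "continuous_on B (f :: (nat \<Rightarrow> real) \<Rightarrow> 'a)" "inj_on f B"
  obtains g where "continuous_on (cube m) g" "inj_on g (cube m)" "\<And>x. x \<in> B \<Longrightarrow> g x = f x"
proof -
  obtain g0 where g0: "continuous_on (cube m) g0" "\<And>x. x \<in> B \<Longrightarrow> g0 x = f x"
    by (fact extend_into_linear_topological_space[OF fine_covers_cube B(1) f(1)])
  define d where "d x = (if B = {} then 1 else infdist x B)" for x
  have d: "continuous_on S d" for S
    by (cases "B = {}") (auto simp: d_def intro!: continuous_intros)
  have d0: "d x = 0 \<longleftrightarrow> x \<in> B" for x
    using in_closed_iff_infdist_zero[OF B(1), of x] by (auto simp: d_def)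
  \<comment> \<open>\<open>d\<close> vanishes exactly on \<open>B\<close>, and off \<open>B\<close>
    it determines \<open>x\<close> together with the products d x * x i. So the added terms leave
    the map unchanged on \<open>B\<close> and make it injective. Index 0 is taken by
    \<open>d\<close>, which shifts the coordinates by one.\<close>
  define u where "u i x = (if i = 0 then d x else d x * x (i - 1))" for i and x :: "nat \<Rightarrow> real"
  have uc: "continuous_on (cube m) (u i)" for i
    unfolding u_def
    by (cases "i = 0") (auto intro!: continuous_on_mult d continuous_on_subset[OF continuous_on_product_coordinates])
  have "\<exists>y. \<forall>x\<in>cube m. \<forall>x'\<in>cube m.
      g0 x + (\<Sum>i<Suc m. u i x *\<^sub>R y i) = g0 x' + (\<Sum>i<Suc m. u i x' *\<^sub>R y i) \<longrightarrow>
      (\<forall>i<Suc m. u i x = u i x') \<and> g0 x = g0 x'"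
    by (intro add_transversal_directions[OF inf compact_cube g0(1)] uc)
  then obtain y where "\<forall>x\<in>cube m. \<forall>x'\<in>cube m.
      g0 x + (\<Sum>i<Suc m. u i x *\<^sub>R y i) = g0 x' + (\<Sum>i<Suc m. u i x' *\<^sub>R y i) \<longrightarrow>
      (\<forall>i<Suc m. u i x = u i x') \<and> g0 x = g0 x'" by (rule exE)
  then have y: "\<And>x x'. x \<in> cube m \<Longrightarrow> x' \<in> cube m \<Longrightarrow>
      g0 x + (\<Sum>i<Suc m. u i x *\<^sub>R y i) = g0 x' + (\<Sum>i<Suc m. u i x' *\<^sub>R y i) \<Longrightarrow>
      (\<forall>i<Suc m. u i x = u i x') \<and> g0 x = g0 x'"
    by blast
  define g where "g x = g0 x + (\<Sum>i<Suc m. u i x *\<^sub>R y i)" for x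
  show thesis
  proof (rule that[of g])
    show "continuous_on (cube m) g"
      unfolding g_def
      by (intro continuous_on_add g0(1) continuous_on_sum continuous_on_scaleR_lts continuous_on_const uc)
    show "g x = f x" if "x \<in> B" for x
    proof -
      have "u i x = 0" for i using that d0 by (simp add: u_def)
      then show ?thesis using g0(2)[OF that] by (simp add: g_def)
    qed
    show "inj_on g (cube m)"
    proof (rule inj_onI)
      fix x x' assume x: "x \<in> cube m" "x' \<in> cube m" and "g x = g x'"
      from \<open>g x = g x'\<close> have eq: "(\<forall>i<Suc m. u i x = u i x') \<and> g0 x = g0 x'"
        unfolding g_def by (rule y[OF x])
      then have "u 0 x = u 0 x'" by (meson zero_less_Suc)
      then have dd: "d x = d x'" by (simp add: u_def)
      show "x = x'"
      proof (cases "d x = 0")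
        case True
        then have xB: "x \<in> B" "x' \<in> B" using d0[of x] d0[of x'] dd by simp_all
        have "f x = f x'" using eq g0(2)[OF xB(1)] g0(2)[OF xB(2)] by simp
        then show ?thesis using f(2) xB by (simp add: inj_on_eq_iff)
      next
        case False
        have "x i = x' i" for i
        proof (cases "i < m")
          case True
          then have "u (Suc i) x = u (Suc i) x'" using eq by (meson Suc_mono)
          then show ?thesis using False dd by (simp add: u_def)
        qed (use x in \<open>simp add: cube_def\<close>)
        then show ?thesis by (rule ext)
      qed
    qed
  qed
qed

end

section \<open>Homeomorphisms with \<open>\<real>\<^sup>\<infinity>\<close>\<close>

lemma topspace_R_infinity_Rn: "topspace R_infinity = (\<Union>n. Rn n)"
proof -
  have "x \<in> Rn (Suc n)" if "x \<in> Rn n" for x n using that by simp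
  then show ?thesis by (auto simp: R_infinity_def topspace_Euclidean_space)
qed

lemma closedin_R_infinity:
  "closedin R_infinity F \<longleftrightarrow> F \<subseteq> topspace R_infinity \<and> (\<forall>n. closed (F \<inter> Rn (Suc n)))"
proof -
  have *: "openin (Euclidean_space (Suc n)) ((topspace R_infinity - F) \<inter> topspace (Euclidean_space (Suc n)))
      \<longleftrightarrow> closed (F \<inter> Rn (Suc n))" for n
  proof -
    have "(topspace R_infinity - F) \<inter> topspace (Euclidean_space (Suc n)) =
        topspace (Euclidean_space (Suc n)) - (F \<inter> Rn (Suc n))"
      by (auto simp: R_infinity_def topspace_Euclidean_space)
    moreover have "openin (Euclidean_space (Suc n)) (topspace (Euclidean_space (Suc n)) - (F \<inter> Rn (Suc n)))
        \<longleftrightarrow> closedin (Euclidean_space (Suc n)) (F \<inter> Rn (Suc n))"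
      by (auto simp: closedin_def topspace_Euclidean_space)
    ultimately show ?thesis by (auto simp: closedin_Euclidean_space_iff topspace_Euclidean_space)
  qed
  have "openin R_infinity (topspace R_infinity - F) \<longleftrightarrow> (\<forall>n. closed (F \<inter> Rn (Suc n)))"
    unfolding *[symmetric] by (subst R_infinity_def) (auto simp: openin_direct_limit R_infinity_def)
  then show ?thesis by (simp add: closedin_def)
qed

lemma closed_Rn: "closed (Rn k)"
proof -
  have "Rn k = (\<Inter>i\<in>{k..}. {x. x i = 0})" by auto
  then show ?thesis
    by (simp only:) (intro closed_INT ballI closed_Collect_eq continuous_on_const continuous_on_product_coordinates)
qed

text \<open>The open sets \<open>W m\<close> cover \<open>Rn k\<close>, and for \<open>m\<close> at
  least \<open>k\<close> the trace of \<open>W m\<close> on \<open>Rn k\<close> lies in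
  \<open>cube m\<close>. Hence the cubes determine the topology of \<open>Rn k\<close>.\<close>

lemma closed_if_closed_Int_cubes:
  assumes F: "F \<subseteq> Rn k" and cl: "\<And>m. closed (F \<inter> cube m)"
  shows "closed F"
proof -
  define W where "W m = {x::nat \<Rightarrow> real. \<forall>i\<in>{..<k}. \<bar>x i\<bar> < real m}" for m
  have W: "open (W m)" for m
    unfolding W_def Collect_ball_eq
    by (intro open_INT ballI open_Collect_less continuous_on_const continuous_on_rabs
        continuous_on_product_coordinates finite_lessThan)
  have "- F = - Rn k \<union> (\<Union>m\<in>{k..}. W m - F \<inter> cube m)"
  proof (intro equalityI subsetI)
    fix x assume x: "x \<in> - F"
    show "x \<in> - Rn k \<union> (\<Union>m\<in>{k..}. W m - F \<inter> cube m)"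
    proof (cases "x \<in> Rn k")
      case True
      then obtain m where m: "x \<in> cube m" using Rn_subset_cubes by blast
      have "\<bar>x i\<bar> < real (Suc (m + k))" for i
      proof -
        have "\<bar>x i\<bar> \<le> real m" using m by (cases "i < m") (auto simp: cube_def)
        then show ?thesis by simp
      qed
      then have "x \<in> W (Suc (m + k))" by (simp add: W_def)
      then show ?thesis using x by (intro UnI2 UN_I[of "Suc (m + k)"]) auto
    qed simp
  next
    fix x assume x: "x \<in> - Rn k \<union> (\<Union>m\<in>{k..}. W m - F \<inter> cube m)"
    show "x \<in> - F"
    proof
      assume xF: "x \<in> F"
      then have "x \<in> Rn k" using F by blast
      then obtain m where m: "m \<ge> k" "x \<in> W m" "x \<notin> F \<inter> cube m" using x by blast
      have "\<bar>x i\<bar> \<le> real m" for i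
        using m(2) \<open>x \<in> Rn k\<close> by (cases "i < k") (auto simp: W_def less_imp_le)
      then have "x \<in> cube m" using \<open>x \<in> Rn k\<close> m(1) by (auto simp: cube_def)
      then show False using m(3) xF by blast
    qed
  qed
  moreover have "open (- Rn k \<union> (\<Union>m\<in>{k..}. W m - F \<inter> cube m))"
    using closed_Rn W cl by (intro open_Un open_UN ballI open_Diff open_Compl) auto
  ultimately show ?thesis by (simp add: closed_def)
qed

lemma compact_subset_cube:
  assumes T: "compact T" "T \<subseteq> Rn k"
  obtains m0 where "\<And>m. m \<ge> m0 \<Longrightarrow> T \<subseteq> cube m"
proof -
  have "continuous_on T (\<lambda>x. \<Sum>i<k. \<bar>x i\<bar>)"
    by (intro continuous_on_sum continuous_on_rabs continuous_on_subset[OF continuous_on_product_coordinates subset_UNIV])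
  then have "compact ((\<lambda>x. \<Sum>i<k. \<bar>x i\<bar>) ` T)" using T(1) by (rule compact_continuous_image)
  then have "bounded ((\<lambda>x. \<Sum>i<k. \<bar>x i\<bar>) ` T)" by (rule compact_imp_bounded)
  then obtain R where R: "\<And>x. x \<in> T \<Longrightarrow> \<bar>\<Sum>i<k. \<bar>x i\<bar>\<bar> \<le> R" unfolding bounded_real by blast
  show thesis
  proof (rule that[of "k + nat \<lceil>R\<rceil>"], rule subsetI)
    fix m x assume m: "m \<ge> k + nat \<lceil>R\<rceil>" and x: "x \<in> T"
    have "\<bar>x i\<bar> \<le> real m" for i
    proof (cases "i < k")
      case True
      then have "\<bar>x i\<bar> \<le> (\<Sum>i<k. \<bar>x i\<bar>)" by (intro member_le_sum) auto
      then have "\<bar>x i\<bar> \<le> R" using R[OF x] by linarith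
      then show ?thesis using m by linarith
    qed (use x T(2) in auto)
    then show "x \<in> cube m" using x T(2) m by (auto simp: cube_def)
  qed
qed

context compacta_limit
begin

text \<open>Closedness of the map is where \<open>surj\<close> enters: inside \<open>C n\<close> the
  image of a closed set \<open>F\<close> agrees, by injectivity, with the image of the compact part
  of \<open>F\<close> in a cube whose image contains \<open>C n\<close>.\<close>

lemma homeomorphic_map_R_infinityI:
  fixes h :: "(nat \<Rightarrow> real) \<Rightarrow> 'a"
  assumes inj: "inj_on h (topspace R_infinity)" and cont: "\<And>m. continuous_on (cube m) h"
    and surj: "\<And>n. \<exists>m. C n \<subseteq> h ` cube m"
  shows "homeomorphic_map R_infinity euclidean h"
proof (rule bijective_closed_imp_homeomorphic_map)
  have cubeT: "cube m \<subseteq> topspace R_infinity" for m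
    by (auto simp: topspace_R_infinity_Rn cube_def)
  show "continuous_map R_infinity euclidean h"
    unfolding continuous_map_closedin
  proof (intro conjI allI impI)
    fix S assume "closedin (euclidean :: 'a topology) S"
    then have S: "closed S" by simp
    show "closedin R_infinity {x \<in> topspace R_infinity. h x \<in> S}"
      unfolding closedin_R_infinity
    proof (intro conjI allI)
      fix n
      show "closed ({x \<in> topspace R_infinity. h x \<in> S} \<inter> Rn (Suc n))"
      proof (rule closed_if_closed_Int_cubes[of _ "Suc n"])
        fix m
        have "closed (cube m \<inter> h -` S)"
          using cont S compact_imp_closed[OF compact_cube] by (intro continuous_closed_preimage)
        then have "closed ((cube m \<inter> h -` S) \<inter> Rn (Suc n))" using closed_Rn by (rule closed_Int)
        moreover have "{x \<in> topspace R_infinity. h x \<in> S} \<inter> Rn (Suc n) \<inter> cube m = (cube m \<inter> h -` S) \<inter> Rn (Suc n)"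
          using cubeT[of m] by blast
        ultimately show "closed ({x \<in> topspace R_infinity. h x \<in> S} \<inter> Rn (Suc n) \<inter> cube m)" by simp
      qed blast
    qed blast
  qed simp
  show "closed_map R_infinity euclidean h"
    unfolding closed_map_def
  proof (intro allI impI)
    fix F assume F: "closedin R_infinity F"
    have "closed (h ` F \<inter> C n)" for n
    proof -
      obtain m where m: "C n \<subseteq> h ` cube m" using surj by blast
      have "F \<inter> cube m = F \<inter> Rn (Suc m) \<inter> cube m" by (auto simp: cube_def)
      then have "compact (F \<inter> cube m)"
        using F compact_cube[of m] by (auto simp: closedin_R_infinity closed_Int_compact)
      then have "compact (h ` (F \<inter> cube m))"
        by (rule compact_continuous_image[OF continuous_on_subset[OF cont Int_lower2]])
      then have "closed (h ` (F \<inter> cube m) \<inter> C n)"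
        by (intro closed_Int compact_imp_closed_lts compact_C)
      moreover have "h ` (F \<inter> cube m) \<inter> C n = h ` F \<inter> C n"
      proof -
        have "h x \<in> h ` (F \<inter> cube m)" if "x \<in> F" "h x \<in> C n" for x
        proof -
          obtain y where y: "y \<in> cube m" "h x = h y" using m \<open>h x \<in> C n\<close> by blast
          have "x \<in> topspace R_infinity" using F \<open>x \<in> F\<close> closedin_subset by blast
          then have "x = y" using inj y cubeT by (meson inj_onD subsetD)
          then show ?thesis using y(1) \<open>x \<in> F\<close> by blast
        qed
        then show ?thesis by blast
      qed
      ultimately show ?thesis by simp
    qed
    then show "closedin euclidean (h ` F)" using closed_if by simp
  qed
  show "h ` topspace R_infinity = topspace euclidean"
  proof -
    have "a \<in> h ` topspace R_infinity" for a
    proof -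
      obtain n where "a \<in> C n" using C_cover by blast
      then show ?thesis using surj[of n] cubeT by blast
    qed
    then show ?thesis by auto
  qed
qed (rule inj)

text \<open>Back and forth: \<^term>\<open>C n\<close> is first embedded into some \<open>\<real>\<^sup>k\<close> by a map inverting
  \<^term>\<open>g\<close>, with two extra groups of coordinates, the distance \<open>d\<close> to the image of \<^term>\<open>g\<close> and
  \<open>d\<close> times an embedding; the inverse of that map is then extended over a larger cube.\<close>

lemma back_and_forth_step:
  fixes g :: "(nat \<Rightarrow> real) \<Rightarrow> 'a"
  assumes inf: "infinite_dimensional TYPE('a)"
    and g: "continuous_on (cube m) g" "inj_on g (cube m)"
  obtains m' g' where "m < m'" "continuous_on (cube m') g'" "inj_on g' (cube m')"
    "\<And>x. x \<in> cube m \<Longrightarrow> g' x = g x" "C n \<subseteq> g' ` cube m'"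
proof -
  define P where "P = g ` cube m"
  have P: "compact P" unfolding P_def by (rule compact_continuous_image[OF g(1) compact_cube])
  obtain N where N: "P \<union> C n \<subseteq> C N" using compact_subset_C[OF compact_Un[OF P compact_C]] by blast
  obtain e k where e: "continuous_on (C N) e" "inj_on e (C N)" "e ` C N \<subseteq> Rn k" using C_embeds by blast
  define gi where "gi = inv_into (cube m) g"
  define ei where "ei = inv_into (C N) e"
  have gi: "gi (g x) = x" if "x \<in> cube m" for x using g(2) that by (simp add: gi_def)
  have giP: "gi a \<in> cube m" "g (gi a) = a" if "a \<in> P" for a
    using that unfolding P_def gi_def by (simp_all add: inv_into_into f_inv_into_f)
  have ei: "ei (e a) = a" if "a \<in> C N" for a using e(2) that by (simp add: ei_def)
  have gi_cont: "continuous_on P gi"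
    unfolding P_def using compact_imp_closed_lts compact_cube g(1) gi
    by (rule continuous_on_inv_if_compact_closed)
  have PN: "P \<subseteq> C N" using N by blast
  define A where "A = e ` P"
  have A: "compact A" unfolding A_def
    using P continuous_on_subset[OF e(1) PN] by (intro compact_continuous_image)
  have "P \<noteq> {}"
  proof -
    have "(\<lambda>_. 0) \<in> cube m" by (simp add: cube_def)
    then show ?thesis by (auto simp: P_def)
  qed
  then have ne: "A \<noteq> {}" by (auto simp: A_def)
  have ei_cont: "continuous_on A ei"
    unfolding A_def using continuous_on_subset[OF e(1) PN] P
    by (rule continuous_on_inv) (use ei PN in blast)
  have eiA: "ei ` A \<subseteq> P" using ei PN by (auto simp: A_def)
  \<comment> \<open>The inverse of \<open>g\<close>, read through \<open>e\<close>, is extended from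
    \<open>A\<close> to all sequences by Tietze's theorem, one coordinate at a time.\<close>
  have "\<exists>H. continuous_on UNIV H \<and> (\<forall>z\<in>A. H z = gi (ei z) i)" for i
  proof -
    have "continuous_on A (\<lambda>z. gi (ei z))" by (rule continuous_on_compose2[OF gi_cont ei_cont eiA])
    then have "continuous_on A (\<lambda>z. gi (ei z) i)" by (rule continuous_on_product_then_coordinatewise)
    moreover have "closedin (top_of_set UNIV) A" using compact_imp_closed[OF A] by simp
    moreover have "norm (gi (ei z) i) \<le> real m" if "z \<in> A" for z
    proof -
      have "gi (ei z) \<in> cube m" using eiA that giP by blast
      then show ?thesis by (cases "i < m") (auto simp: cube_def)
    qed
    ultimately obtain H where "continuous_on UNIV H" "\<And>z. z \<in> A \<Longrightarrow> H z = gi (ei z) i"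
      using Tietze[of A "\<lambda>z. gi (ei z) i" UNIV "real m"] by (metis of_nat_0_le_iff)
    then show ?thesis by blast
  qed
  then obtain H where H: "\<And>i. continuous_on UNIV (H i)" "\<And>i z. z \<in> A \<Longrightarrow> H i z = gi (ei z) i"
    by metis
  define d where "d z = infdist z A" for z
  have d0: "d z = 0 \<longleftrightarrow> z \<in> A" for z
    unfolding d_def using in_closed_iff_infdist_zero[OF compact_imp_closed[OF A] ne] by blast
  define \<phi> where "\<phi> a i = (if i < m then H i (e a) else if i = m then d (e a)
      else if i < Suc m + k then d (e a) * e a (i - Suc m) else 0)" for a i
  have dcont: "continuous_on (C N) (\<lambda>a. d (e a))" unfolding d_def by (intro continuous_intros e(1))
  have \<phi>_cont: "continuous_on (C N) \<phi>"
  proof (rule continuous_on_coordinatewise_then_product)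
    fix i
    have 1: "continuous_on (C N) (\<lambda>a. H i (e a))"
      using continuous_on_compose2[OF H(1)[of i] e(1)] by simp
    have 2: "continuous_on (C N) (\<lambda>a. d (e a) * e a (i - Suc m))"
      by (intro continuous_on_mult dcont continuous_on_product_then_coordinatewise[OF e(1)])
    consider "i < m" | "i = m" | "i > m" "i < Suc m + k" | "i > m" "i \<ge> Suc m + k" by linarith
    then show "continuous_on (C N) (\<lambda>a. \<phi> a i)"
      by cases (use 1 2 dcont in \<open>simp_all add: \<phi>_def\<close>)
  qed
  have \<phi>_low: "\<phi> a i = H i (e a)" if "i < m" for a i using that by (simp add: \<phi>_def)
  have \<phi>_m: "\<phi> a m = d (e a)" for a by (simp add: \<phi>_def)
  have \<phi>_high: "\<phi> a (Suc m + j) = d (e a) * e a j" if "j < k" for a j using that by (simp add: \<phi>_def)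
  \<comment> \<open>On \<open>P\<close> the distance \<open>d\<close> vanishes, so
    \<open>\<phi>\<close> is the inverse of \<open>g\<close> there. This is what makes the final
    \<open>g'\<close> agree with \<open>g\<close> on the old cube.\<close>
  have \<phi>P: "\<phi> a = gi a" if a: "a \<in> P" for a
  proof
    fix i
    have eA: "e a \<in> A" using a by (simp add: A_def)
    have d: "d (e a) = 0" using d0 eA by simp
    show "\<phi> a i = gi a i"
    proof (cases "i < m")
      case True
      then show ?thesis using H(2)[OF eA, of i] ei[of a] a PN \<phi>_low[OF True] by auto
    next
      case False
      have "gi a i = 0" using giP(1)[OF a] False by (simp add: cube_def)
      then show ?thesis using False d by (simp add: \<phi>_def)
    qed
  qed
  have \<phi>_inj: "inj_on \<phi> (C N)"
  proof (rule inj_onI)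
    fix a b assume a: "a \<in> C N" and b: "b \<in> C N" and eq: "\<phi> a = \<phi> b"
    have dd: "d (e a) = d (e b)" using fun_cong[OF eq, of m] by (simp only: \<phi>_m)
    show "a = b"
    proof (cases "d (e a) = 0")
      case True
      have inP: "c \<in> P" if "c \<in> C N" "d (e c) = 0" for c
      proof -
        have "e c \<in> A" using that(2) d0 by simp
        then obtain c' where "c' \<in> P" "e c = e c'" by (auto simp: A_def)
        then show ?thesis using e(2) that(1) PN by (metis inj_on_eq_iff subsetD)
      qed
      have aP: "a \<in> P" using inP[OF a True] .
      have bP: "b \<in> P" using inP[OF b] True dd by simp
      have "gi a = gi b" using eq \<phi>P[OF aP] \<phi>P[OF bP] by simp
      then show ?thesis using giP(2)[OF aP] giP(2)[OF bP] by metis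
    next
      case False
      have "e a j = e b j" for j
      proof (cases "j < k")
        case True
        then have "d (e a) * e a j = d (e b) * e b j"
          using fun_cong[OF eq, of "Suc m + j"] by (simp only: \<phi>_high)
        then show ?thesis using dd False by simp
      next
        case False
        have "e a \<in> Rn k" "e b \<in> Rn k" using e(3) a b by blast+
        then show ?thesis using False by simp
      qed
      then have "e a = e b" by (rule ext)
      then show ?thesis using e(2) a b by (simp add: inj_on_eq_iff)
    qed
  qed
  define B where "B = \<phi> ` C N"
  have B: "compact B" unfolding B_def by (rule compact_continuous_image[OF \<phi>_cont compact_C])
  have "B \<subseteq> Rn (Suc m + k)" by (auto simp: B_def \<phi>_def)
  then obtain m0 where m0: "\<And>m. m \<ge> m0 \<Longrightarrow> B \<subseteq> cube m" using compact_subset_cube[OF B] by blast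
  \<comment> \<open>\<open>Suc m\<close> forces the cubes to grow at every step, so that in the end
    they exhaust \<open>R_infinity\<close>.\<close>
  define m' where "m' = max m0 (Suc m)"
  have m': "m < m'" "B \<subseteq> cube m'" using m0[of m'] by (auto simp: m'_def)
  define f where "f = inv_into (C N) \<phi>"
  have f\<phi>: "f (\<phi> a) = a" if "a \<in> C N" for a using \<phi>_inj that by (simp add: f_def)
  have f_cont: "continuous_on B f"
    unfolding B_def using \<phi>_cont compact_C by (rule continuous_on_inv) (use f\<phi> in blast)
  have f_inj: "inj_on f B" unfolding B_def by (rule inj_onI) (auto simp: f\<phi>)
  obtain g' where g': "continuous_on (cube m') g'" "inj_on g' (cube m')"
    "\<And>x. x \<in> B \<Longrightarrow> g' x = f x"
    by (fact extend_embedding_to_cube[OF inf compact_imp_closed[OF B] m'(2) f_cont f_inj])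
  show thesis
  proof (rule that[OF m'(1) g'(1,2)])
    show "g' x = g x" if x: "x \<in> cube m" for x
    proof -
      have gP: "g x \<in> P" using x by (simp add: P_def)
      then have gN: "g x \<in> C N" using PN by blast
      have \<phi>g: "\<phi> (g x) = x" using \<phi>P[OF gP] gi[OF x] by simp
      then have "x \<in> B" using gN by (metis B_def imageI)
      then have "g' x = f (\<phi> (g x))" using g'(3) \<phi>g by simp
      then show ?thesis using f\<phi>[OF gN] by simp
    qed
    show "C n \<subseteq> g' ` cube m'"
    proof
      fix a assume "a \<in> C n"
      then have a: "a \<in> C N" using N by blast
      then have "\<phi> a \<in> B" by (simp add: B_def)
      moreover have "g' (\<phi> a) = a" using g'(3)[OF \<open>\<phi> a \<in> B\<close>] f\<phi>[OF a] by simp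
      ultimately show "a \<in> g' ` cube m'" using m'(2) by (metis image_eqI subsetD)
    qed
  qed
qed

theorem homeomorphic_R_infinity:
  assumes inf: "infinite_dimensional TYPE('a)"
  shows "(euclidean :: 'a topology) homeomorphic_space R_infinity"
proof -
  define P where "P n s \<longleftrightarrow> continuous_on (cube (fst s)) (snd s) \<and> inj_on (snd s) (cube (fst s))"
    for n :: nat and s :: "nat \<times> ((nat \<Rightarrow> real) \<Rightarrow> 'a)"
  define Q where "Q n s s' \<longleftrightarrow> fst s < fst s' \<and> (\<forall>x\<in>cube (fst s). snd s' x = snd s x) \<and>
      C n \<subseteq> snd s' ` cube (fst s')" for n and s s' :: "nat \<times> ((nat \<Rightarrow> real) \<Rightarrow> 'a)"
  have "\<exists>f. \<forall>n. P n (f n) \<and> Q n (f n) (f (Suc n))"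
  proof (rule dependent_nat_choice)
    \<comment> \<open>\<open>cube 0\<close> is a single point, so a constant map starts the
      construction.\<close>
    have "x = (\<lambda>_. 0)" if "x \<in> cube 0" for x using that by (auto simp: cube_def)
    then have "inj_on (\<lambda>_. 0::'a) (cube 0)" by (metis inj_onI)
    then show "\<exists>s. P 0 s" by (intro exI[of _ "(0, \<lambda>_. 0)"]) (simp add: P_def)
  next
    fix s n assume "P n s"
    then have s: "continuous_on (cube (fst s)) (snd s)" "inj_on (snd s) (cube (fst s))"
      by (auto simp: P_def)
    obtain m' g' where
      "fst s < m'" "continuous_on (cube m') g'" "inj_on g' (cube m')"
      "\<And>x. x \<in> cube (fst s) \<Longrightarrow> g' x = snd s x" "C n \<subseteq> g' ` cube m'"
      by (fact back_and_forth_step[OF inf s, of n])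
    then show "\<exists>s'. P (Suc n) s' \<and> Q n s s'"
      by (intro exI[of _ "(m', g')"]) (simp add: P_def Q_def)
  qed
  then obtain f where f: "\<And>n. P n (f n)" "\<And>n. Q n (f n) (f (Suc n))" by blast
  define m where "m n = fst (f n)" for n
  define g where "g n = snd (f n)" for n
  have g: "continuous_on (cube (m n)) (g n)" "inj_on (g n) (cube (m n))" for n
    using f(1)[of n] by (auto simp: P_def m_def g_def)
  have mS: "m n < m (Suc n)" and gS: "\<And>x. x \<in> cube (m n) \<Longrightarrow> g (Suc n) x = g n x"
    and CS: "C n \<subseteq> g (Suc n) ` cube (m (Suc n))" for n
    using f(2)[of n] by (auto simp: Q_def m_def g_def)
  have "strict_mono m" using mS by (rule strict_mono_Suc_iff[THEN iffD2, rule_format])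
  then have mm: "m i \<le> m j" if "i \<le> j" for i j using that by (simp add: strict_mono_less_eq)
  have m_ge: "n \<le> m n" for n by (rule strict_mono_imp_increasing) fact
  have gg: "g (n + k) x = g n x" if "x \<in> cube (m n)" for n k x
  proof (induction k)
    case (Suc k)
    have "x \<in> cube (m (n + k))" using that cube_mono[OF mm[of n "n + k"]] by auto
    then show ?case using gS[of x "n + k"] Suc by simp
  qed simp
  define h where "h x = g (LEAST n. x \<in> cube (m n)) x" for x
  have h: "h x = g n x" if "x \<in> cube (m n)" for x n
  proof -
    let ?l = "LEAST n. x \<in> cube (m n)"
    have "x \<in> cube (m ?l)" using that by (rule LeastI)
    moreover have "?l \<le> n" using that by (rule Least_le)
    ultimately show ?thesis using gg[of x ?l "n - ?l"] by (simp add: h_def)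
  qed
  have "homeomorphic_map R_infinity euclidean h"
  proof (rule homeomorphic_map_R_infinityI)
    fix n
    have "continuous_on (cube (m n)) h"
      using g(1)[of n] by (rule continuous_on_eq) (simp add: h)
    then show "continuous_on (cube n) h" using cube_mono[OF m_ge] by (rule continuous_on_subset)
    have "h ` cube (m (Suc n)) = g (Suc n) ` cube (m (Suc n))"
      by (rule image_cong) (simp_all add: h)
    then show "\<exists>k. C n \<subseteq> h ` cube k" using CS[of n] by (intro exI[of _ "m (Suc n)"]) simp
  next
    show "inj_on h (topspace R_infinity)"
    proof (rule inj_onI)
      fix x y assume x: "x \<in> topspace R_infinity" and y: "y \<in> topspace R_infinity" and eq: "h x = h y"
      obtain i where i: "x \<in> cube i" using x Rn_subset_cubes unfolding topspace_R_infinity_Rn by blast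
      obtain j where j: "y \<in> cube j" using y Rn_subset_cubes unfolding topspace_R_infinity_Rn by blast
      have "i \<le> m (max i j)" "j \<le> m (max i j)" using m_ge[of "max i j"] by simp_all
      then have xy: "x \<in> cube (m (max i j))" "y \<in> cube (m (max i j))"
        using i j cube_mono by blast+
      then have "g (max i j) x = g (max i j) y" using eq h by simp
      then show "x = y" using inj_onD[OF g(2)[of "max i j"]] xy by blast
    qed
  qed
  then have "R_infinity homeomorphic_space (euclidean :: 'a topology)"
    by (rule homeomorphic_map_imp_homeomorphic_space)
  then show ?thesis using homeomorphic_space_sym by blast
qed

end

section \<open>The locally convex case\<close>

text \<open>Each single vector is absorbed, and compactness makes the exponent uniform. The choice
  of \<open>W\<close> lets an exponent \<open>n\<close> of the finite subcover be replaced by any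
  larger \<open>i\<close>.\<close>

lemma compact_absorbed:
  fixes K V :: "'a::linear_topological_space set"
  assumes K: "compact K" and V: "open V" "0 \<in> V"
  obtains J where "\<And>i x. J \<le> i \<Longrightarrow> x \<in> K \<Longrightarrow> ((1/2)^i) *\<^sub>R x \<in> V"
proof -
  obtain W where W: "open W" "0 \<in> W" "\<And>t x. \<bar>t\<bar> \<le> 1 \<Longrightarrow> x \<in> W \<Longrightarrow> t *\<^sub>R x \<in> V"
    by (fact zero_nbhd_scale[OF V])
  define U where "U n = (\<lambda>x. ((1/2)^n) *\<^sub>R x) -` W" for n :: nat
  have "open (U n)" for n
    unfolding U_def
    by (intro open_vimage W(1) continuous_on_scaleR_lts continuous_on_const continuous_on_id)
  moreover have "K \<subseteq> (\<Union>n. U n)"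
  proof
    fix x :: 'a
    have "(\<lambda>n. ((1/2::real)^n) *\<^sub>R x) \<longlonglongrightarrow> 0 *\<^sub>R x"
      by (intro tendsto_scaleR_lts tendsto_const) (simp add: LIMSEQ_realpow_zero)
    then have "\<forall>\<^sub>F n in sequentially. ((1/2::real)^n) *\<^sub>R x \<in> W"
      using W(1,2) topological_tendstoD by fastforce
    then show "x \<in> (\<Union>n. U n)" by (auto simp: U_def eventually_sequentially)
  qed
  ultimately obtain I where I: "finite I" "K \<subseteq> (\<Union>n\<in>I. U n)"
    using compactE_image[OF K, of UNIV U] by metis
  show thesis
  proof (rule that[of "Max I"])
    fix i x assume i: "Max I \<le> i" and "x \<in> K"
    then obtain n where n: "n \<in> I" "x \<in> U n" using I(2) by blast
    then have "n \<le> i" using i Max_ge[OF I(1) n(1)] by simp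
    have "((1/2::real)^(i - n)) *\<^sub>R (((1/2)^n) *\<^sub>R x) \<in> V"
      using n(2) by (intro W(3)) (auto simp: U_def power_le_one)
    then show "((1/2)^i) *\<^sub>R x \<in> V"
      using \<open>n \<le> i\<close> by (simp add: power_add[symmetric])
  qed
qed

context compacta_limit
begin

text \<open>If \<^term>\<open>x i\<close> are independent points of a compact set, then \<^term>\<open>(1/2)^i *\<^sub>R x i\<close> tends
  to \<open>0\<close>, and by local convexity the convex hull of a tail of this sequence and \<open>0\<close> lies in some
  \<^term>\<open>C n\<close>. But that hull contains cubes of all dimensions.\<close>

lemma compact_spans_finite_dimensional:
  assumes lc: "locally_convex TYPE('a)" and K: "compact (K :: 'a set)"
  obtains B where "finite B" "K \<subseteq> span B"
proof (rule ccontr)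
  assume *: "\<not> thesis"
  obtain B where B: "B \<subseteq> K" "independent B" "K \<subseteq> span B" by (rule maximal_independent_subset)
  then have "infinite B" using * that by blast
  then obtain x :: "nat \<Rightarrow> 'a" where x: "inj x" "range x \<subseteq> B" using infinite_countable_subset by blast
  have ind: "independent (range x)" using B(2) x(2) by (rule independent_mono)
  have xK: "x i \<in> K" for i using x(2) B(1) by blast
  \<comment> \<open>\<open>T j\<close> is the convex hull of 0 and the points (1/2)^i x i with
    \<open>i\<close> at least \<open>j\<close>: relative to these points the coefficients are y i *
    2^(i+j), nonnegative and with sum at most 1.\<close>
  define T where "T j = {lincomb (\<lambda>i. x (i + j)) M y | M y.
    (\<forall>i<M. 0 \<le> y i) \<and> (\<Sum>i<M. y i * 2^(i + j)) \<le> 1}" for j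
  have "\<exists>j N. T j \<subseteq> C N"
  proof (rule ccontr)
    assume "\<nexists>j N. T j \<subseteq> C N"
    then have "\<forall>j. \<exists>p. p \<in> T j \<and> p \<notin> C j" by blast
    then obtain p where p: "\<And>j. p j \<in> T j" "\<And>j. p j \<notin> C j" by metis
    \<comment> \<open>The nonzero \<open>p j\<close> form a closed set, so \<open>U\<close> is a
      neighbourhood of 0. Convexity puts all late \<open>p j\<close> into \<open>U\<close>, which
      makes them 0; but 0 belongs to some \<open>C k\<close>.\<close>
    define U where "U = - p ` {j. p j \<noteq> 0}"
    have "open U" unfolding U_def by (intro open_Compl closed_if_eventually_outside p(2))
    moreover have "0 \<in> U" by (auto simp: U_def)
    ultimately obtain V where V: "open V" "convex V" "0 \<in> V" "V \<subseteq> U"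
      using lc unfolding locally_convex_def by blast
    obtain J where J: "\<And>i x. J \<le> i \<Longrightarrow> x \<in> K \<Longrightarrow> ((1/2)^i) *\<^sub>R x \<in> V"
      by (fact compact_absorbed[OF K V(1,3)])
    have "p j = 0" if "j \<ge> J" for j
    proof -
      obtain M y where y: "p j = lincomb (\<lambda>i. x (i + j)) M y" "\<And>i. i < M \<Longrightarrow> 0 \<le> y i"
        "(\<Sum>i<M. y i * 2^(i + j)) \<le> 1" using p(1)[of j] unfolding T_def by blast
      \<comment> \<open>The extra index \<open>M\<close> gives the missing weight to the vector 0,
        so that the combination is convex.\<close>
      define a where "a i = (if i < M then y i * 2^(i + j) else 1 - (\<Sum>i<M. y i * 2^(i + j)))" for i
      define w where "w i = (if i < M then ((1/2::real)^(i + j)) *\<^sub>R x (i + j) else 0)" for i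
      have "(\<Sum>i\<in>{..<Suc M}. a i *\<^sub>R w i) \<in> V"
      proof (rule convex_sum)
        show "sum a {..<Suc M} = 1" by (simp add: a_def)
        show "0 \<le> a i" if "i \<in> {..<Suc M}" for i using y(2,3) by (simp add: a_def)
        show "w i \<in> V" if "i \<in> {..<Suc M}" for i
          unfolding w_def using J[of "i + j" "x (i + j)"] xK \<open>j \<ge> J\<close> V(3) by auto
      qed (use V in auto)
      also have "(\<Sum>i\<in>{..<Suc M}. a i *\<^sub>R w i) = (\<Sum>i<M. y i *\<^sub>R x (i + j))"
        by (simp add: a_def w_def power_one_over)
      finally have "p j \<in> U" using V(4) y(1) by (auto simp: lincomb_def)
      then show "p j = 0" by (auto simp: U_def)
    qed
    moreover obtain k where "0 \<in> C k" using C_cover by blast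
    ultimately have "p (max J k) \<in> C (max J k)" using C_mono[of k "max J k"] by auto
    then show False using p(2) by blast
  qed
  then obtain j N where jN: "T j \<subseteq> C N" by blast
  define v where "v i = x (i + j)" for i
  have v: "inj v" by (intro injI) (simp add: v_def inj_eq[OF x(1)])
  have vi: "independent (range v)" by (rule independent_mono[OF ind]) (auto simp: v_def)
  obtain k where k: "\<And>M a b s. k < M \<Longrightarrow> (\<And>i. i < M \<Longrightarrow> a i < b i) \<Longrightarrow> s \<noteq> 0 \<Longrightarrow>
    \<not> (\<lambda>x. s *\<^sub>R lincomb v M x) ` {x \<in> Rn M. \<forall>i<M. a i \<le> x i \<and> x i \<le> b i} \<subseteq> C N"
    by (fact boxes_in_compact_bounded_dimension[OF compact_C v vi])
  define M where "M = Suc k"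
  \<comment> \<open>The sides are chosen so that the weights of the corner \<open>b\<close> add up
    to 1, which places the whole box in \<open>T j\<close>.\<close>
  define b where "b i = (1/2::real)^(i + j) / real M" for i
  have "(\<lambda>x. 1 *\<^sub>R lincomb v M x) ` {x \<in> Rn M. \<forall>i<M. 0 \<le> x i \<and> x i \<le> b i} \<subseteq> C N"
  proof
    fix z assume "z \<in> (\<lambda>x. 1 *\<^sub>R lincomb v M x) ` {x \<in> Rn M. \<forall>i<M. 0 \<le> x i \<and> x i \<le> b i}"
    then obtain y where y: "z = lincomb v M y" "\<And>i. i < M \<Longrightarrow> 0 \<le> y i \<and> y i \<le> b i" by auto
    have "(\<Sum>i<M. y i * 2^(i + j)) \<le> (\<Sum>i<M. b i * 2^(i + j))"
      using y(2) by (intro sum_mono mult_right_mono) auto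
    also have "\<dots> = (\<Sum>i<M. 1 / real M)" by (simp add: b_def power_one_over)
    also have "\<dots> = 1" by (simp add: M_def)
    finally have "z \<in> T j" using y unfolding T_def v_def by blast
    then show "z \<in> C N" using jN by blast
  qed
  then show False using k[of M "\<lambda>_. 0" b 1] by (simp add: M_def b_def)
qed

section \<open>Countable bases and bounded coordinates\<close>

lemma countable_infinite_basis:
  assumes inf: "infinite_dimensional TYPE('a)" and lc: "locally_convex TYPE('a)"
  obtains v :: "nat \<Rightarrow> 'a" where "inj v" "independent (range v)" "span (range v) = UNIV"
proof -
  obtain B :: "'a set" where B: "independent B" "UNIV \<subseteq> span B"
    by (rule maximal_independent_subset[of "UNIV :: 'a set"])
  then have "infinite B" using inf by (auto simp: infinite_dimensional_def)
  have "finite (B \<inter> C n)" for n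
  proof -
    obtain F where F: "finite F" "C n \<subseteq> span F"
      by (rule compact_spans_finite_dimensional[OF lc compact_C])
    have "independent (B \<inter> C n)" using B(1) by (rule independent_mono) simp
    then show ?thesis using independent_span_bound[OF F(1), of "B \<inter> C n"] F(2) by blast
  qed
  then have "countable (B \<inter> C n)" for n by (rule countable_finite)
  then have "countable (\<Union>n. B \<inter> C n)" by (intro countable_UN) simp_all
  moreover have "(\<Union>n. B \<inter> C n) = B" using C_cover by blast
  ultimately have "countable B" by simp
  then obtain v :: "nat \<Rightarrow> 'a" where v: "bij_betw v UNIV B"
    using \<open>infinite B\<close> bij_betw_from_nat_into by blast
  then have "range v = B" "inj v" by (auto simp: bij_betw_def)
  then show thesis using that[of v] B by auto
qed

text \<open>The image of the unit sphere \<open>S\<close> of the sup norm is compact and omits 0, so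
  \<open>V\<close> and its multiples by factors of modulus at most 1 avoid it. A vector of
  \<open>K\<close> with a coordinate above 2^J, rescaled to the sphere, would be such a multiple of
  a vector of \<open>V\<close>.\<close>

lemma compact_in_bounded_combinations:
  assumes v: "inj (v :: nat \<Rightarrow> 'a)" "independent (range v)" and K: "compact K"
    and sub: "K \<subseteq> lincomb v k ` Rn k"
  shows "\<exists>m\<ge>k. K \<subseteq> lincomb v k ` (cube m \<inter> Rn k)"
proof -
  define S where "S = {x \<in> Rn k. \<forall>i<k. \<bar>x i\<bar> \<le> 1} \<inter> (\<Union>j<k. {x. \<bar>x j\<bar> = 1})"
  have "{x \<in> Rn k. \<forall>i<k. \<bar>x i\<bar> \<le> 1} = {x. \<forall>i. (if i < k then -1 else 0) \<le> x i \<and> x i \<le> (if i < k then 1 else 0)}"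
    by (auto simp: not_less order_antisym abs_le_iff)
  then have "compact {x \<in> Rn k. \<forall>i<k. \<bar>x i\<bar> \<le> (1::real)}" by (simp only: compact_box)
  moreover have "closed (\<Union>j<k. {x::nat \<Rightarrow> real. \<bar>x j\<bar> = 1})"
    by (intro closed_UN finite_lessThan ballI closed_Collect_eq continuous_on_const continuous_on_rabs
        continuous_on_product_coordinates)
  ultimately have S: "compact S" unfolding S_def by (rule compact_Int_closed)
  have "compact (lincomb v k ` S)" by (rule compact_continuous_image[OF continuous_on_lincomb S])
  then have "open (- lincomb v k ` S)" using compact_imp_closed_lts by blast
  moreover have "0 \<notin> lincomb v k ` S"
  proof
    assume "0 \<in> lincomb v k ` S"
    then obtain x where x: "x \<in> S" "lincomb v k x = 0" by auto
    then have "x i = 0" if "i < k" for i using lincomb_eq_0D[OF v] that by blast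
    then show False using x(1) by (auto simp: S_def)
  qed
  ultimately obtain V where V: "open V" "0 \<in> V"
    "\<And>t x. \<bar>t\<bar> \<le> 1 \<Longrightarrow> x \<in> V \<Longrightarrow> t *\<^sub>R x \<in> - lincomb v k ` S"
    using zero_nbhd_scale[of "- lincomb v k ` S"] by (metis ComplI)
  obtain J where J: "\<And>i x. J \<le> i \<Longrightarrow> x \<in> K \<Longrightarrow> ((1/2)^i) *\<^sub>R x \<in> V"
    by (fact compact_absorbed[OF K V(1,2)])
  define m where "m = max k (2^J)"
  have "a \<in> lincomb v k ` (cube m \<inter> Rn k)" if a: "a \<in> K" for a
  proof -
    obtain x where x: "a = lincomb v k x" "x \<in> Rn k" using a sub by blast
    have "\<bar>x i\<bar> \<le> 2^J" for i
    proof (rule ccontr)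
      assume *: "\<not> \<bar>x i\<bar> \<le> 2^J"
      then have "i < k" using x(2) by (cases "i < k") auto
      define r where "r = Max ((\<lambda>i. \<bar>x i\<bar>) ` {..<k})"
      have r: "\<bar>x l\<bar> \<le> r" if "l < k" for l unfolding r_def using that by (intro Max_ge) auto
      have "r \<in> (\<lambda>i. \<bar>x i\<bar>) ` {..<k}" unfolding r_def using \<open>i < k\<close> by (intro Max_in) auto
      then obtain l where l: "l < k" "r = \<bar>x l\<bar>" by blast
      have rJ: "2^J < r" using r[OF \<open>i < k\<close>] * by linarith
      then have r0: "r > 0" by (meson less_trans zero_less_numeral zero_less_power)
      define y where "y i = x i / r" for i
      have "\<bar>y i\<bar> \<le> 1" if "i < k" for i using r[OF that] r0 by (simp add: y_def abs_divide)
      moreover have "\<bar>y l\<bar> = 1" using l(2) r0 by (simp add: y_def abs_divide)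
      ultimately have "y \<in> S" using x(2) l(1) unfolding S_def by (auto simp: y_def)
      have "lincomb v k y = (1 / r) *\<^sub>R a"
        by (simp add: x(1) lincomb_def y_def scaleR_sum_right)
      also have "\<dots> = (2^J / r) *\<^sub>R ((1/2)^J *\<^sub>R a)" by (simp add: power_one_over)
      finally have "lincomb v k y \<in> - lincomb v k ` S"
        using V(3)[of "2^J / r" "(1/2)^J *\<^sub>R a"] J[OF order_refl a] rJ r0 by simp
      then show False using \<open>y \<in> S\<close> by blast
    qed
    moreover have "real (2^J) \<le> real m" unfolding m_def by (intro of_nat_mono) simp
    ultimately have "\<bar>x i\<bar> \<le> real m" for i by (metis of_nat_numeral of_nat_power order_trans)
    then have "x \<in> cube m" using x(2) by (auto simp: cube_def m_def)
    then show ?thesis using x by blast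
  qed
  then show ?thesis by (intro exI[of _ m]) (auto simp: m_def)
qed

theorem locally_convex_linear_homeomorphism:
  assumes inf: "infinite_dimensional TYPE('a)" and lc: "locally_convex TYPE('a)"
  shows "\<exists>f :: 'a \<Rightarrow> nat \<Rightarrow> real. linear_homeomorphism_R_infinity f"
proof -
  obtain v :: "nat \<Rightarrow> 'a" where v: "inj v" "independent (range v)" "span (range v) = UNIV"
    by (rule countable_infinite_basis[OF inf lc])
  define f where "f a i = representation (range v) a (v i)" for a i
  have f_add: "f (a + b) = (\<lambda>i. f a i + f b i)" for a b
    by (rule ext) (simp add: f_def representation_add[OF v(2)] v(3))
  have f_scale: "f (c *\<^sub>R a) = (\<lambda>i. c * f a i)" for c a
    by (rule ext) (simp add: f_def representation_scale[OF v(2)] v(3))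
  \<comment> \<open>The inverse of the coordinate map on finitely supported sequences. The
    homeomorphism is established for \<open>h\<close>, because the criterion
    \<open>homeomorphic_map_R_infinityI\<close> concerns maps out of
    \<open>R_infinity\<close>.\<close>
  define h where "h x = (\<Sum>i | x i \<noteq> 0. x i *\<^sub>R v i)" for x :: "nat \<Rightarrow> real"
  have h: "h x = lincomb v m x" if "x \<in> Rn m" for x m
    unfolding h_def lincomb_def
    using that by (intro sum.mono_neutral_left) (auto simp: not_less[symmetric])
  have T: "topspace R_infinity = {x. finite {i. x i \<noteq> 0}}" by (rule topspace_R_infinity)
  have fT: "f a \<in> topspace R_infinity" for a
  proof -
    have "finite {b. representation (range v) a b \<noteq> 0}" by (rule finite_representation)
    then have "finite (v -` {b. representation (range v) a b \<noteq> 0})" using v(1) by (rule finite_vimageI)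
    then show ?thesis unfolding T by (simp add: f_def vimage_def)
  qed
  have hf: "h (f a) = a" for a
  proof -
    have eq: "{b. representation (range v) a b \<noteq> 0} = v ` {i. f a i \<noteq> 0}"
      using representation_ne_zero[of "range v" a] by (auto simp: f_def)
    have "a = (\<Sum>b | representation (range v) a b \<noteq> 0. representation (range v) a b *\<^sub>R b)"
      using sum_nonzero_representation_eq[OF v(2), of a] v(3) by simp
    also have "\<dots> = h (f a)"
      unfolding eq h_def using v(1) by (subst sum.reindex) (auto simp: f_def inj_on_def)
    finally show ?thesis by simp
  qed
  have h_inj: "inj_on h (topspace R_infinity)"
  proof (rule inj_onI)
    fix x y assume "x \<in> topspace R_infinity" "y \<in> topspace R_infinity" and eq: "h x = h y"
    then obtain i j where ij: "x \<in> Rn i" "y \<in> Rn j" unfolding topspace_R_infinity_Rn by blast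
    have xy: "x \<in> Rn (max i j)" "y \<in> Rn (max i j)" using ij by auto
    then have "lincomb v (max i j) x = lincomb v (max i j) y" using eq h[OF xy(1)] h[OF xy(2)] by simp
    then show "x = y" using inj_onD[OF inj_on_lincomb[OF v(1,2)]] xy by blast
  qed
  have "homeomorphic_map R_infinity euclidean h"
  proof (rule homeomorphic_map_R_infinityI[OF h_inj])
    fix m
    have "cube m \<subseteq> Rn m" by (auto simp: cube_def)
    then show "continuous_on (cube m) h"
      using h by (intro continuous_on_eq[OF continuous_on_lincomb[of _ v m]]) force
  next
    fix n
    obtain F where F: "finite F" "C n \<subseteq> span F"
      by (rule compact_spans_finite_dimensional[OF lc compact_C])
    have "\<forall>a\<in>F. \<exists>k. f a \<in> Rn k" using fT unfolding topspace_R_infinity_Rn by blast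
    then obtain k where k: "\<And>a. a \<in> F \<Longrightarrow> f a \<in> Rn (k a)" by metis
    define m where "m = Max (insert 0 (k ` F))"
    have "k a \<le> m" if "a \<in> F" for a unfolding m_def using F(1) that by (intro Max_ge) auto
    then have Fm: "F \<subseteq> {a. f a \<in> Rn m}" using k by (blast intro: order_trans)
    have "subspace {a. f a \<in> Rn m}"
    proof (rule subspaceI)
      have "f 0 = (\<lambda>_. 0)" using f_scale[of 0 0] by simp
      then show "0 \<in> {a. f a \<in> Rn m}" by simp
    qed (auto simp: f_add f_scale)
    then have "C n \<subseteq> {a. f a \<in> Rn m}" using F(2) span_minimal[OF Fm] by blast
    then have fm: "f a \<in> Rn m" if "a \<in> C n" for a using that by blast
    have "C n \<subseteq> lincomb v m ` Rn m"
    proof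
      fix a assume "a \<in> C n"
      then have fa: "f a \<in> Rn m" by (rule fm)
      show "a \<in> lincomb v m ` Rn m"
        by (rule image_eqI[OF _ fa]) (use hf[of a] h[OF fa] in simp)
    qed
    from compact_in_bounded_combinations[OF v(1,2) compact_C this] obtain l where
      l: "C n \<subseteq> lincomb v m ` (cube l \<inter> Rn m)" by blast
    have "lincomb v m ` (cube l \<inter> Rn m) = h ` (cube l \<inter> Rn m)" using h by (intro image_cong) auto
    then show "\<exists>l. C n \<subseteq> h ` cube l" using l by blast
  qed
  then obtain g where g: "homeomorphic_maps R_infinity euclidean h g"
    unfolding homeomorphic_map_maps by blast
  have "g a = f a" for a
  proof -
    have "g a \<in> topspace R_infinity" "h (g a) = a"
      using g by (auto simp: homeomorphic_maps_def continuous_map_def)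
    then show ?thesis using inj_onD[OF h_inj] fT[of a] hf[of a] by simp
  qed
  then have "homeomorphic_maps R_infinity euclidean h f"
    using homeomorphic_maps_eq[OF g] by blast
  then have "homeomorphic_map euclidean R_infinity f"
    using homeomorphic_maps_map homeomorphic_maps_sym by blast
  then show ?thesis unfolding linear_homeomorphism_R_infinity_def using f_add f_scale by blast
qed

end

section \<open>Finite-dimensional metrizable compacta embed into Euclidean spaces\<close>

text \<open>The coordinates are the distances to the points of a countable dense set. Distinct
  \<open>p\<close> and \<open>q\<close> are told apart by a point of this set that is nearer to
  \<open>p\<close> than half their distance.\<close>

lemma compact_metrizable_embeds_into_sequences:
  assumes X: "compact_space X" "metrizable_space X"
  obtains \<phi> :: "'b \<Rightarrow> nat \<Rightarrow> real" where "continuous_map X euclidean \<phi>" "inj_on \<phi> (topspace X)"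
proof (cases "topspace X = {}")
  case True
  then show thesis using that[of "\<lambda>_ _. 0"] by simp
next
  case False
  obtain M d where Md: "Metric_space M d" "X = Metric_space.mtopology M d"
    using X(2) unfolding metrizable_space_def by blast
  interpret Metric_space M d by (rule Md(1))
  have XM: "topspace X = M" by (simp add: Md(2))
  have "\<exists>F. finite F \<and> F \<subseteq> M \<and> M \<subseteq> (\<Union>x\<in>F. mball x (1 / real (Suc n)))" for n
  proof -
    let ?U = "(\<lambda>x. mball x (1 / real (Suc n))) ` M"
    have "\<forall>u\<in>?U. openin X u" by (auto simp: Md(2))
    moreover have "topspace X \<subseteq> \<Union>?U"
    proof
      fix p assume "p \<in> topspace X"
      then show "p \<in> \<Union>?U" using XM by (intro UN_I[of p]) simp_all
    qed
    ultimately obtain \<F> where "finite \<F>" "\<F> \<subseteq> ?U" "topspace X \<subseteq> \<Union>\<F>"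
      using X(1) unfolding compact_space_def compactin_def by meson
    then show ?thesis using finite_subset_image[of \<F> "\<lambda>x. mball x (1 / real (Suc n))" M] XM by metis
  qed
  then obtain F where F: "\<And>n. finite (F n)" "\<And>n. F n \<subseteq> M" "\<And>n. M \<subseteq> (\<Union>x\<in>F n. mball x (1 / real (Suc n)))"
    by metis
  define A where "A = (\<Union>n. F n)"
  have "countable (F n)" for n using F(1) by (rule countable_finite)
  then have "countable A" unfolding A_def by (intro countable_UN) simp_all
  moreover have "A \<noteq> {}" using False F(3)[of 0] XM by (auto simp: A_def)
  ultimately have x: "range (from_nat_into A) = A" by (simp add: range_from_nat_into)
  define \<phi> where "\<phi> p i = d (from_nat_into A i) p" for p and i :: nat
  have AM: "from_nat_into A i \<in> M" for i
    using x F(2) unfolding A_def by blast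
  show thesis
  proof (rule that[of \<phi>])
    define m where "m = metric (M, d)"
    have m: "mtopology_of m = X" "mspace m = M" "mdist m = d"
      by (simp_all add: m_def Md(2) mtopology_of_def)
    have "continuous_map X euclidean (\<lambda>p. \<phi> p i)" for i
    proof -
      have "continuous_map X euclidean (\<lambda>p. mdist m (from_nat_into A i) p)"
        using AM XM by (intro continuous_map_mdist) (auto simp: m)
      then show ?thesis by (simp add: \<phi>_def m)
    qed
    then have "continuous_map X (product_topology (\<lambda>i. euclidean) UNIV) \<phi>"
      by (intro continuous_map_coordinatewise_then_product) auto
    then show "continuous_map X euclidean \<phi>" by (simp add: euclidean_product_topology)
    show "inj_on \<phi> (topspace X)"
    proof (rule inj_onI, rule ccontr)
      fix p q assume p: "p \<in> topspace X" and q: "q \<in> topspace X" and eq: "\<phi> p = \<phi> q" and "p \<noteq> q"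
      then have "d p q > 0" using XM by (metis mdist_pos_less)
      then obtain n where n: "1 / real (Suc n) < d p q / 2"
        using reals_Archimedean[of "d p q / 2"] by (auto simp: inverse_eq_divide)
      obtain y where y: "y \<in> F n" "p \<in> mball y (1 / real (Suc n))" using F(3)[of n] p XM by blast
      then have "y \<in> A" by (auto simp: A_def)
      then obtain i where i: "y = from_nat_into A i" using x by (metis imageE)
      have "d y p = d y q" using fun_cong[OF eq, of i] by (simp add: \<phi>_def i)
      moreover have "d y p < d p q / 2" using y(2) n by simp
      moreover have "d p q \<le> d y p + d y q" using triangle[of p y q] y F(2) p q XM commute by auto
      ultimately show False by linarith
    qed
  qed
qed

lemma fine_covers_image:
  fixes \<phi> :: "'b \<Rightarrow> 'c::metric_space"
  assumes X: "compact_space X" "covering_dim_le X n"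
    and \<phi>: "continuous_map X euclidean \<phi>" "inj_on \<phi> (topspace X)"
  shows "fine_covers (\<phi> ` topspace X) (Suc n)"
  unfolding fine_covers_def
proof (intro allI impI)
  fix e :: real assume e: "e > 0"
  let ?K = "\<phi> ` topspace X"
  have "compactin euclidean ?K"
    using X(1) \<phi>(1) unfolding compact_space_def by (rule image_compactin)
  then have K: "compact ?K" by simp
  then obtain T where T: "finite T" "?K \<subseteq> (\<Union>c\<in>T. ball c (e/2))"
    using compactE_image[of ?K ?K "\<lambda>c. ball c (e/2)"] e by (metis UN_I centre_in_ball half_gt_zero open_ball subsetI)
  define U where "U c = {p \<in> topspace X. \<phi> p \<in> ball c (e/2)}" for c
  have Uo: "openin X (U c)" for c
    unfolding U_def using \<phi>(1) by (rule openin_continuous_map_preimage) simp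
  have "\<Union>(U ` T) = topspace X"
  proof (intro equalityI subsetI)
    fix p assume "p \<in> topspace X"
    moreover from this obtain c where "c \<in> T" "\<phi> p \<in> ball c (e/2)" using T(2) by blast
    ultimately show "p \<in> \<Union>(U ` T)" by (auto simp: U_def)
  qed (auto simp: U_def)
  then have "finite (U ` T) \<and> (\<forall>u\<in>U ` T. openin X u) \<and> \<Union>(U ` T) = topspace X"
    using T(1) Uo by auto
  then obtain \<V> where V: "finite \<V>" "\<forall>V\<in>\<V>. openin X V" "\<Union>\<V> = topspace X"
    "\<forall>V\<in>\<V>. \<exists>u\<in>U ` T. V \<subseteq> u" "\<forall>x\<in>topspace X. card {V \<in> \<V>. x \<in> V} \<le> Suc n"
    using X(2)[unfolded covering_dim_le_def, rule_format, of "U ` T"] by auto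
  \<comment> \<open>\<open>W V\<close> meets the image of \<open>X\<close> exactly in the image of
    \<open>V\<close>, and it is open in the whole space because the complement of \<open>V\<close>
    is compact.\<close>
  define W where "W V = - \<phi> ` (topspace X - V)" for V
  have mem: "\<phi> p \<in> W V \<longleftrightarrow> p \<in> V" if "p \<in> topspace X" for p V
    using that \<phi>(2) by (auto simp: W_def inj_on_def)
  have Wo: "open (W V)" if "V \<in> \<V>" for V
  proof -
    have "closedin X (topspace X - V)" using V(2) that by (simp add: openin_closedin_eq closedin_diff)
    then have "compactin X (topspace X - V)" by (rule closedin_compact_space[OF X(1)])
    from image_compactin[OF this \<phi>(1)] have "compact (\<phi> ` (topspace X - V))" by simp
    then show ?thesis unfolding W_def by (intro open_Compl compact_imp_closed)
  qed
  show "\<exists>\<C>. finite \<C> \<and> (\<forall>U\<in>\<C>. open U \<and> (\<forall>x\<in>U \<inter> ?K. \<forall>y\<in>U \<inter> ?K. dist x y < e)) \<and> ?K \<subseteq> \<Union>\<C> \<and>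
     (\<forall>x\<in>?K. card {U\<in>\<C>. x \<in> U} \<le> Suc n)"
  proof (intro exI[of _ "W ` \<V>"] conjI ballI)
    show "finite (W ` \<V>)" using V(1) by simp
    show "open u" if "u \<in> W ` \<V>" for u using that Wo by blast
    show "?K \<subseteq> \<Union>(W ` \<V>)"
    proof
      fix z assume "z \<in> ?K"
      then obtain p where p: "p \<in> topspace X" "z = \<phi> p" by blast
      then obtain V where "V \<in> \<V>" "p \<in> V" using V(3) by blast
      then show "z \<in> \<Union>(W ` \<V>)" using mem[OF p(1)] p(2) by blast
    qed
  next
    fix u x y assume u: "u \<in> W ` \<V>" and x: "x \<in> u \<inter> ?K" and y: "y \<in> u \<inter> ?K"
    then obtain V where V': "V \<in> \<V>" "u = W V" by blast
    obtain p where p: "p \<in> topspace X" "x = \<phi> p" using x by blast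
    obtain q where q: "q \<in> topspace X" "y = \<phi> q" using y by blast
    have "p \<in> V" "q \<in> V" using mem p q x y V'(2) by auto
    moreover obtain c where "V \<subseteq> U c" using V(4) V'(1) by blast
    ultimately have "x \<in> ball c (e/2)" "y \<in> ball c (e/2)" using p q by (auto simp: U_def)
    then show "dist x y < e" using dist_triangle_half_r[of c x e y] by simp
  next
    fix x assume "x \<in> ?K"
    then obtain p where p: "p \<in> topspace X" "x = \<phi> p" by blast
    have "{u \<in> W ` \<V>. x \<in> u} \<subseteq> W ` {V \<in> \<V>. p \<in> V}" using mem p by auto
    then have "card {u \<in> W ` \<V>. x \<in> u} \<le> card (W ` {V \<in> \<V>. p \<in> V})"
      using V(1) by (intro card_mono) simp_all
    also have "\<dots> \<le> card {V \<in> \<V>. p \<in> V}" using V(1) by (intro card_image_le) simp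
    also have "\<dots> \<le> Suc n" using V(5) p(1) by blast
    finally show "card {u \<in> W ` \<V>. x \<in> u} \<le> Suc n" .
  qed
qed

theorem finite_dimensional_compactum_embeds_into_Rn:
  assumes X: "compact_space X" "metrizable_space X" "finite_covering_dim X"
  obtains e :: "'b \<Rightarrow> nat \<Rightarrow> real" and k where
    "continuous_map X euclidean e" "inj_on e (topspace X)" "e ` topspace X \<subseteq> Rn k"
proof -
  obtain n where n: "covering_dim_le X n" using X(3) by (auto simp: finite_covering_dim_def)
  obtain \<phi> :: "'b \<Rightarrow> nat \<Rightarrow> real" where \<phi>: "continuous_map X euclidean \<phi>" "inj_on \<phi> (topspace X)"
    by (rule compact_metrizable_embeds_into_sequences[OF X(1,2)])
  let ?K = "\<phi> ` topspace X"
  have "compactin euclidean ?K"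
    using X(1) \<phi>(1) unfolding compact_space_def by (rule image_compactin)
  then have "compact ?K" by simp
  then obtain j where j: "continuous_on ?K j" "inj_on j ?K" "j ` ?K \<subseteq> Rn (2 * Suc n)"
    by (rule fine_covers_imp_embedding[OF _ fine_covers_image[OF X(1) n \<phi>]])
  show thesis
  proof (rule that[of "j \<circ> \<phi>" "2 * Suc n"])
    show "continuous_map X euclidean (j \<circ> \<phi>)"
    proof (rule continuous_map_compose)
      show "continuous_map X (top_of_set ?K) \<phi>" using \<phi>(1) by (simp add: continuous_map_in_subtopology)
      show "continuous_map (top_of_set ?K) euclidean j" using j(1) by simp
    qed
    show "inj_on (j \<circ> \<phi>) (topspace X)" using \<phi>(2) j(2) by (rule comp_inj_on)
    show "(j \<circ> \<phi>) ` topspace X \<subseteq> Rn (2 * Suc n)" using j(3) by (simp only: image_comp[symmetric])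
  qed
qed

section \<open>The classification\<close>

text \<open>Compactness makes \<open>g\<close> a closed map onto its image, so its inverse
  \<open>f\<close> composes continuously with \<open>e\<close>. The source is a
  \<open>topology\<close> value because each piece of a limit sequence carries its own
  topology.\<close>

lemma continuous_on_factor_through_compact:
  fixes g :: "'b \<Rightarrow> 'c::topological_space" and e :: "'b \<Rightarrow> 'd::topological_space"
  assumes cl: "\<And>T::'c set. compact T \<Longrightarrow> closed T" and X: "compact_space X"
    and g: "continuous_map X euclidean g" and e: "continuous_map X euclidean e"
    and f: "\<And>p. p \<in> topspace X \<Longrightarrow> f (g p) = p"
  shows "continuous_on (g ` topspace X) (\<lambda>a. e (f a))"
  unfolding continuous_on_closed_invariant
proof (intro allI impI)
  fix B :: "'d set" assume "closed B"
  then have "closedin X {p \<in> topspace X. e p \<in> B}"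
    using e by (simp add: closedin_continuous_map_preimage)
  then have "compactin X {p \<in> topspace X. e p \<in> B}" by (rule closedin_compact_space[OF X])
  from image_compactin[OF this g] have "closed (g ` {p \<in> topspace X. e p \<in> B})" by (intro cl) simp
  moreover have "g ` {p \<in> topspace X. e p \<in> B} \<inter> g ` topspace X = (\<lambda>a. e (f a)) -` B \<inter> g ` topspace X"
  proof (intro equalityI subsetI)
    fix a assume "a \<in> g ` {p \<in> topspace X. e p \<in> B} \<inter> g ` topspace X"
    then obtain p where "a = g p" "p \<in> topspace X" "e p \<in> B" by blast
    then show "a \<in> (\<lambda>a. e (f a)) -` B \<inter> g ` topspace X" using f by simp
  next
    fix a assume a: "a \<in> (\<lambda>a. e (f a)) -` B \<inter> g ` topspace X"
    then obtain p where p: "a = g p" "p \<in> topspace X" by blast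
    then have "e p \<in> B" using a f by simp
    then show "a \<in> g ` {p \<in> topspace X. e p \<in> B} \<inter> g ` topspace X" using p by blast
  qed
  ultimately show "\<exists>A. closed A \<and> A \<inter> g ` topspace X = (\<lambda>a. e (f a)) -` B \<inter> g ` topspace X" by blast
qed

lemma closedin_direct_limit:
  "closedin (direct_limit K) F \<longleftrightarrow>
    F \<subseteq> (\<Union>n. topspace (K n)) \<and> (\<forall>n. closedin (K n) (F \<inter> topspace (K n)))"
proof -
  have *: "((\<Union>n. topspace (K n)) - F) \<inter> topspace (K n) = topspace (K n) - F \<inter> topspace (K n)" for n by auto
  show ?thesis by (auto simp: closedin_def openin_direct_limit *)
qed

lemma C_fd_infinity_imp_compacta_limit:
  assumes "C_fd_infinity (euclidean :: 'a::linear_topological_space topology)"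
  shows "\<exists>C :: nat \<Rightarrow> 'a set. compacta_limit C"
proof -
  obtain K :: "nat \<Rightarrow> 'a topology" where K: "fd_compacta_sequence K"
    "(euclidean :: 'a topology) homeomorphic_space direct_limit K"
    using assms by (auto simp: C_fd_infinity_def)
  have Kn: "compact_space (K n)" "metrizable_space (K n)" "finite_covering_dim (K n)"
    and K_Suc: "topspace (K n) \<subseteq> topspace (K (Suc n))" for n
    using K(1) by (auto simp: fd_compacta_sequence_def increasing_spaces_def)
  obtain f g where fg: "homeomorphic_maps (euclidean :: 'a topology) (direct_limit K) f g"
    using K(2) by (auto simp: homeomorphic_space_def)
  then have f: "homeomorphic_map euclidean (direct_limit K) f"
    unfolding homeomorphic_maps_map by blast
  from fg have g: "continuous_map (direct_limit K) euclidean g"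
    and gf: "\<And>a. g (f a) = a" and fg': "\<And>p n. p \<in> topspace (K n) \<Longrightarrow> f (g p) = p"
    by (auto simp: homeomorphic_maps_def)
  have f_closed: "closed F \<longleftrightarrow> closedin (direct_limit K) (f ` F)" for F
    using homeomorphic_map_closedness[OF f, of F] by simp
  have f_top: "f a \<in> (\<Union>n. topspace (K n))" for a
    using homeomorphic_imp_surjective_map[OF f] by auto
  have gK: "continuous_map (K n) euclidean g" for n
    unfolding continuous_map_closedin
  proof (intro conjI allI impI)
    fix S assume "closedin (euclidean :: 'a topology) S"
    then have "closedin (direct_limit K) {p \<in> topspace (direct_limit K). g p \<in> S}"
      using g closedin_continuous_map_preimage by blast
    then have "closedin (K n) ({p \<in> topspace (direct_limit K). g p \<in> S} \<inter> topspace (K n))"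
      by (simp add: closedin_direct_limit)
    moreover have "{p \<in> topspace (direct_limit K). g p \<in> S} \<inter> topspace (K n) = {p \<in> topspace (K n). g p \<in> S}"
      by auto
    ultimately show "closedin (K n) {p \<in> topspace (K n). g p \<in> S}" by simp
  qed simp
  define C where "C n = g ` topspace (K n)" for n
  have C: "compact (C n)" for n
    using image_compactin[OF _ gK[of n], of "topspace (K n)"] Kn(1) by (simp add: C_def compact_space_def)
  have fC: "f ` (F \<inter> C n) = f ` F \<inter> topspace (K n)" for F n
  proof (intro equalityI subsetI)
    fix x assume "x \<in> f ` (F \<inter> C n)"
    then obtain p where p: "x = f (g p)" "g p \<in> F" "p \<in> topspace (K n)" by (auto simp: C_def)
    then have "x \<in> topspace (K n)" using fg' by simp
    then show "x \<in> f ` F \<inter> topspace (K n)" using p(1,2) by blast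
  next
    fix x assume x: "x \<in> f ` F \<inter> topspace (K n)"
    then obtain a where a: "x = f a" "a \<in> F" by blast
    then have "a = g x" using gf by simp
    then have "a \<in> C n" using x by (simp add: C_def)
    then show "x \<in> f ` (F \<inter> C n)" using a by blast
  qed
  \<comment> \<open>A point is closed in the limit because it is closed in every metrizable piece.
    The Hausdorff property of the whole space then comes from its group structure.\<close>
  have sing: "closed {a}" for a :: 'a
    unfolding f_closed closedin_direct_limit
  proof (intro conjI allI)
    show "f ` {a} \<subseteq> (\<Union>n. topspace (K n))" using f_top by simp
    fix n show "closedin (K n) (f ` {a} \<inter> topspace (K n))"
      using metrizable_imp_Hausdorff_space[OF Kn(2)[of n]]
      by (cases "f a \<in> topspace (K n)") (auto simp: closedin_Hausdorff_singleton)
  qed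
  have "compacta_limit C"
  proof
    show "compact (C n)" for n by (rule C)
    show "C n \<subseteq> C (Suc n)" for n using K_Suc by (auto simp: C_def)
    show "(\<Union>n. C n) = UNIV"
    proof -
      have "a \<in> (\<Union>n. C n)" for a
      proof -
        obtain n where "f a \<in> topspace (K n)" using f_top by blast
        then have "g (f a) \<in> C n" unfolding C_def by (rule imageI)
        then show ?thesis using gf by auto
      qed
      then show ?thesis by blast
    qed
    show "closed {a}" for a :: 'a by (rule sing)
    show "closed F" if cl: "\<And>n. closed (F \<inter> C n)" for F
      unfolding f_closed closedin_direct_limit
    proof (intro conjI allI)
      show "f ` F \<subseteq> (\<Union>n. topspace (K n))" using f_top by blast
      fix n
      have "closedin (K n) (f ` (F \<inter> C n) \<inter> topspace (K n))"
        using cl[of n] unfolding f_closed closedin_direct_limit by blast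
      then show "closedin (K n) (f ` F \<inter> topspace (K n))" unfolding fC by (simp add: Int_assoc)
    qed
    show "\<exists>e k. continuous_on (C n) e \<and> inj_on e (C n) \<and> e ` C n \<subseteq> Rn k" for n
    proof -
      obtain e :: "'a \<Rightarrow> nat \<Rightarrow> real" and k where
        e: "continuous_map (K n) euclidean e" "inj_on e (topspace (K n))" "e ` topspace (K n) \<subseteq> Rn k"
        by (rule finite_dimensional_compactum_embeds_into_Rn[OF Kn])
      have "continuous_on (C n) (\<lambda>a. e (f a))"
        unfolding C_def
        by (rule continuous_on_factor_through_compact[OF compact_imp_closed_if_closed_singletons[OF sing]
              Kn(1) gK e(1) fg'])
      moreover have "inj_on (\<lambda>a. e (f a)) (C n)"
      proof (rule inj_onI)
        fix a b assume "a \<in> C n" "b \<in> C n" and eq: "e (f a) = e (f b)"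
        then have "f a \<in> topspace (K n)" "f b \<in> topspace (K n)" using fg' by (auto simp: C_def)
        then have "f a = f b" using e(2) eq by (simp add: inj_on_eq_iff)
        then show "a = b" using gf by metis
      qed
      moreover have "(\<lambda>a. e (f a)) ` C n \<subseteq> Rn k" using e(3) fg' by (auto simp: C_def)
      ultimately show ?thesis by blast
    qed
  qed
  then show ?thesis by blast
qed

theorem mainTheorem1:
  assumes "infinite_dimensional TYPE('a::linear_topological_space)"
    and "C_fd_infinity (euclidean :: 'a topology)"
  shows "(euclidean :: 'a topology) homeomorphic_space R_infinity \<and>
    (locally_convex TYPE('a) \<longrightarrow>
      (\<exists>f :: 'a \<Rightarrow> nat \<Rightarrow> real. linear_homeomorphism_R_infinity f))"
proof -
  obtain C :: "nat \<Rightarrow> 'a set" where "compacta_limit C"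
    using C_fd_infinity_imp_compacta_limit[OF assms(2)] by blast
  then interpret compacta_limit C .
  show ?thesis
    using homeomorphic_R_infinity[OF assms(1)] locally_convex_linear_homeomorphism[OF assms(1)] by blast
qed

end
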